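(* Let $K$ be a commutative Frobenius ring and let $R$ be a (unital, associative, possibly noncommutative) $K$-algebra that is finitely generated as a $K$-module. Then $R$ is a non projective Frobenius $K$-algebra if and only if $R$ is a Frobenius ring.
   Context: All rings are unital and possibly noncommutative. A left and right artinian ring $A$ with Jacobson radical $J$ is called Frobenius if $\operatorname{Soc}({}_AA)\cong A/J$ as left $A$-modules and $\operatorname{Soc}(A_A)\cong A/J$ as right $A$-modules, where $\operatorname{Soc}$ denotes the socle. Let $R$ be an algebra over a commutative Frobenius ring $K$. A $K$-bilinear form $\langle -,-\rangle : R\times R\to K$ is associative if $\langle bb',b''\rangle=\langle b,b'b''\rangle$ for all $b,b',b''\in R$. It is non degenerate if both maps $\alpha,\beta: R\to R^*=\operatorname{Hom}_K(R,K)$, $\alpha(b)(b')=\langle b,b'\rangle=\beta(b')(b)$, are injective. The algebra $R$ is called non projective Frobenius over $K$ if $R$ is finitely generated as a $K$-module and there exists an associative non degenerate $K$-bilinear form $R\times R\to K$ ("non projective" means "not necessarily projective" as a $K$-module). *)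

theory Defs
  imports "HOL-Algebra.QuotRing" "HOL-Algebra.Module" "HOL-Algebra.Generated_Groups"
begin

section \<open>One-sided modules over a possibly noncommutative ring\<close>

text \<open>
  The locale \<^locale>\<open>module\<close> requires a commutative ring of scalars, but the record of modules and
  the locale \<^locale>\<open>submodule\<close> do not; both are used here for left modules over an arbitrary ring.
  Right \<open>A\<close>-modules are treated as left modules over the opposite ring.
\<close>

definition opposite_ring :: "('a, 'm) ring_scheme \<Rightarrow> ('a, 'm) ring_scheme" where
  "opposite_ring A = A\<lparr>monoid.mult := \<lambda>x y. y \<otimes>\<^bsub>A\<^esub> x\<rparr>"

definition regular_module :: "('a, 'm) ring_scheme \<Rightarrow> ('a, 'a) module" where
  "regular_module A =
    \<lparr>carrier = carrier A, monoid.mult = monoid.mult A, one = one A, zero = zero A, add = add A,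
     smult = monoid.mult A\<rparr>"

text \<open>
  The multiplicative fields of a factor module are irrelevant; they are only present because the
  module record extends the ring record.
\<close>

definition factor_module :: "('a, 'b, 'm) module_scheme \<Rightarrow> 'b set \<Rightarrow> ('a, 'b set) module" where
  "factor_module M N =
    \<lparr>carrier = a_rcosets\<^bsub>M\<^esub> N, monoid.mult = rcoset_mult M N, one = N +>\<^bsub>M\<^esub> \<one>\<^bsub>M\<^esub>,
     zero = N, add = set_add M, smult = (\<lambda>a X. \<Union>x\<in>X. N +>\<^bsub>M\<^esub> (a \<odot>\<^bsub>M\<^esub> x))\<rparr>"

definition module_isomorphic ::
  "('a, 'k) ring_scheme \<Rightarrow> ('a, 'b, 'm) module_scheme \<Rightarrow> ('a, 'c, 'n) module_scheme \<Rightarrow> bool" where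
  "module_isomorphic A M N \<longleftrightarrow>
    (\<exists>h. bij_betw h (carrier M) (carrier N) \<and>
      (\<forall>x\<in>carrier M. \<forall>y\<in>carrier M. h (x \<oplus>\<^bsub>M\<^esub> y) = h x \<oplus>\<^bsub>N\<^esub> h y) \<and>
      (\<forall>a\<in>carrier A. \<forall>x\<in>carrier M. h (a \<odot>\<^bsub>M\<^esub> x) = a \<odot>\<^bsub>N\<^esub> h x))"

definition simple_submodule ::
  "'b set \<Rightarrow> ('a, 'k) ring_scheme \<Rightarrow> ('a, 'b, 'm) module_scheme \<Rightarrow> bool" where
  "simple_submodule S A M \<longleftrightarrow>
    submodule S A M \<and> S \<noteq> {\<zero>\<^bsub>M\<^esub>} \<and>
    (\<forall>N. submodule N A M \<and> N \<subseteq> S \<longrightarrow> N = {\<zero>\<^bsub>M\<^esub>} \<or> N = S)"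

text \<open>The sum of all simple submodules, i.e. the additive subgroup generated by their union.\<close>

definition socle :: "('a, 'k) ring_scheme \<Rightarrow> ('a, 'b, 'm) module_scheme \<Rightarrow> 'b set" where
  "socle A M = generate (add_monoid M) (\<Union>{S. simple_submodule S A M})"

definition socle_module ::
  "('a, 'k) ring_scheme \<Rightarrow> ('a, 'b, 'm) module_scheme \<Rightarrow> ('a, 'b, 'm) module_scheme" where
  "socle_module A M = M\<lparr>carrier := socle A M\<rparr>"


section \<open>Frobenius rings\<close>

definition left_ideal :: "'a set \<Rightarrow> ('a, 'm) ring_scheme \<Rightarrow> bool" where
  "left_ideal I A \<longleftrightarrow> submodule I A (regular_module A)"

definition left_artinian :: "('a, 'm) ring_scheme \<Rightarrow> bool" where
  "left_artinian A \<longleftrightarrow>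
    (\<forall>I :: nat \<Rightarrow> 'a set. (\<forall>n. left_ideal (I n) A) \<and> (\<forall>n. I (Suc n) \<subseteq> I n) \<longrightarrow>
      (\<exists>n. \<forall>m\<ge>n. I m = I n))"

definition right_artinian :: "('a, 'm) ring_scheme \<Rightarrow> bool" where
  "right_artinian A \<longleftrightarrow> left_artinian (opposite_ring A)"

definition maximal_left_ideal :: "'a set \<Rightarrow> ('a, 'm) ring_scheme \<Rightarrow> bool" where
  "maximal_left_ideal I A \<longleftrightarrow>
    left_ideal I A \<and> I \<noteq> carrier A \<and>
    (\<forall>L. left_ideal L A \<and> I \<subseteq> L \<longrightarrow> L = I \<or> L = carrier A)"

text \<open>The intersection is taken inside the carrier, so the radical of the zero ring is the ring.\<close>

definition jacobson_radical :: "('a, 'm) ring_scheme \<Rightarrow> 'a set" where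
  "jacobson_radical A = carrier A \<inter> \<Inter>{I. maximal_left_ideal I A}"

definition frobenius_ring :: "('a, 'm) ring_scheme \<Rightarrow> bool" where
  "frobenius_ring A \<longleftrightarrow>
    ring A \<and> left_artinian A \<and> right_artinian A \<and>
    module_isomorphic A
      (socle_module A (regular_module A))
      (factor_module (regular_module A) (jacobson_radical A)) \<and>
    module_isomorphic (opposite_ring A)
      (socle_module (opposite_ring A) (regular_module (opposite_ring A)))
      (factor_module (regular_module (opposite_ring A)) (jacobson_radical A))"


section \<open>Algebras with an associative non degenerate form\<close>

text \<open>
  In contrast to \<^locale>\<open>algebra\<close>, the multiplication of \<open>R\<close> need not be commutative, so
  compatibility with the scalars is required in both arguments.
\<close>

locale unital_algebra = module K R + ring R
  for K :: "('k, 'm) ring_scheme" and R :: "('k, 'r, 'n) module_scheme" +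
  assumes smult_mult_left:
      "\<lbrakk>a \<in> carrier K; x \<in> carrier R; y \<in> carrier R\<rbrakk> \<Longrightarrow>
        (a \<odot>\<^bsub>R\<^esub> x) \<otimes>\<^bsub>R\<^esub> y = a \<odot>\<^bsub>R\<^esub> (x \<otimes>\<^bsub>R\<^esub> y)"
    and smult_mult_right:
      "\<lbrakk>a \<in> carrier K; x \<in> carrier R; y \<in> carrier R\<rbrakk> \<Longrightarrow>
        x \<otimes>\<^bsub>R\<^esub> (a \<odot>\<^bsub>R\<^esub> y) = a \<odot>\<^bsub>R\<^esub> (x \<otimes>\<^bsub>R\<^esub> y)"

definition finitely_generated_module ::
  "('k, 'm) ring_scheme \<Rightarrow> ('k, 'r, 'n) module_scheme \<Rightarrow> bool" where
  "finitely_generated_module K M \<longleftrightarrow>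
    (\<exists>S. finite S \<and> S \<subseteq> carrier M \<and>
      carrier M = {\<Oplus>\<^bsub>M\<^esub>s\<in>S. c s \<odot>\<^bsub>M\<^esub> s | c. c \<in> S \<rightarrow> carrier K})"

definition bilinear_form ::
  "('k, 'm) ring_scheme \<Rightarrow> ('k, 'r, 'n) module_scheme \<Rightarrow> ('r \<Rightarrow> 'r \<Rightarrow> 'k) \<Rightarrow> bool" where
  "bilinear_form K M f \<longleftrightarrow>
    f \<in> carrier M \<rightarrow> carrier M \<rightarrow> carrier K \<and>
    (\<forall>x\<in>carrier M. \<forall>y\<in>carrier M. \<forall>z\<in>carrier M.
      f (x \<oplus>\<^bsub>M\<^esub> y) z = f x z \<oplus>\<^bsub>K\<^esub> f y z \<and>
      f x (y \<oplus>\<^bsub>M\<^esub> z) = f x y \<oplus>\<^bsub>K\<^esub> f x z) \<and>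
    (\<forall>a\<in>carrier K. \<forall>x\<in>carrier M. \<forall>y\<in>carrier M.
      f (a \<odot>\<^bsub>M\<^esub> x) y = a \<otimes>\<^bsub>K\<^esub> f x y \<and>
      f x (a \<odot>\<^bsub>M\<^esub> y) = a \<otimes>\<^bsub>K\<^esub> f x y)"

definition associative_form ::
  "('k, 'r, 'n) module_scheme \<Rightarrow> ('r \<Rightarrow> 'r \<Rightarrow> 'k) \<Rightarrow> bool" where
  "associative_form R f \<longleftrightarrow>
    (\<forall>x\<in>carrier R. \<forall>y\<in>carrier R. \<forall>z\<in>carrier R. f (x \<otimes>\<^bsub>R\<^esub> y) z = f x (y \<otimes>\<^bsub>R\<^esub> z))"

text \<open>
  The two maps from \<open>R\<close> to its dual; functionals are restricted to the carrier of \<open>R\<close>, so that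
  two of them are equal iff they agree on \<open>R\<close>.
\<close>

definition form_alpha ::
  "('k, 'r, 'n) module_scheme \<Rightarrow> ('r \<Rightarrow> 'r \<Rightarrow> 'k) \<Rightarrow> 'r \<Rightarrow> 'r \<Rightarrow> 'k" where
  "form_alpha R f b = (\<lambda>b'\<in>carrier R. f b b')"

definition form_beta ::
  "('k, 'r, 'n) module_scheme \<Rightarrow> ('r \<Rightarrow> 'r \<Rightarrow> 'k) \<Rightarrow> 'r \<Rightarrow> 'r \<Rightarrow> 'k" where
  "form_beta R f b' = (\<lambda>b\<in>carrier R. f b b')"

definition nondegenerate_form ::
  "('k, 'r, 'n) module_scheme \<Rightarrow> ('r \<Rightarrow> 'r \<Rightarrow> 'k) \<Rightarrow> bool" where
  "nondegenerate_form R f \<longleftrightarrow>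
    inj_on (form_alpha R f) (carrier R) \<and> inj_on (form_beta R f) (carrier R)"

definition nonprojective_frobenius_algebra ::
  "('k, 'm) ring_scheme \<Rightarrow> ('k, 'r, 'n) module_scheme \<Rightarrow> bool" where
  "nonprojective_frobenius_algebra K R \<longleftrightarrow>
    unital_algebra K R \<and> finitely_generated_module K R \<and>
    (\<exists>f. bilinear_form K R f \<and> associative_form R f \<and> nondegenerate_form R f)"

end

theory Submission
  imports Defs
begin

text \<open>
  Over a commutative Frobenius ring \<open>K\<close> the functor \<open>Hom(-, K)\<close> behaves like a duality on finitely
  generated modules: \<open>K\<close> satisfies Baer's criterion, because \<open>I \<mapsto> Ann I\<close> reverses lengths of ideals,
  and functionals separate points. A form is the same as a functional \<open>f\<close> on \<open>R\<close> whose kernel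
  contains no nonzero left and no nonzero right ideal. On \<open>R / J\<close> such a functional \<open>m\<close> always
  exists, built from a decomposition of \<open>1\<close> into primitive idempotents. Given \<open>f\<close>, the element \<open>z\<close>
  with \<open>m = f (- z)\<close> generates the left socle and has annihilator \<open>J\<close>, so \<open>a \<mapsto> a z\<close> identifies
  \<open>R / J\<close> with the socle. Conversely such a \<open>z\<close> transports \<open>m\<close> to the left socle, and an extension
  of it to \<open>R\<close> is nondegenerate on the left; likewise on the right. A chain condition argument shows
  that one of these functionals is nondegenerate on both sides.
\<close>

section \<open>Left ideals\<close>

text \<open>Nondegeneracy of a functional \<open>l\<close> only says that a map such as
  \<open>u \<mapsto> l (u -)\<close> is injective, and as \<open>R\<close> need not be projective
  over \<open>K\<close>, no count of ranks makes such a map surjective. Baer's criterion takes over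
  this role: a functional that vanishes on the common kernel of the maps \<open>l (- y)\<close> is
  itself of the form \<open>l (- z)\<close>. Thus injectivity of \<open>u \<mapsto> l (u -)\<close>
  gives surjectivity of \<open>z \<mapsto> l (- z)\<close>. The forward direction uses this twice,
  for \<open>l\<close> to find \<open>z\<close>, and for \<open>m\<close> to see that each socle
  element is a multiple of \<open>z\<close>. In the converse direction the left and the right socle
  yield two functionals with no visible relation, each nondegenerate on one side; this is the
  obstacle that calls for the chain argument. Lengths are compared only among ideals of
  \<open>K\<close>. That they are finite has to be derived from the descending chain condition
  first.\<close>

definition adjoin :: "('a, 'm) ring_scheme \<Rightarrow> 'a set \<Rightarrow> 'a \<Rightarrow> 'a set" where
  "adjoin A I a = {x \<oplus>\<^bsub>A\<^esub> b \<otimes>\<^bsub>A\<^esub> a | x b. x \<in> I \<and> b \<in> carrier A}"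

text \<open>Says that \<open>V / U\<close> is a simple module without forming factor
  modules.\<close>

definition covered_by :: "('a, 'm) ring_scheme \<Rightarrow> 'a set \<Rightarrow> 'a set \<Rightarrow> bool" where
  "covered_by A U V \<longleftrightarrow> left_ideal U A \<and> left_ideal V A \<and> U \<subset> V \<and>
    (\<forall>W. left_ideal W A \<and> U \<subseteq> W \<and> W \<subseteq> V \<longrightarrow> W = U \<or> W = V)"

context ring
begin

lemma left_ideal_iff:
  "left_ideal I R \<longleftrightarrow> I \<subseteq> carrier R \<and> \<zero> \<in> I \<and> (\<forall>x\<in>I. \<forall>y\<in>I. x \<oplus> y \<in> I) \<and>
    (\<forall>a\<in>carrier R. \<forall>x\<in>I. a \<otimes> x \<in> I)" (is "?l \<longleftrightarrow> ?r")
proof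
  assume ?l
  then interpret submodule I R "regular_module R" by (simp add: left_ideal_def)
  show ?r
    using subset m_closed one_closed smult_closed by (auto simp: regular_module_def)
next
  assume r: ?r
  have "\<ominus> x \<in> I" if "x \<in> I" for x
  proof -
    have "\<ominus> \<one> \<otimes> x \<in> I" using r that by blast
    moreover have "x \<in> carrier R" using r that by blast
    ultimately show ?thesis by (simp add: l_minus)
  qed
  then have "inv\<^bsub>add_monoid (regular_module R)\<^esub> x \<in> I" if "x \<in> I" for x
    using that r by (simp add: regular_module_def a_inv_def m_inv_def)
  then show ?l using r
    unfolding left_ideal_def
    by (intro submodule.intro subgroup.intro submodule_axioms.intro)
      (auto simp: regular_module_def)
qed

lemma left_idealI:
  assumes "I \<subseteq> carrier R" "\<zero> \<in> I" "\<And>x y. x \<in> I \<Longrightarrow> y \<in> I \<Longrightarrow> x \<oplus> y \<in> I"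
    "\<And>a x. a \<in> carrier R \<Longrightarrow> x \<in> I \<Longrightarrow> a \<otimes> x \<in> I"
  shows "left_ideal I R"
  using assms by (simp add: left_ideal_iff)

lemma left_idealD:
  assumes "left_ideal I R"
  shows "I \<subseteq> carrier R" "\<And>x. x \<in> I \<Longrightarrow> x \<in> carrier R" "\<zero> \<in> I"
    "\<And>x y. x \<in> I \<Longrightarrow> y \<in> I \<Longrightarrow> x \<oplus> y \<in> I"
    "\<And>a x. a \<in> carrier R \<Longrightarrow> x \<in> I \<Longrightarrow> a \<otimes> x \<in> I"
  using assms by (auto simp: left_ideal_iff)

lemma left_ideal_a_inv:
  assumes "left_ideal I R" "x \<in> I"
  shows "\<ominus> x \<in> I"
  using left_idealD(5)[OF assms(1), of "\<ominus> \<one>" x] left_idealD(2)[OF assms]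
    assms(2) by (simp add: l_minus)

lemma left_ideal_minus:
  assumes "left_ideal I R" "x \<in> I" "y \<in> I"
  shows "x \<ominus> y \<in> I"
  using left_idealD(4)[OF assms(1,2) left_ideal_a_inv[OF assms(1,3)]] by (simp add: minus_eq)

lemma left_ideal_sum_cancel:
  assumes "left_ideal I R" "x \<oplus> y \<in> I" "x \<in> I" "y \<in> carrier R"
  shows "y \<in> I"
proof -
  have "\<ominus> x \<oplus> (x \<oplus> y) \<in> I" using left_idealD(4) left_ideal_a_inv assms by blast
  then show ?thesis using assms left_idealD(2)[OF assms(1)] by (simp add: r_neg2 r_neg1)
qed

lemma left_ideal_diff_cancel:
  assumes "left_ideal I R" "x \<ominus> y \<in> I" "y \<in> I" "x \<in> carrier R"
  shows "x \<in> I"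
proof -
  have "(x \<ominus> y) \<oplus> y \<in> I" using left_idealD(4) assms by blast
  moreover have "(x \<ominus> y) \<oplus> y = x"
    using assms left_idealD(2)[OF assms(1)] by (simp add: minus_eq a_assoc l_neg)
  ultimately show ?thesis by simp
qed

lemma left_ideal_diff_cancel':
  assumes "left_ideal I R" "x \<ominus> y \<in> I" "x \<in> I" "y \<in> carrier R"
  shows "y \<in> I"
proof -
  have "x \<ominus> (x \<ominus> y) \<in> I" using left_ideal_minus assms by blast
  moreover have "x \<ominus> (x \<ominus> y) = y"
    using assms left_idealD(2)[OF assms(1)] by algebra
  ultimately show ?thesis by simp
qed

lemma left_ideal_zero: "left_ideal {\<zero>} R"
  by (rule left_idealI) auto

lemma left_ideal_carrier: "left_ideal (carrier R) R"
  by (rule left_idealI) auto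

lemma left_ideal_Int: "left_ideal I R \<Longrightarrow> left_ideal J R \<Longrightarrow> left_ideal (I \<inter> J) R"
  by (auto simp: left_ideal_iff)

lemma left_ideal_Inter:
  assumes "\<And>I. I \<in> F \<Longrightarrow> left_ideal I R"
  shows "left_ideal (carrier R \<inter> \<Inter>F) R"
  using assms by (auto simp: left_ideal_iff)

lemma left_ideal_finsum:
  assumes "left_ideal I R" "finite S" "f \<in> S \<rightarrow> I"
  shows "finsum R f S \<in> I"
  using assms(2,3)
proof (induction)
  case empty
  then show ?case using left_idealD(3)[OF assms(1)] by simp
next
  case (insert x F)
  moreover have "f \<in> F \<rightarrow> carrier R" "f x \<in> carrier R"
    using insert left_idealD(2)[OF assms(1)] by auto
  ultimately show ?case using left_idealD(4)[OF assms(1)] by (simp add: finsum_insert)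
qed

lemma left_ideal_eq_carrier_iff:
  assumes "left_ideal I R"
  shows "I = carrier R \<longleftrightarrow> \<one> \<in> I"
  using left_idealD[OF assms] by (metis one_closed r_one subsetI subset_antisym)

lemma left_ideal_adjoin:
  assumes I: "left_ideal I R" and a: "a \<in> carrier R"
  shows "left_ideal (adjoin R I a) R" "I \<subseteq> adjoin R I a" "a \<in> adjoin R I a"
proof -
  note D = left_idealD[OF I]
  show "left_ideal (adjoin R I a) R"
  proof (rule left_idealI)
    show "adjoin R I a \<subseteq> carrier R" using D(2) a by (auto simp: adjoin_def)
    show "\<zero> \<in> adjoin R I a"
      unfolding adjoin_def using D(3) a by (auto intro!: exI[of _ \<zero>])
    fix x y assume "x \<in> adjoin R I a" "y \<in> adjoin R I a"
    then obtain u b v c where *: "x = u \<oplus> b \<otimes> a" "y = v \<oplus> c \<otimes> a" "u \<in> I" "v \<in> I"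
      "b \<in> carrier R" "c \<in> carrier R" by (auto simp: adjoin_def)
    have "x \<oplus> y = (u \<oplus> v) \<oplus> (b \<oplus> c) \<otimes> a"
      using * a D(2) by (simp add: l_distr a_ac)
    then show "x \<oplus> y \<in> adjoin R I a" using * D(4) by (force simp: adjoin_def)
  next
    fix r x assume r: "r \<in> carrier R" and "x \<in> adjoin R I a"
    then obtain u b where *: "x = u \<oplus> b \<otimes> a" "u \<in> I" "b \<in> carrier R"
      by (auto simp: adjoin_def)
    have "r \<otimes> x = r \<otimes> u \<oplus> (r \<otimes> b) \<otimes> a"
      using * a D(2) r by (simp add: r_distr m_assoc)
    then show "r \<otimes> x \<in> adjoin R I a" using * D(5) r by (force simp: adjoin_def)
  qed
  show "I \<subseteq> adjoin R I a"
  proof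
    fix x assume "x \<in> I"
    then have "x = x \<oplus> \<zero> \<otimes> a" using D(2) a by simp
    then show "x \<in> adjoin R I a" unfolding adjoin_def using \<open>x \<in> I\<close> by blast
  qed
  have "a = \<zero> \<oplus> \<one> \<otimes> a" using a by simp
  then show "a \<in> adjoin R I a" unfolding adjoin_def using D(3) by blast
qed

lemma adjoinE:
  assumes "x \<in> adjoin R I a"
  obtains u b where "x = u \<oplus> b \<otimes> a" "u \<in> I" "b \<in> carrier R"
  using assms by (auto simp: adjoin_def)

lemma adjoin_least:
  assumes "left_ideal L R" "I \<subseteq> L" "a \<in> L"
  shows "adjoin R I a \<subseteq> L"
  using left_idealD[OF assms(1)] assms(2,3) by (auto simp: adjoin_def)

lemma left_ideal_principal:
  assumes "a \<in> carrier R"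
  shows "left_ideal {r \<otimes> a | r. r \<in> carrier R} R"
proof (rule left_idealI)
  show "\<zero> \<in> {r \<otimes> a |r. r \<in> carrier R}" using assms by (force intro: exI[of _ \<zero>])
  fix x y assume "x \<in> {r \<otimes> a |r. r \<in> carrier R}" "y \<in> {r \<otimes> a |r. r \<in> carrier R}"
  then show "x \<oplus> y \<in> {r \<otimes> a |r. r \<in> carrier R}" using assms by (force simp: l_distr[symmetric])
next
  fix b x assume "b \<in> carrier R" "x \<in> {r \<otimes> a |r. r \<in> carrier R}"
  then show "b \<otimes> x \<in> {r \<otimes> a |r. r \<in> carrier R}" using assms by (force simp: m_assoc[symmetric])
qed (use assms in auto)

lemma left_ideal_annihilator:
  assumes "S \<subseteq> carrier R"
  shows "left_ideal {a \<in> carrier R. \<forall>x\<in>S. a \<otimes> x = \<zero>} R"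
  by (rule left_idealI) (use assms in \<open>auto simp: l_distr m_assoc subset_iff\<close>)

text \<open>If every member of \<open>S\<close> had a strictly smaller one, iterating a choice of it
  would give a strictly decreasing sequence of left ideals.\<close>

lemma left_artinian_minimal:
  assumes "left_artinian R" "S \<noteq> {}" "\<And>I. I \<in> S \<Longrightarrow> left_ideal I R"
  obtains I where "I \<in> S" "\<And>L. L \<in> S \<Longrightarrow> L \<subseteq> I \<Longrightarrow> L = I"
proof (rule ccontr)
  assume "\<not> thesis"
  then have "\<forall>I\<in>S. \<exists>L\<in>S. L \<subset> I" using that by (metis psubsetI)
  then obtain g where g: "\<And>I. I \<in> S \<Longrightarrow> g I \<in> S" "\<And>I. I \<in> S \<Longrightarrow> g I \<subset> I" by metis
  obtain I0 where I0: "I0 \<in> S" using assms(2) by blast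
  define f where "f n = (g ^^ n) I0" for n
  have fS: "f n \<in> S" for n by (induction n) (auto simp: f_def I0 g)
  have fs: "f (Suc n) \<subset> f n" for n using g(2)[OF fS[of n]] by (simp add: f_def)
  have "\<exists>n. \<forall>m\<ge>n. f m = f n"
    using assms(1) fs fS assms(3) unfolding left_artinian_def by blast
  then show False using fs by (metis le_SucI le_refl psubset_eq)
qed

lemma covered_byD:
  assumes "covered_by R U V"
  shows "left_ideal U R" "left_ideal V R" "U \<subset> V"
    "\<And>W. left_ideal W R \<Longrightarrow> U \<subseteq> W \<Longrightarrow> W \<subseteq> V \<Longrightarrow> W = U \<or> W = V"
  using assms by (auto simp: covered_by_def)

lemma covered_by_adjoin:
  assumes "covered_by R U V" "x \<in> V" "x \<notin> U"
  shows "adjoin R U x = V"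
proof -
  note c = covered_byD[OF assms(1)]
  have x: "x \<in> carrier R" using left_idealD(2)[OF c(2)] assms by blast
  show ?thesis
    using c(4)[OF left_ideal_adjoin(1,2)[OF c(1) x]] left_ideal_adjoin(3)[OF c(1) x] assms
      adjoin_least[OF c(2), of U x] c(3) by blast
qed

lemma maximal_left_idealD:
  assumes "maximal_left_ideal M R"
  shows "left_ideal M R" "M \<noteq> carrier R" "\<one> \<notin> M"
    "\<And>L. left_ideal L R \<Longrightarrow> M \<subseteq> L \<Longrightarrow> L = M \<or> L = carrier R"
  using assms left_ideal_eq_carrier_iff by (auto simp: maximal_left_ideal_def)

text \<open>\<open>M + R x\<close> must be the whole ring, so \<open>\<one>\<close> splits. This is
  how simplicity of \<open>R / M\<close> is used below: an element outside \<open>M\<close> has a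
  left inverse modulo \<open>M\<close>.\<close>

lemma maximal_left_ideal_split:
  assumes M: "maximal_left_ideal M R" and x: "x \<in> carrier R" "x \<notin> M"
  obtains b where "b \<in> carrier R" "\<one> \<ominus> b \<otimes> x \<in> M"
proof -
  note D = maximal_left_idealD[OF M]
  have "adjoin R M x = carrier R"
    using D(4)[OF left_ideal_adjoin(1,2)[OF D(1) x(1)]] left_ideal_adjoin(3)[OF D(1) x(1)] x by blast
  then obtain u b where *: "\<one> = u \<oplus> b \<otimes> x" "u \<in> M" "b \<in> carrier R"
    by (metis adjoinE one_closed)
  moreover have "u \<in> carrier R" using * left_idealD(2)[OF D(1)] by blast
  ultimately have "\<one> \<ominus> b \<otimes> x = u" using x by (simp add: minus_eq a_assoc r_neg)
  then show ?thesis using that * by metis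
qed

end

section \<open>Length of ideals\<close>

text \<open>The existence of such a function stands for the existence of a composition series,
  without choosing one and without the Jordan-Hoelder theorem. The value at the zero ideal is left
  open, hence the summand \<open>l {\<zero>}\<close> in the later count.\<close>

definition length_function :: "('a, 'm) ring_scheme \<Rightarrow> 'a set \<Rightarrow> ('a set \<Rightarrow> nat) \<Rightarrow> bool" where
  "length_function A I l \<longleftrightarrow>
    (\<forall>U V. left_ideal U A \<longrightarrow> left_ideal V A \<longrightarrow> U \<subset> V \<longrightarrow> V \<subseteq> I \<longrightarrow> l U < l V) \<and>
    (\<forall>U V. covered_by A U V \<longrightarrow> V \<subseteq> I \<longrightarrow> l V = Suc (l U))"

definition finite_length :: "('a, 'm) ring_scheme \<Rightarrow> 'a set \<Rightarrow> bool" where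
  "finite_length A I \<longleftrightarrow> (\<exists>l. length_function A I l)"

lemma finite_lengthI: "length_function A I l \<Longrightarrow> finite_length A I"
  by (auto simp: finite_length_def)

lemma length_functionI:
  assumes "\<And>U V. left_ideal U A \<Longrightarrow> left_ideal V A \<Longrightarrow> U \<subset> V \<Longrightarrow> V \<subseteq> I \<Longrightarrow> l U < l V"
    "\<And>U V. covered_by A U V \<Longrightarrow> V \<subseteq> I \<Longrightarrow> l V = Suc (l U)"
  shows "length_function A I l"
  unfolding length_function_def using assms by simp

lemma length_functionD:
  assumes "length_function A I l"
  shows "left_ideal U A \<Longrightarrow> left_ideal V A \<Longrightarrow> U \<subset> V \<Longrightarrow> V \<subseteq> I \<Longrightarrow> l U < l V"
    "covered_by A U V \<Longrightarrow> V \<subseteq> I \<Longrightarrow> l V = Suc (l U)"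
  using assms unfolding length_function_def by simp_all

context ring
begin

lemma finite_length_zero: "finite_length R {\<zero>}"
proof -
  have no: False if "left_ideal U R" "U \<subset> V" "V \<subseteq> {\<zero>}" for U V
  proof -
    have "\<zero> \<in> U" using left_idealD(3) that(1) .
    then show False using that(2,3) by blast
  qed
  have "length_function R {\<zero>} (\<lambda>_. 0)"
  proof (rule length_functionI)
    fix U V assume "covered_by R U V" "V \<subseteq> {\<zero>}"
    then show "0 = Suc 0" using no[OF covered_byD(1,3)] by blast
  next
    fix U V assume "left_ideal U R" "U \<subset> V" "V \<subseteq> {\<zero>}"
    then show "(0::nat) < 0" using no by blast
  qed
  then show ?thesis by (rule finite_lengthI)
qed

text \<open>A length function on the subideals of \<open>W\<close> extends to those of \<open>I\<close> by
  \<open>U \<mapsto> l (U \<inter> W) + [U \<not>\<subseteq> W]\<close>.\<close>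

lemma finite_length_covered:
  assumes c: "covered_by R W I" and f: "finite_length R W"
  shows "finite_length R I"
proof -
  obtain l where l: "length_function R W l" using f by (auto simp: finite_length_def)
  note l1 = length_functionD(1)[OF l] and l2 = length_functionD(2)[OF l]
  note c' = covered_byD[OF c]
  define k where "k U = l (U \<inter> W) + (if U \<subseteq> W then 0 else 1)" for U
  \<comment> \<open>\<open>U\<close> is not contained in the maximal proper subideal
    \<open>W\<close>, so \<open>U + W = I\<close>.\<close>
  have split: "\<exists>u\<in>U. x \<ominus> u \<in> W"
    if U: "left_ideal U R" "U \<subseteq> I" "\<not> U \<subseteq> W" and x: "x \<in> I" for U x
  proof -
    obtain y where y: "y \<in> U" "y \<notin> W" using U by blast
    have "adjoin R W y = I" by (rule covered_by_adjoin[OF c]) (use y U in auto)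
    then obtain w b where *: "x = w \<oplus> b \<otimes> y" "w \<in> W" "b \<in> carrier R"
      using x by (metis adjoinE)
    have "w \<in> carrier R" "y \<in> carrier R" using * y U left_idealD(2) c'(1) by blast+
    then have "x \<ominus> b \<otimes> y = w" using * by (simp add: minus_eq a_assoc r_neg)
    moreover have "b \<otimes> y \<in> U" using left_idealD(5)[OF U(1)] * y by blast
    ultimately show ?thesis using * by metis
  qed
  have mono: "k U < k V" if UV: "left_ideal U R" "left_ideal V R" "U \<subset> V" "V \<subseteq> I" for U V
  proof (cases "U \<inter> W = V \<inter> W")
    case False
    then have "l (U \<inter> W) < l (V \<inter> W)"
      using UV c'(1) by (intro l1 left_ideal_Int) auto
    then show ?thesis using UV by (auto simp: k_def)
  next
    case True
    have "U \<subseteq> W" "\<not> V \<subseteq> W"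
    proof -
      show "U \<subseteq> W"
      proof (rule ccontr)
        \<comment> \<open>Modular law: \<open>U + W = I\<close> together with
          \<open>U \<inter> W = V \<inter> W\<close> forces \<open>V = U\<close>.\<close>
        assume nW: "\<not> U \<subseteq> W"
        have "V \<subseteq> U"
        proof
          fix x assume x: "x \<in> V"
          then obtain u where u: "u \<in> U" "x \<ominus> u \<in> W" using split[OF UV(1) _ nW] UV by blast
          have "x \<ominus> u \<in> V" using left_ideal_minus[OF UV(2)] x u UV by blast
          then have "x \<ominus> u \<in> U" using u True by blast
          then show "x \<in> U" using left_ideal_diff_cancel[OF UV(1)] u x left_idealD(2)[OF UV(2)] by blast
        qed
        then show False using UV by blast
      qed
      then show "\<not> V \<subseteq> W" using True UV by blast
    qed
    then show ?thesis using True by (simp add: k_def)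
  qed
  have cov: "k V = Suc (k U)" if UV: "covered_by R U V" "V \<subseteq> I" for U V
  proof -
    note d = covered_byD[OF UV(1)]
    consider "V \<subseteq> W" | "U \<subseteq> W" "\<not> V \<subseteq> W" | "\<not> U \<subseteq> W" "\<not> V \<subseteq> W" using d(3) by blast
    then show ?thesis
    proof cases
      case 1
      then have "U \<subseteq> W" using d(3) by blast
      with 1 show ?thesis using l2[OF UV(1)] by (simp add: k_def Int_absorb2)
    next
      case 2
      have "V \<inter> W = U"
        using d(4)[OF left_ideal_Int[OF d(2) c'(1)]] d(3) 2 by blast
      moreover have "U \<inter> W = U" using 2 by blast
      ultimately show ?thesis using 2 by (simp add: k_def)
    next
      case 3
      \<comment> \<open>As \<open>U + W = I\<close>, the inclusion induces an isomorphism from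
        \<open>(V \<inter> W) / (U \<inter> W)\<close> to \<open>V / U\<close>, so the cover
        survives intersection with \<open>W\<close>.\<close>
      have "covered_by R (U \<inter> W) (V \<inter> W)"
        unfolding covered_by_def
      proof (intro conjI allI impI)
        show "left_ideal (U \<inter> W) R" "left_ideal (V \<inter> W) R" using d(1,2) c'(1) left_ideal_Int by blast+
        show "U \<inter> W \<subset> V \<inter> W"
        proof -
          have "l (U \<inter> W) < l (V \<inter> W)"
            using mono[OF d(1-3) UV(2)] 3 by (simp add: k_def)
          then have "U \<inter> W \<noteq> V \<inter> W" by auto
          then show ?thesis using d(3) by blast
        qed
        fix X assume X: "left_ideal X R \<and> U \<inter> W \<subseteq> X \<and> X \<subseteq> V \<inter> W"
        show "X = U \<inter> W \<or> X = V \<inter> W"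
        proof (cases "X \<subseteq> U")
          case True
          then show ?thesis using X by blast
        next
          case False
          then obtain y where y: "y \<in> X" "y \<notin> U" by blast
          have ad: "adjoin R U y = V" by (rule covered_by_adjoin[OF UV(1)]) (use y X in auto)
          have "V \<inter> W \<subseteq> X"
          proof
            fix x assume x: "x \<in> V \<inter> W"
            then obtain u b where *: "x = u \<oplus> b \<otimes> y" "u \<in> U" "b \<in> carrier R"
              using ad by (metis adjoinE IntD1)
            have by1: "b \<otimes> y \<in> X" using left_idealD(5) X * y by blast
            then have "x \<ominus> b \<otimes> y \<in> W" using left_ideal_minus[OF c'(1)] x X by blast
            moreover have "u \<in> carrier R" "b \<otimes> y \<in> carrier R"
              using left_idealD(2) d(1) *(2) by1 X by blast+
            then have "x \<ominus> b \<otimes> y = u" using * by (simp add: minus_eq a_assoc r_neg)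
            ultimately have "u \<in> X" using * X by blast
            then show "x \<in> X" using by1 * X left_idealD(4) by blast
          qed
          then show ?thesis using X by blast
        qed
      qed
      then show ?thesis using 3 l2 by (simp add: k_def)
    qed
  qed
  have "length_function R I k" by (rule length_functionI[OF mono cov])
  then show ?thesis by (rule finite_lengthI)
qed

text \<open>The lengths of proper subideals are bounded by that of \<open>I\<close>; a proper
  subideal of greatest length leaves no room below \<open>I\<close>.\<close>

lemma finite_length_maximal_sub:
  assumes I: "left_ideal I R" "finite_length R I" "I \<noteq> {\<zero>}"
  obtains W where "covered_by R W I"
proof -
  obtain l where l: "length_function R I l" using I(2) by (auto simp: finite_length_def)
  note l1 = length_functionD(1)[OF l]
  let ?P = "\<lambda>W. left_ideal W R \<and> W \<subset> I"
  have "\<forall>W. ?P W \<longrightarrow> l W < l I" using l1[OF _ I(1)] by simp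
  moreover have "?P {\<zero>}" using left_ideal_zero left_idealD(3)[OF I(1)] I(3) by blast
  ultimately obtain W where W: "?P W" "\<And>V. ?P V \<Longrightarrow> l V \<le> l W"
    using ex_has_greatest_nat[of ?P "{\<zero>}" l "l I"] by auto
  have "covered_by R W I"
    unfolding covered_by_def
  proof (intro conjI allI impI)
    fix V assume V: "left_ideal V R \<and> W \<subseteq> V \<and> V \<subseteq> I"
    show "V = W \<or> V = I"
    proof (rule ccontr)
      assume *: "\<not> (V = W \<or> V = I)"
      then have "l W < l V" using V W by (intro l1) auto
      moreover have "l V \<le> l W" using W(2) V * by blast
      ultimately show False by simp
    qed
  qed (use W I in auto)
  then show ?thesis using that by blast
qed

end

context ring
begin

lemma minus_eq_zero_iff:
  assumes "x \<in> carrier R" "y \<in> carrier R"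
  shows "x \<ominus> y = \<zero> \<longleftrightarrow> x = y"
  using assms by (metis a_inv_closed minus_eq minus_minus minus_equality r_neg)

text \<open>A union of a chain of ideals avoiding \<open>y\<close> still avoids \<open>y\<close>.
  With \<open>y = \<one>\<close> this yields maximal left ideals; with other \<open>y\<close> it
  serves where a maximal proper subideal of \<open>I\<close> is not yet known to exist.\<close>

lemma left_ideal_Zorn:
  assumes L: "left_ideal L R" "L \<subseteq> I" "y \<notin> L"
  obtains W where "left_ideal W R" "L \<subseteq> W" "W \<subseteq> I" "y \<notin> W"
    "\<And>V. left_ideal V R \<Longrightarrow> W \<subset> V \<Longrightarrow> V \<subseteq> I \<Longrightarrow> y \<in> V"
proof -
  define S where "S = {W. left_ideal W R \<and> L \<subseteq> W \<and> W \<subseteq> I \<and> y \<notin> W}"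
  have "L \<in> S" using L by (simp add: S_def)
  have "\<exists>W\<in>S. \<forall>X\<in>S. W \<subseteq> X \<longrightarrow> X = W"
  proof (rule subset_Zorn_nonempty)
    show "S \<noteq> {}" using \<open>L \<in> S\<close> by blast
    fix C assume C: "C \<noteq> {}" "subset.chain S C"
    have CS: "\<And>X. X \<in> C \<Longrightarrow> X \<in> S"
      and tot: "\<And>X Y. X \<in> C \<Longrightarrow> Y \<in> C \<Longrightarrow> X \<subseteq> Y \<or> Y \<subseteq> X"
      using C(2) by (auto simp: subset_chain_def)
    have id: "\<And>X. X \<in> C \<Longrightarrow> left_ideal X R" using CS by (simp add: S_def)
    obtain X0 where X0: "X0 \<in> C" using C(1) by blast
    have "left_ideal (\<Union>C) R"
    proof (rule left_idealI)
      show "\<Union>C \<subseteq> carrier R" using id left_idealD(1) by blast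
      show "\<zero> \<in> \<Union>C" using id left_idealD(3) X0 by blast
      fix u v assume "u \<in> \<Union>C" "v \<in> \<Union>C"
      then obtain X Y where XY: "X \<in> C" "Y \<in> C" "u \<in> X" "v \<in> Y" by blast
      then obtain Z where "Z \<in> C" "u \<in> Z" "v \<in> Z" using tot[of X Y] by blast
      then show "u \<oplus> v \<in> \<Union>C" using left_idealD(4)[OF id] by blast
    next
      fix a u assume "a \<in> carrier R" "u \<in> \<Union>C"
      then show "a \<otimes> u \<in> \<Union>C" using left_idealD(5)[OF id] by blast
    qed
    moreover have "L \<subseteq> \<Union>C" using CS[OF X0] X0 by (auto simp: S_def)
    moreover have "\<Union>C \<subseteq> I" "y \<notin> \<Union>C" using CS by (auto simp: S_def)
    ultimately show "\<Union>C \<in> S" by (simp add: S_def)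
  qed
  then obtain W where W: "W \<in> S" "\<And>X. X \<in> S \<Longrightarrow> W \<subseteq> X \<Longrightarrow> X = W" by blast
  show ?thesis
  proof (rule that[of W])
    fix V assume V: "left_ideal V R" "W \<subset> V" "V \<subseteq> I"
    show "y \<in> V"
    proof (rule ccontr)
      assume "y \<notin> V"
      then have "V \<in> S" using V W(1) by (auto simp: S_def)
      then show False using W(2) V(2) by blast
    qed
  qed (use W(1) in \<open>simp_all add: S_def\<close>)
qed

end

section \<open>Commutative artinian rings\<close>

context cring
begin

lemma left_ideal_image_mult:
  assumes a: "a \<in> carrier R" and I: "left_ideal I R"
  shows "left_ideal ((\<otimes>) a ` I) R"
proof (rule left_idealI)
  note D = left_idealD[OF I]
  show "(\<otimes>) a ` I \<subseteq> carrier R" using D(2) a by auto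
  show "\<zero> \<in> (\<otimes>) a ` I" using D(3) a by (auto intro!: image_eqI[of _ _ \<zero>])
  fix x y assume "x \<in> (\<otimes>) a ` I" "y \<in> (\<otimes>) a ` I"
  then obtain u v where *: "x = a \<otimes> u" "y = a \<otimes> v" "u \<in> I" "v \<in> I" by blast
  then have "x \<oplus> y = a \<otimes> (u \<oplus> v)" using D(2) a by (simp add: r_distr)
  then show "x \<oplus> y \<in> (\<otimes>) a ` I" using D(4)[OF *(3,4)] by blast
next
  note D = left_idealD[OF I]
  fix r x assume r: "r \<in> carrier R" and "x \<in> (\<otimes>) a ` I"
  then obtain u where *: "x = a \<otimes> u" "u \<in> I" by blast
  then have "r \<otimes> x = a \<otimes> (r \<otimes> u)" using D(2) a r by (simp add: m_lcomm)
  then show "r \<otimes> x \<in> (\<otimes>) a ` I" using D(5)[OF r *(2)] by blast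
qed

text \<open>Multiplication by \<open>a\<close> is linear by commutativity and maps \<open>I\<close>
  onto \<open>a I\<close>. Subideals of \<open>a I\<close> correspond to the subideals of
  \<open>I\<close> that contain its kernel, so maximal proper ones pull back to maximal proper
  ones.\<close>

lemma covered_by_preimage_mult:
  assumes a: "a \<in> carrier R" and I: "left_ideal I R" and c: "covered_by R W ((\<otimes>) a ` I)"
  shows "covered_by R {x \<in> I. a \<otimes> x \<in> W} I" (is "covered_by R ?V I")
  unfolding covered_by_def
proof (intro conjI allI impI)
  note c' = covered_byD[OF c] and D = left_idealD[OF I]
  show "left_ideal I R" by fact
  show "left_ideal ?V R"
  proof (rule left_idealI)
    fix r x assume r: "r \<in> carrier R" and x: "x \<in> ?V"
    have "r \<otimes> (a \<otimes> x) \<in> W" using left_idealD(5)[OF c'(1) r] x by blast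
    moreover have "a \<otimes> (r \<otimes> x) = r \<otimes> (a \<otimes> x)" using D(2) a r x by (simp add: m_lcomm)
    ultimately show "r \<otimes> x \<in> ?V" using D(5)[OF r] x by simp
  next
    fix x y assume xy: "x \<in> ?V" "y \<in> ?V"
    then have "a \<otimes> x \<oplus> a \<otimes> y \<in> W" using left_idealD(4)[OF c'(1)] by blast
    then show "x \<oplus> y \<in> ?V" using xy D(2,4) a by (simp add: r_distr)
  qed (use D a left_idealD(3)[OF c'(1)] in auto)
  show "?V \<subset> I" using c'(3) by blast
  fix X assume X: "left_ideal X R \<and> ?V \<subseteq> X \<and> X \<subseteq> I"
  have "W \<subseteq> (\<otimes>) a ` X"
  proof
    fix w assume w: "w \<in> W"
    then obtain x where "w = a \<otimes> x" "x \<in> I" using c'(3) by blast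
    then show "w \<in> (\<otimes>) a ` X" using X w by blast
  qed
  moreover have "(\<otimes>) a ` X \<subseteq> (\<otimes>) a ` I" using X by blast
  ultimately consider "(\<otimes>) a ` X = W" | "(\<otimes>) a ` X = (\<otimes>) a ` I"
    using c'(4)[OF left_ideal_image_mult[OF a]] X by blast
  then show "X = ?V \<or> X = I"
  proof cases
    case 1
    then show ?thesis using X by blast
  next
    case 2
    have "x \<in> X" if x: "x \<in> I" for x
    proof -
      \<comment> \<open>\<open>x\<close> and \<open>x'\<close> differ by an element of the kernel,
        which lies in the preimage of \<open>W\<close> and hence in \<open>X\<close>.\<close>
      obtain x' where x': "x' \<in> X" "a \<otimes> x = a \<otimes> x'" using 2 x by blast
      have x'I: "x' \<in> I" using x' X by blast
      have "a \<otimes> (x \<ominus> x') = \<zero>"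
        using a D(2)[OF x] D(2)[OF x'I] x' by (simp add: minus_eq r_distr r_minus r_neg)
      then have "x \<ominus> x' \<in> ?V"
        using left_ideal_minus[OF I x x'I] left_idealD(3)[OF c'(1)] by simp
      then have "x \<ominus> x' \<in> X" using X by blast
      then show "x \<in> X" using left_ideal_diff_cancel[of X x x'] X x' D(2)[OF x] by blast
    qed
    then show ?thesis using X by blast
  qed
qed

text \<open>Take a minimal ideal \<open>I\<close> without finite length. It has no maximal proper
  subideal, since that one would have finite length and pass it on to \<open>I\<close>. Consequently
  every \<open>a\<close> that does not kill \<open>I\<close> acts on it surjectively, and by the
  chain condition on the powers of \<open>a\<close> even invertibly. A subideal maximal among those
  avoiding a nonzero \<open>y\<close> then turns out to be maximal proper, a contradiction.\<close>

lemma artinian_finite_length: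
  assumes art: "left_artinian R" and L: "left_ideal L R"
  shows "finite_length R L"
proof (rule ccontr)
  assume "\<not> finite_length R L"
  then have "{I. left_ideal I R \<and> \<not> finite_length R I} \<noteq> {}" using L by blast
  then obtain I where "I \<in> {I. left_ideal I R \<and> \<not> finite_length R I}"
    and min: "\<And>U. U \<in> {I. left_ideal I R \<and> \<not> finite_length R I} \<Longrightarrow> U \<subseteq> I \<Longrightarrow> U = I"
    using left_artinian_minimal[OF art, of "{I. left_ideal I R \<and> \<not> finite_length R I}"]
    by (metis (no_types, lifting) mem_Collect_eq)
  then have I: "left_ideal I R" "\<not> finite_length R I" by simp_all
  have min': "finite_length R U" if "left_ideal U R" "U \<subset> I" for U
    using min[of U] that by blast
  note D = left_idealD[OF I(1)]
  have nocov: "\<not> covered_by R W I" for W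
  proof
    assume c: "covered_by R W I"
    show False using finite_length_covered[OF c min'[OF covered_byD(1,3)[OF c]]] I(2) by blast
  qed
  \<comment> \<open>If \<open>a I\<close> were proper, it would have finite length, hence a maximal
    proper subideal, whose preimage would be one of \<open>I\<close>.\<close>
  have surj: "(\<otimes>) a ` I = I" if a: "a \<in> carrier R" and ne: "(\<otimes>) a ` I \<noteq> {\<zero>}" for a
  proof (rule ccontr)
    assume "(\<otimes>) a ` I \<noteq> I"
    moreover have "(\<otimes>) a ` I \<subseteq> I" using D(5)[OF a] by blast
    ultimately have "finite_length R ((\<otimes>) a ` I)"
      by (intro min'[OF left_ideal_image_mult[OF a I(1)]]) auto
    then obtain W where "covered_by R W ((\<otimes>) a ` I)"
      by (rule finite_length_maximal_sub[OF left_ideal_image_mult[OF a I(1)] _ ne])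
    from nocov covered_by_preimage_mult[OF a I(1) this] show False by (rule notE)
  qed
  have inv: "\<exists>b\<in>carrier R. \<forall>x\<in>I. (b \<otimes> a) \<otimes> x = x"
    if a: "a \<in> carrier R" and ne: "(\<otimes>) a ` I \<noteq> {\<zero>}" for a
  proof -
    define f where "f n = {r \<otimes> a [^] n | r. r \<in> carrier R}" for n :: nat
    have "left_ideal (f n) R" for n using left_ideal_principal a by (simp add: f_def)
    moreover have "f (Suc n) \<subseteq> f n" for n
    proof
      fix x assume "x \<in> f (Suc n)"
      then obtain r where r: "r \<in> carrier R" "x = r \<otimes> a [^] (Suc n)" by (auto simp: f_def)
      then have "x = (r \<otimes> a) \<otimes> a [^] n" using a by (simp add: m_ac)
      then show "x \<in> f n" using r a by (auto simp: f_def)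
    qed
    ultimately obtain n where n: "f (Suc n) = f n"
      using art unfolding left_artinian_def by (meson le_SucI le_refl)
    \<comment> \<open>The ideals of the powers stabilise, so \<open>a^n = b a^(n+1)\<close>. Since
      \<open>a^n I = I\<close>, the product \<open>b a\<close> acts as the identity on
      \<open>I\<close>.\<close>
    have "\<one> \<otimes> a [^] n \<in> f n" unfolding f_def by blast
    then obtain b where b: "b \<in> carrier R" "\<one> \<otimes> a [^] n = b \<otimes> a [^] (Suc n)"
      using n by (auto simp: f_def)
    have pw: "\<exists>y\<in>I. x = a [^] k \<otimes> y" if "x \<in> I" for x and k :: nat
      using that
    proof (induction k arbitrary: x)
      case 0
      then show ?case using D(2) by (auto intro!: bexI[of _ x])
    next
      case (Suc k)
      then obtain y where y: "y \<in> I" "x = a [^] k \<otimes> y" by blast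
      then obtain w where w: "w \<in> I" "y = a \<otimes> w" using surj[OF a ne] by blast
      then have "x = a [^] Suc k \<otimes> w" using y D(2) a by (simp add: m_assoc)
      then show ?case using w by blast
    qed
    have "(b \<otimes> a) \<otimes> x = x" if xI: "x \<in> I" for x
    proof -
      obtain y where y: "y \<in> I" "x = a [^] n \<otimes> y" using pw[OF xI] by blast
      have yc: "y \<in> carrier R" using y D(2) by blast
      have "(b \<otimes> a) \<otimes> x = (b \<otimes> a [^] (Suc n)) \<otimes> y" using y yc a b by (simp add: m_ac)
      also have "\<dots> = x" using b(2)[symmetric] a y by simp
      finally show ?thesis .
    qed
    then show ?thesis using b by blast
  qed
  have "I \<noteq> {\<zero>}" using finite_length_zero I(2) by blast
  then obtain y where y: "y \<in> I" "y \<notin> {\<zero>}" using D(3) by blast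
  obtain W where W: "left_ideal W R" "W \<subseteq> I" "y \<notin> W"
    and max: "\<And>V. left_ideal V R \<Longrightarrow> W \<subset> V \<Longrightarrow> V \<subseteq> I \<Longrightarrow> y \<in> V"
    by (rule left_ideal_Zorn[OF left_ideal_zero, of I y]) (use D(3) y in auto)
  have yc: "y \<in> carrier R" using D(2) y by blast
  \<comment> \<open>For \<open>u\<close> outside \<open>W\<close>, write \<open>y = w + k u\<close>.
    As \<open>k u\<close> is nonzero, \<open>k\<close> can be inverted on \<open>I\<close>, which
    expresses \<open>u\<close> by \<open>y\<close> and \<open>w\<close>, both elements of
    \<open>V\<close>.\<close>
  have key: "I \<subseteq> V" if V: "left_ideal V R" "W \<subset> V" "V \<subseteq> I" for V
  proof
    fix u assume u: "u \<in> I"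
    have yV: "y \<in> V" using max[OF V] .
    have uc: "u \<in> carrier R" using D(2) u by blast
    show "u \<in> V"
    proof (cases "u \<in> W")
      case False
      note ad = left_ideal_adjoin[OF W(1) uc]
      have "y \<in> adjoin R W u"
      proof (rule max[OF ad(1)])
        show "W \<subset> adjoin R W u" using ad False by blast
        show "adjoin R W u \<subseteq> I" using adjoin_least[OF I(1) W(2) u] .
      qed
      then obtain w k where k: "y = w \<oplus> k \<otimes> u" "w \<in> W" "k \<in> carrier R" by (rule adjoinE)
      have wc: "w \<in> carrier R" using left_idealD(2)[OF W(1)] k by blast
      have "k \<otimes> u \<noteq> \<zero>" using k W(3) wc by auto
      then have "(\<otimes>) k ` I \<noteq> {\<zero>}" using u by blast
      then obtain b where b: "b \<in> carrier R" "\<And>x. x \<in> I \<Longrightarrow> (b \<otimes> k) \<otimes> x = x"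
        using inv[OF k(3)] by blast
      have "b \<otimes> y = b \<otimes> w \<oplus> u"
        using k b(1) b(2)[OF u] wc uc by (simp add: r_distr m_assoc)
      then have "b \<otimes> w \<oplus> u \<in> V" using left_idealD(5)[OF V(1) b(1) yV] by simp
      moreover have "b \<otimes> w \<in> V" using left_idealD(5)[OF V(1) b(1)] k V(2) by blast
      ultimately show ?thesis using left_ideal_sum_cancel[OF V(1)] uc by blast
    qed (use V in blast)
  qed
  have "covered_by R W I"
    unfolding covered_by_def
  proof (intro conjI allI impI)
    show "W \<subset> I" using W(2,3) y(1) by blast
    fix V assume "left_ideal V R \<and> W \<subseteq> V \<and> V \<subseteq> I"
    then show "V = W \<or> V = I" using key[of V] by blast
  qed (use W I in simp_all)
  then show False using nocov by blast
qed

end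

section \<open>Annihilators, partial functionals and self-dual rings\<close>

definition annihilator :: "('a, 'm) ring_scheme \<Rightarrow> 'a set \<Rightarrow> 'a set" where
  "annihilator A I = {a \<in> carrier A. \<forall>x\<in>I. a \<otimes>\<^bsub>A\<^esub> x = \<zero>\<^bsub>A\<^esub>}"

text \<open>\<open>N\<close> is a bare set, so that one notion covers functionals on ideals, on
  submodules and on a whole algebra.\<close>

definition linear_on ::
  "('k, 'm) ring_scheme \<Rightarrow> ('k, 'b, 'n) module_scheme \<Rightarrow> 'b set \<Rightarrow> ('b \<Rightarrow> 'k) \<Rightarrow> bool" where
  "linear_on K M N f \<longleftrightarrow> f \<in> N \<rightarrow> carrier K \<and>
    (\<forall>x\<in>N. \<forall>y\<in>N. f (x \<oplus>\<^bsub>M\<^esub> y) = f x \<oplus>\<^bsub>K\<^esub> f y) \<and>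
    (\<forall>a\<in>carrier K. \<forall>x\<in>N. f (a \<odot>\<^bsub>M\<^esub> x) = a \<otimes>\<^bsub>K\<^esub> f x)"

text \<open>The second condition says that every nonzero cyclic module \<open>K / I\<close> has a nonzero functional.\<close>

locale self_dual_ring = cring K for K :: "('k, 'm) ring_scheme" (structure) +
  assumes baer: "\<lbrakk>left_ideal I K; linear_on K (regular_module K) I g\<rbrakk> \<Longrightarrow>
      \<exists>c\<in>carrier K. \<forall>x\<in>I. g x = c \<otimes> x"
    and cogenerator: "\<lbrakk>left_ideal I K; I \<noteq> carrier K\<rbrakk> \<Longrightarrow> annihilator K I \<noteq> {\<zero>}"

lemma linear_onD:
  assumes "linear_on K M N f"
  shows "x \<in> N \<Longrightarrow> f x \<in> carrier K"
    "x \<in> N \<Longrightarrow> y \<in> N \<Longrightarrow> f (x \<oplus>\<^bsub>M\<^esub> y) = f x \<oplus>\<^bsub>K\<^esub> f y"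
    "a \<in> carrier K \<Longrightarrow> x \<in> N \<Longrightarrow> f (a \<odot>\<^bsub>M\<^esub> x) = a \<otimes>\<^bsub>K\<^esub> f x"
  using assms unfolding linear_on_def by auto

lemma linear_onI:
  assumes "\<And>x. x \<in> N \<Longrightarrow> f x \<in> carrier K"
    "\<And>x y. x \<in> N \<Longrightarrow> y \<in> N \<Longrightarrow> f (x \<oplus>\<^bsub>M\<^esub> y) = f x \<oplus>\<^bsub>K\<^esub> f y"
    "\<And>a x. a \<in> carrier K \<Longrightarrow> x \<in> N \<Longrightarrow> f (a \<odot>\<^bsub>M\<^esub> x) = a \<otimes>\<^bsub>K\<^esub> f x"
  shows "linear_on K M N f"
  using assms unfolding linear_on_def by auto


lemma linear_on_subset: "linear_on K M N f \<Longrightarrow> N' \<subseteq> N \<Longrightarrow> linear_on K M N' f"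
  unfolding linear_on_def by (auto 4 4)

section \<open>Baer's criterion in a commutative artinian ring with cyclic socle\<close>

context cring
begin

lemma maximal_left_ideal_prime:
  assumes "maximal_left_ideal M R" "a \<in> carrier R" "b \<in> carrier R" "a \<otimes> b \<in> M" "a \<notin> M"
  shows "b \<in> M"
proof -
  note M = maximal_left_idealD(1)[OF assms(1)]
  obtain c where c: "c \<in> carrier R" "\<one> \<ominus> c \<otimes> a \<in> M"
    using maximal_left_ideal_split[OF assms(1,2,5)] by blast
  have "b \<otimes> (\<one> \<ominus> c \<otimes> a) \<in> M" "c \<otimes> (a \<otimes> b) \<in> M"
    using left_idealD(5)[OF M] c assms by blast+
  then have "b \<otimes> (\<one> \<ominus> c \<otimes> a) \<oplus> c \<otimes> (a \<otimes> b) \<in> M" using left_idealD(4)[OF M] by blast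
  moreover have "b \<otimes> (\<one> \<ominus> c \<otimes> a) \<oplus> c \<otimes> (a \<otimes> b) = b" using c assms by algebra
  ultimately show ?thesis by simp
qed

end

text \<open>This is what a commutative Frobenius ring supplies: \<open>a \<mapsto> a z\<close>
  identifies the ring modulo its radical with the socle. The socle enters only through elements with
  maximal annihilator, that is, generators of simple ideals.\<close>

locale cyclic_socle = cring K for K :: "('k, 'm) ring_scheme" (structure) +
  fixes z
  assumes art: "left_artinian K"
    and z: "z \<in> carrier K"
    and radical_z: "jacobson_radical K = {a \<in> carrier K. a \<otimes> z = \<zero>}"
    and socle_z: "\<lbrakk>s \<in> carrier K; maximal_left_ideal {a \<in> carrier K. a \<otimes> s = \<zero>} K\<rbrakk> \<Longrightarrow>
      \<exists>c\<in>carrier K. s = c \<otimes> z"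
begin

text \<open>Write \<open>s = a z\<close> and \<open>t = b z\<close>. Since \<open>m a\<close> lies
  in the radical and \<open>a\<close> does not, a maximal ideal avoiding \<open>a\<close> contains
  \<open>m\<close> and so equals it. Hence \<open>a\<close> is invertible modulo \<open>m\<close>,
  with inverse \<open>k\<close> say, and \<open>t = (b k) s\<close>. In other words, what
  \<open>m\<close> kills is at most one-dimensional over \<open>K / m\<close>.\<close>

lemma maximal_annihilator_one_dim:
  assumes m: "maximal_left_ideal m K" and s: "s \<in> carrier K" "s \<noteq> \<zero>" and t: "t \<in> carrier K"
    and ms: "\<And>a. a \<in> m \<Longrightarrow> a \<otimes> s = \<zero>" and mt: "\<And>a. a \<in> m \<Longrightarrow> a \<otimes> t = \<zero>"
  obtains c where "c \<in> carrier K" "t = c \<otimes> s"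
proof -
  note mD = maximal_left_idealD[OF m]
  note mI = left_idealD[OF mD(1)]
  have cyc: "\<exists>c\<in>carrier K. u = c \<otimes> z"
    if u: "u \<in> carrier K" and mu: "\<And>a. a \<in> m \<Longrightarrow> a \<otimes> u = \<zero>" for u
  proof (cases "u = \<zero>")
    case True
    then show ?thesis using z by (auto intro!: bexI[of _ \<zero>])
  next
    case False
    let ?A = "{a \<in> carrier K. a \<otimes> u = \<zero>}"
    have A: "left_ideal ?A K" using left_ideal_annihilator[of "{u}"] u by simp
    moreover have "m \<subseteq> ?A" using mI(2) mu by blast
    moreover have "\<one> \<notin> ?A" using u False by simp
    ultimately have "?A = m" using mD(4)[of ?A] by blast
    then show ?thesis using socle_z[OF u] m by simp
  qed
  obtain a b where ab: "a \<in> carrier K" "s = a \<otimes> z" "b \<in> carrier K" "t = b \<otimes> z"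
    using cyc[OF s(1) ms] cyc[OF t mt] by blast
  have J: "q \<otimes> a \<in> jacobson_radical K" "q \<otimes> b \<in> jacobson_radical K" if "q \<in> m" for q
    using ms[OF that] mt[OF that] ab z mI(2)[OF that] by (simp_all add: radical_z m_assoc)
  have "a \<notin> jacobson_radical K" using ab s(2) by (simp add: radical_z)
  then obtain m' where m': "maximal_left_ideal m' K" "a \<notin> m'"
    using ab(1) by (auto simp: jacobson_radical_def)
  note m'D = maximal_left_idealD[OF m'(1)]
  have "q \<in> m'" if q: "q \<in> m" for q
  proof (rule maximal_left_ideal_prime[OF m'(1) ab(1) mI(2)[OF q] _ m'(2)])
    show "a \<otimes> q \<in> m'" using J(1)[OF q] m'(1) ab mI(2)[OF q] by (simp add: jacobson_radical_def m_comm)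
  qed
  then have "m' = m" using mD(4)[OF m'D(1)] m'D(2) by blast
  with m' have "a \<notin> m" by simp
  then obtain k where k: "k \<in> carrier K" "\<one> \<ominus> k \<otimes> a \<in> m"
    using maximal_left_ideal_split[OF m ab(1)] by blast
  have "(\<one> \<ominus> k \<otimes> a) \<otimes> t = \<zero>" using mt k by blast
  then have "t \<ominus> (b \<otimes> k) \<otimes> s = \<zero>"
  proof -
    have "(\<one> \<ominus> k \<otimes> a) \<otimes> t = t \<ominus> (b \<otimes> k) \<otimes> s"
      unfolding ab(2,4) using ab(1,3) k(1) z by algebra
    then show ?thesis using \<open>(\<one> \<ominus> k \<otimes> a) \<otimes> t = \<zero>\<close> by simp
  qed
  then have "t = (b \<otimes> k) \<otimes> s" using t ab(3) k(1) s(1) by (simp add: minus_eq_zero_iff)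
  then show ?thesis using that ab k by blast
qed

lemma left_ideal_ann: "left_ideal I K \<Longrightarrow> left_ideal (annihilator K I) K"
  unfolding annihilator_def using left_ideal_annihilator left_idealD(1) by blast

lemma annihilator_antimono: "U \<subseteq> V \<Longrightarrow> annihilator K V \<subseteq> annihilator K U"
  by (auto simp: annihilator_def)

text \<open>The conductor is the annihilator of the class of \<open>x\<close>, which generates the
  simple module \<open>V / U\<close>.\<close>

lemma covered_by_conductor:
  assumes c: "covered_by K U V" and x: "x \<in> V" "x \<notin> U"
  shows "maximal_left_ideal {a \<in> carrier K. a \<otimes> x \<in> U} K" (is "maximal_left_ideal ?m K")
  unfolding maximal_left_ideal_def
proof (intro conjI allI impI)
  note c' = covered_byD[OF c]
  note U = left_idealD[OF c'(1)] and V = left_idealD[OF c'(2)]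
  have xc: "x \<in> carrier K" using V(2) x by blast
  show m: "left_ideal ?m K"
    by (rule left_idealI) (use U xc in \<open>auto simp: l_distr m_assoc\<close>)
  show "?m \<noteq> carrier K" using left_ideal_eq_carrier_iff[OF m] x xc by simp
  fix L assume L: "left_ideal L K \<and> ?m \<subseteq> L"
  show "L = ?m \<or> L = carrier K"
  proof (cases "L \<subseteq> ?m")
    case False
    then obtain l where l: "l \<in> L" "l \<notin> ?m" by blast
    have lc: "l \<in> carrier K" using l L left_idealD(2) by blast
    have lx: "l \<otimes> x \<in> V" "l \<otimes> x \<notin> U" using l lc V(5) x by auto
    have "adjoin K U (l \<otimes> x) = V" by (rule covered_by_adjoin[OF c lx])
    then obtain u b where b: "x = u \<oplus> b \<otimes> (l \<otimes> x)" "u \<in> U" "b \<in> carrier K"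
      using x(1) adjoinE by metis
    have "(\<one> \<ominus> b \<otimes> l) \<otimes> x = x \<ominus> b \<otimes> (l \<otimes> x)"
      using xc b(3) lc by algebra
    also have "\<dots> = (u \<oplus> b \<otimes> (l \<otimes> x)) \<ominus> b \<otimes> (l \<otimes> x)" using b(1) by simp
    also have "\<dots> = u" using U(2)[OF b(2)] b(3) lc xc by (simp add: minus_eq a_assoc r_neg)
    finally have "\<one> \<ominus> b \<otimes> l \<in> ?m" using b lc by simp
    then have "\<one> \<ominus> b \<otimes> l \<in> L" using L by blast
    moreover have "b \<otimes> l \<in> L" using left_idealD(5) L b l by blast
    ultimately have "\<one> \<in> L" using left_ideal_diff_cancel L by blast
    then show ?thesis using left_ideal_eq_carrier_iff L by blast
  qed (use L in blast)
qed

text \<open>Write \<open>V = U + K x\<close>. On the annihilator of \<open>U\<close>, the map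
  \<open>v \<mapsto> v x\<close> has the annihilator of \<open>V\<close> as its kernel, and its
  values are killed by the conductor of \<open>x\<close>. Such elements form at most one dimension,
  so the quotient is zero or simple.\<close>

lemma annihilator_covered:
  assumes c: "covered_by K U V"
  shows "annihilator K U = annihilator K V \<or> covered_by K (annihilator K V) (annihilator K U)"
proof (cases "annihilator K U = annihilator K V")
  case False
  note c' = covered_byD[OF c]
  have VU: "annihilator K V \<subset> annihilator K U"
    using False annihilator_antimono c'(3) by blast
  obtain x where x: "x \<in> V" "x \<notin> U" using c'(3) by blast
  have ad: "adjoin K U x = V" by (rule covered_by_adjoin[OF c x])
  let ?m = "{a \<in> carrier K. a \<otimes> x \<in> U}"
  have m: "maximal_left_ideal ?m K" by (rule covered_by_conductor[OF c x])
  have xc: "x \<in> carrier K" using left_idealD(2)[OF c'(2)] x by blast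
  have annV: "v \<in> annihilator K V" if v: "v \<in> annihilator K U" "v \<otimes> x = \<zero>" for v
    unfolding annihilator_def
  proof (intro CollectI conjI ballI)
    show vc: "v \<in> carrier K" using v by (simp add: annihilator_def)
    fix y assume "y \<in> V"
    then obtain u b where b: "y = u \<oplus> b \<otimes> x" "u \<in> U" "b \<in> carrier K" using ad adjoinE by metis
    have uc: "u \<in> carrier K" using left_idealD(2)[OF c'(1)] b by blast
    have "v \<otimes> y = v \<otimes> u \<oplus> b \<otimes> (v \<otimes> x)" using b vc uc xc by (simp add: r_distr m_lcomm)
    then show "v \<otimes> y = \<zero>" using v b by (simp add: annihilator_def)
  qed
  have kill: "a \<otimes> (v \<otimes> x) = \<zero>" if "v \<in> annihilator K U" "a \<in> ?m" for v a
  proof -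
    have "a \<otimes> (v \<otimes> x) = v \<otimes> (a \<otimes> x)" using that xc by (simp add: annihilator_def m_lcomm)
    then show ?thesis using that by (simp add: annihilator_def)
  qed
  have "covered_by K (annihilator K V) (annihilator K U)"
    unfolding covered_by_def
  proof (intro conjI allI impI)
    show "left_ideal (annihilator K V) K" "left_ideal (annihilator K U) K"
      using left_ideal_ann c'(1,2) by blast+
    show "annihilator K V \<subset> annihilator K U" by (rule VU)
    fix W assume W: "left_ideal W K \<and> annihilator K V \<subseteq> W \<and> W \<subseteq> annihilator K U"
    show "W = annihilator K V \<or> W = annihilator K U"
    proof (cases "W \<subseteq> annihilator K V")
      case False
      then obtain v where v: "v \<in> W" "v \<notin> annihilator K V" by blast
      have vU: "v \<in> annihilator K U" using v W by blast
      have vc: "v \<in> carrier K" using vU by (simp add: annihilator_def)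
      have vx: "v \<otimes> x \<noteq> \<zero>" using annV[OF vU] v by blast
      have "w \<in> W" if w: "w \<in> annihilator K U" for w
      proof -
        have wc: "w \<in> carrier K" using w by (simp add: annihilator_def)
        obtain k where k: "k \<in> carrier K" "w \<otimes> x = k \<otimes> (v \<otimes> x)"
          by (rule maximal_annihilator_one_dim[OF m, of "v \<otimes> x" "w \<otimes> x"])
            (use vx vc wc xc kill[OF vU] kill[OF w] in auto)
        have "(w \<ominus> k \<otimes> v) \<otimes> x = w \<otimes> x \<ominus> k \<otimes> (v \<otimes> x)"
          using wc k(1) vc xc by algebra
        then have "(w \<ominus> k \<otimes> v) \<otimes> x = \<zero>" using k wc xc by (simp add: minus_eq r_neg vc)
        moreover have "w \<ominus> k \<otimes> v \<in> annihilator K U"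
          using left_ideal_minus[OF left_ideal_ann[OF c'(1)] w]
            left_idealD(5)[OF left_ideal_ann[OF c'(1)] k(1) vU] by blast
        ultimately have "w \<ominus> k \<otimes> v \<in> W" using annV W by blast
        moreover have "k \<otimes> v \<in> W" using left_idealD(5) W k v by blast
        ultimately show ?thesis using left_ideal_diff_cancel W wc by blast
      qed
      then show ?thesis using W by blast
    qed (use W in blast)
  qed
  then show ?thesis by blast
qed simp

text \<open>Passing from an ideal to a cover raises its length by \<open>1\<close> and lowers the length of its
  annihilator by at most \<open>1\<close>, so the sum of the two lengths is monotone; it has the same value at
  \<open>0\<close> and at \<open>K\<close>.\<close>

lemma length_annihilator:
  assumes l: "length_function K (carrier K) l" and I: "left_ideal I K"
  shows "l I + l (annihilator K I) = l {\<zero>} + l (carrier K)"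
proof -
  note l1 = length_functionD(1)[OF l] and l2 = length_functionD(2)[OF l]
  have step: "l U + l (annihilator K U) \<le> l V + l (annihilator K V)" if c: "covered_by K U V" for U V
  proof -
    have sub: "W \<subseteq> carrier K" if "left_ideal W K" for W using left_idealD(1)[OF that] .
    have "l V = Suc (l U)" using l2[OF c sub[OF covered_byD(2)[OF c]]] .
    moreover have "l (annihilator K U) \<le> Suc (l (annihilator K V))"
      using annihilator_covered[OF c]
    proof
      assume c'': "covered_by K (annihilator K V) (annihilator K U)"
      show ?thesis using l2[OF c'' sub[OF covered_byD(2)[OF c'']]] by simp
    qed simp
    ultimately show ?thesis by simp
  qed
  have ann0: "annihilator K {\<zero>} = carrier K" by (auto simp: annihilator_def)
  have ann1: "annihilator K (carrier K) = {\<zero>}" 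
  proof
    show "annihilator K (carrier K) \<subseteq> {\<zero>}"
    proof
      fix a assume "a \<in> annihilator K (carrier K)"
      then have "a \<in> carrier K" "a \<otimes> \<one> = \<zero>" unfolding annihilator_def by blast+
      then show "a \<in> {\<zero>}" by simp
    qed
  qed (simp add: annihilator_def)
  let ?n = "l {\<zero>} + l (carrier K)"
  have le: "l I + l (annihilator K I) \<le> ?n" if "left_ideal I K" for I
    using that
  proof (induction "l (carrier K) - l I" arbitrary: I rule: less_induct)
    case less
    note I = less.prems
    show ?case
    proof (cases "I = carrier K")
      case True
      then show ?thesis using ann1 by simp
    next
      case False
      \<comment> \<open>Strict monotonicity of \<open>l\<close> makes an ideal of least length
        strictly above \<open>I\<close> a cover of \<open>I\<close>, so this induction climbs
        towards \<open>K\<close>; the reverse inequality descends towards the zero ideal.\<close>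
      let ?P = "\<lambda>V. left_ideal V K \<and> I \<subset> V"
      have "?P (carrier K)" using left_ideal_carrier left_idealD(1)[OF I] False by blast
      then obtain V where V: "?P V" "\<And>W. ?P W \<Longrightarrow> l V \<le> l W"
        using ex_has_least_nat[of ?P "carrier K" l] by auto
      have c: "covered_by K I V"
        unfolding covered_by_def
      proof (intro conjI allI impI)
        fix W assume W: "left_ideal W K \<and> I \<subseteq> W \<and> W \<subseteq> V"
        show "W = I \<or> W = V"
        proof (rule ccontr)
          assume *: "\<not> (W = I \<or> W = V)"
          then have "l V \<le> l W" using V(2)[of W] W by blast
          moreover have "l W < l V"
            by (rule l1) (use W V * left_idealD(1)[of V] in auto)
          ultimately show False by simp
        qed
      qed (use V I in auto)
      have "l I < l (carrier K)"
        by (rule l1[OF I left_ideal_carrier]) (use False left_idealD(1)[OF I] in auto)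
      moreover have "l I < l V" using l1[OF I] V(1) left_idealD(1)[of V] by auto
      ultimately have "l V + l (annihilator K V) \<le> ?n"
        by (intro less.hyps) (use V in auto)
      then show ?thesis using step[OF c] by simp
    qed
  qed
  have ge: "?n \<le> l I + l (annihilator K I)" if "left_ideal I K" for I
    using that
  proof (induction "l I" arbitrary: I rule: less_induct)
    case less
    note I = less.prems
    show ?case
    proof (cases "I = {\<zero>}")
      case True
      then show ?thesis using ann0 by simp
    next
      case False
      have "length_function K I l"
        using left_idealD(1)[OF I] l1 l2 by (intro length_functionI) (meson subset_trans)+
      then obtain W where c: "covered_by K W I"
        using finite_length_maximal_sub[OF I finite_lengthI False] by blast
      have "l W < l I" using l2[OF c left_idealD(1)[OF I]] by simp
      then have "?n \<le> l W + l (annihilator K W)" using less.hyps covered_byD(1)[OF c] by blast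
      then show ?thesis using step[OF c] by simp
    qed
  qed
  show ?thesis using le[OF I] ge[OF I] by simp
qed

text \<open>By the length count, equal annihilators would force equal lengths of \<open>U\<close>
  and \<open>V\<close>. What matters later is the resulting element that kills \<open>U\<close> but
  not \<open>V\<close>.\<close>

lemma annihilator_strict:
  assumes "left_ideal U K" "left_ideal V K" "U \<subset> V"
  shows "annihilator K V \<subset> annihilator K U"
proof -
  have "finite_length K (carrier K)" by (rule artinian_finite_length[OF art left_ideal_carrier])
  then obtain l where l: "length_function K (carrier K) l" by (auto simp: finite_length_def)
  have "l U < l V" by (rule length_functionD(1)[OF l assms left_idealD(1)[OF assms(2)]])
  then have "l (annihilator K U) \<noteq> l (annihilator K V)"
    using length_annihilator[OF l assms(1)] length_annihilator[OF l assms(2)] by simp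
  then have "annihilator K U \<noteq> annihilator K V" by auto
  then show ?thesis using annihilator_antimono[of U V] assms(3) by blast
qed

text \<open>Induction on the length of \<open>I\<close>. On a maximal proper subideal
  \<open>W\<close> the functional is multiplication by some \<open>d\<close>. An element
  \<open>e\<close> that kills \<open>W\<close> but not \<open>I\<close> can correct \<open>d\<close>
  without changing its action on \<open>W\<close>, and a multiple of \<open>e\<close> suffices for
  the one new generator \<open>x\<close>.\<close>

lemma baer_criterion:
  assumes "left_ideal I K" "linear_on K (regular_module K) I g"
  shows "\<exists>c\<in>carrier K. \<forall>x\<in>I. g x = c \<otimes> x"
proof -
  have "finite_length K (carrier K)" by (rule artinian_finite_length[OF art left_ideal_carrier])
  then obtain l where l: "length_function K (carrier K) l" by (auto simp: finite_length_def)
  show ?thesis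
    using assms
  proof (induction "l I" arbitrary: I g rule: less_induct)
    case less
    note I = less.prems(1)
    have g: "\<And>x. x \<in> I \<Longrightarrow> g x \<in> carrier K"
      "\<And>x y. x \<in> I \<Longrightarrow> y \<in> I \<Longrightarrow> g (x \<oplus> y) = g x \<oplus> g y"
      "\<And>a x. a \<in> carrier K \<Longrightarrow> x \<in> I \<Longrightarrow> g (a \<otimes> x) = a \<otimes> g x"
      using linear_onD[OF less.prems(2)] by (simp_all add: regular_module_def)
    show ?case
    proof (cases "I = {\<zero>}")
      case True
      have "g (\<zero> \<otimes> \<zero>) = \<zero> \<otimes> g \<zero>" using g(3)[of \<zero> \<zero>] True by simp
      then show ?thesis using True g(1) by (auto intro!: bexI[of _ \<zero>])
    next
      case False
      obtain W where c: "covered_by K W I"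
        using finite_length_maximal_sub[OF I artinian_finite_length[OF art I] False] by blast
      note c' = covered_byD[OF c]
      have "l W < l I" using length_functionD(2)[OF l c left_idealD(1)[OF I]] by simp
      moreover have "linear_on K (regular_module K) W g"
        using linear_on_subset less.prems(2) c'(3) by blast
      ultimately have "\<exists>d\<in>carrier K. \<forall>x\<in>W. g x = d \<otimes> x" by (rule less.hyps[OF _ c'(1)])
      then obtain d where d: "d \<in> carrier K" "\<And>x. x \<in> W \<Longrightarrow> g x = d \<otimes> x" by blast
      obtain x where x: "x \<in> I" "x \<notin> W" using c'(3) by blast
      have xc: "x \<in> carrier K" using left_idealD(2)[OF I] x by blast
      have ad: "adjoin K W x = I" by (rule covered_by_adjoin[OF c x])
      let ?m = "{a \<in> carrier K. a \<otimes> x \<in> W}"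
      have m: "maximal_left_ideal ?m K" by (rule covered_by_conductor[OF c x])
      obtain e where e: "e \<in> annihilator K W" "e \<notin> annihilator K I"
        using annihilator_strict[OF c'(1,2,3)] by blast
      have ec: "e \<in> carrier K" using e by (simp add: annihilator_def)
      have ew: "e \<otimes> w = \<zero>" if "w \<in> W" for w using e that by (simp add: annihilator_def)
      have ex: "e \<otimes> x \<noteq> \<zero>"
      proof
        assume ex0: "e \<otimes> x = \<zero>"
        have "e \<otimes> y = \<zero>" if y: "y \<in> I" for y
        proof -
          obtain u b where b: "y = u \<oplus> b \<otimes> x" "u \<in> W" "b \<in> carrier K"
            using ad y adjoinE by metis
          have "e \<otimes> y = e \<otimes> u \<oplus> b \<otimes> (e \<otimes> x)"
            using b ec left_idealD(2)[OF c'(1) b(2)] xc by (simp add: r_distr m_lcomm)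
          then show ?thesis using ex0 ew b by simp
        qed
        then show False using e ec by (simp add: annihilator_def)
      qed
      \<comment> \<open>Both \<open>e x\<close> and the error \<open>g x - d x\<close> are killed by
        the conductor of \<open>x\<close>, a maximal ideal, so the error is a multiple of
        \<open>e x\<close>.\<close>
      obtain k where k: "k \<in> carrier K" "g x \<ominus> d \<otimes> x = k \<otimes> (e \<otimes> x)"
      proof (rule maximal_annihilator_one_dim[OF m, of "e \<otimes> x" "g x \<ominus> d \<otimes> x"])
        fix a assume a: "a \<in> ?m"
        have "a \<otimes> (e \<otimes> x) = e \<otimes> (a \<otimes> x)" using a ec xc by (simp add: m_lcomm)
        then show "a \<otimes> (e \<otimes> x) = \<zero>" using a ew by simp
        have "a \<otimes> (g x \<ominus> d \<otimes> x) = g (a \<otimes> x) \<ominus> d \<otimes> (a \<otimes> x)"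
        proof -
          have aK: "a \<in> carrier K" using a by simp
          have "a \<otimes> (g x \<ominus> d \<otimes> x) = a \<otimes> g x \<ominus> d \<otimes> (a \<otimes> x)"
            using aK g(1)[OF x(1)] d(1) xc by algebra
          then show ?thesis using g(3)[of a x] a x by simp
        qed
        then show "a \<otimes> (g x \<ominus> d \<otimes> x) = \<zero>"
          using a d xc by (simp add: minus_eq r_neg)
      qed (use ex ec xc g(1)[OF x(1)] d(1) in auto)
      have "g y = (d \<oplus> k \<otimes> e) \<otimes> y" if y: "y \<in> I" for y
      proof -
        obtain u b where b: "y = u \<oplus> b \<otimes> x" "u \<in> W" "b \<in> carrier K"
          using ad y adjoinE by metis
        have uI: "u \<in> I" "b \<otimes> x \<in> I" using b c'(3) left_idealD(5)[OF I b(3)] x by auto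
        have uc: "u \<in> carrier K" using left_idealD(2)[OF c'(1) b(2)] .
        have gx: "g x = d \<otimes> x \<oplus> k \<otimes> (e \<otimes> x)"
          unfolding k(2)[symmetric] using g(1)[OF x(1)] d(1) xc by algebra
        have "g y = d \<otimes> u \<oplus> b \<otimes> g x" using b(1) g(2)[OF uI] g(3)[OF b(3) x(1)] d(2)[OF b(2)] by simp
        also have "\<dots> = d \<otimes> u \<oplus> k \<otimes> (e \<otimes> u) \<oplus> b \<otimes> g x" using ew[OF b(2)] d(1) k(1) uc by simp
        also have "\<dots> = (d \<oplus> k \<otimes> e) \<otimes> (u \<oplus> b \<otimes> x)"
          unfolding gx using d(1) k(1) ec uc xc b(3) by algebra
        finally show ?thesis using b by simp
      qed
      moreover have "d \<oplus> k \<otimes> e \<in> carrier K" using d k ec by simp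
      ultimately show ?thesis by blast
    qed
  qed
qed

lemma self_dual: "self_dual_ring K"
proof
  fix I :: "'k set" assume I: "left_ideal I K" "I \<noteq> carrier K"
  have "annihilator K (carrier K) \<subset> annihilator K I"
    using annihilator_strict[OF I(1) left_ideal_carrier] I left_idealD(1) by blast
  moreover have "\<zero> \<in> annihilator K (carrier K)" by (simp add: annihilator_def)
  ultimately show "annihilator K I \<noteq> {\<zero>}" by (metis empty_iff psubsetE subset_singletonD)
qed (rule baer_criterion)

end

section \<open>Functionals on finitely generated modules\<close>

definition submodule_adjoin ::
  "('k, 'm) ring_scheme \<Rightarrow> ('k, 'b, 'n) module_scheme \<Rightarrow> 'b set \<Rightarrow> 'b \<Rightarrow> 'b set" where
  "submodule_adjoin K M N s = {x \<oplus>\<^bsub>M\<^esub> k \<odot>\<^bsub>M\<^esub> s | x k. x \<in> N \<and> k \<in> carrier K}"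

section \<open>Submodules and the descending chain condition\<close>

context module
begin

lemma submodule_iff:
  "submodule N R M \<longleftrightarrow> N \<subseteq> carrier M \<and> \<zero>\<^bsub>M\<^esub> \<in> N \<and> (\<forall>x\<in>N. \<forall>y\<in>N. x \<oplus>\<^bsub>M\<^esub> y \<in> N) \<and>
    (\<forall>a\<in>carrier R. \<forall>x\<in>N. a \<odot>\<^bsub>M\<^esub> x \<in> N)" (is "?l \<longleftrightarrow> ?r")
proof
  assume l: ?l
  note E = submoduleE[OF l]
  obtain x where "x \<in> N" using E(2) by blast
  then have "\<zero> \<odot>\<^bsub>M\<^esub> x \<in> N" using E(4)[OF R.zero_closed] by blast
  then have "\<zero>\<^bsub>M\<^esub> \<in> N" using \<open>x \<in> N\<close> E(1) by auto
  then show ?r using E(1,4,5) by blast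
next
  assume r: ?r
  have "\<ominus>\<^bsub>M\<^esub> x \<in> N" if "x \<in> N" for x
  proof -
    have "(\<ominus> \<one>) \<odot>\<^bsub>M\<^esub> x \<in> N" using r that by blast
    moreover have "x \<in> carrier M" using r that by blast
    ultimately show ?thesis by (simp add: smult_l_minus)
  qed
  then show ?l using r by (intro submoduleI) blast+
qed

lemma submodule_intro:
  assumes "N \<subseteq> carrier M" "\<zero>\<^bsub>M\<^esub> \<in> N" "\<And>x y. x \<in> N \<Longrightarrow> y \<in> N \<Longrightarrow> x \<oplus>\<^bsub>M\<^esub> y \<in> N"
    "\<And>a x. a \<in> carrier R \<Longrightarrow> x \<in> N \<Longrightarrow> a \<odot>\<^bsub>M\<^esub> x \<in> N"
  shows "submodule N R M"
  using assms by (simp add: submodule_iff)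

lemma submoduleD:
  assumes "submodule N R M"
  shows "N \<subseteq> carrier M" "\<And>x. x \<in> N \<Longrightarrow> x \<in> carrier M" "\<zero>\<^bsub>M\<^esub> \<in> N"
    "\<And>x y. x \<in> N \<Longrightarrow> y \<in> N \<Longrightarrow> x \<oplus>\<^bsub>M\<^esub> y \<in> N"
    "\<And>a x. a \<in> carrier R \<Longrightarrow> x \<in> N \<Longrightarrow> a \<odot>\<^bsub>M\<^esub> x \<in> N"
  using assms by (auto simp: submodule_iff)

lemma submodule_minus:
  assumes "submodule N R M" "x \<in> N" "y \<in> N"
  shows "x \<ominus>\<^bsub>M\<^esub> y \<in> N"
  using submoduleD(4)[OF assms(1,2) submoduleE(3)[OF assms(1,3)]] by (simp add: M.minus_eq)

lemma submodule_adjoin: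
  assumes N: "submodule N R M" and s: "s \<in> carrier M"
  shows "submodule (submodule_adjoin R M N s) R M" "N \<subseteq> submodule_adjoin R M N s"
    "s \<in> submodule_adjoin R M N s"
proof -
  note D = submoduleD[OF N]
  show "submodule (submodule_adjoin R M N s) R M"
  proof (rule submodule_intro)
    show "submodule_adjoin R M N s \<subseteq> carrier M" using D(2) s by (auto simp: submodule_adjoin_def)
    show "\<zero>\<^bsub>M\<^esub> \<in> submodule_adjoin R M N s"
      unfolding submodule_adjoin_def using D(3) s
      by (intro CollectI exI[of _ "\<zero>\<^bsub>M\<^esub>"] exI[of _ \<zero>]) simp
    fix x y assume "x \<in> submodule_adjoin R M N s" "y \<in> submodule_adjoin R M N s"
    then obtain u b v c where *: "x = u \<oplus>\<^bsub>M\<^esub> b \<odot>\<^bsub>M\<^esub> s" "y = v \<oplus>\<^bsub>M\<^esub> c \<odot>\<^bsub>M\<^esub> s" "u \<in> N" "v \<in> N"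
      "b \<in> carrier R" "c \<in> carrier R" by (auto simp: submodule_adjoin_def)
    have "x \<oplus>\<^bsub>M\<^esub> y = (u \<oplus>\<^bsub>M\<^esub> v) \<oplus>\<^bsub>M\<^esub> (b \<oplus> c) \<odot>\<^bsub>M\<^esub> s"
      using * s D(2) by (simp add: smult_l_distr M.a_ac)
    then show "x \<oplus>\<^bsub>M\<^esub> y \<in> submodule_adjoin R M N s"
      using * D(4) by (force simp: submodule_adjoin_def)
  next
    fix r x assume r: "r \<in> carrier R" and "x \<in> submodule_adjoin R M N s"
    then obtain u b where *: "x = u \<oplus>\<^bsub>M\<^esub> b \<odot>\<^bsub>M\<^esub> s" "u \<in> N" "b \<in> carrier R"
      by (auto simp: submodule_adjoin_def)
    have "r \<odot>\<^bsub>M\<^esub> x = r \<odot>\<^bsub>M\<^esub> u \<oplus>\<^bsub>M\<^esub> (r \<otimes> b) \<odot>\<^bsub>M\<^esub> s"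
      using * s D(2) r by (simp add: smult_r_distr smult_assoc1)
    then show "r \<odot>\<^bsub>M\<^esub> x \<in> submodule_adjoin R M N s"
      using * D(5) r by (force simp: submodule_adjoin_def)
  qed
  show "N \<subseteq> submodule_adjoin R M N s"
  proof
    fix x assume "x \<in> N"
    then have "x = x \<oplus>\<^bsub>M\<^esub> \<zero> \<odot>\<^bsub>M\<^esub> s" using D(2) s by simp
    then show "x \<in> submodule_adjoin R M N s" unfolding submodule_adjoin_def using \<open>x \<in> N\<close> by blast
  qed
  have "s = \<zero>\<^bsub>M\<^esub> \<oplus>\<^bsub>M\<^esub> \<one> \<odot>\<^bsub>M\<^esub> s" using s by simp
  then show "s \<in> submodule_adjoin R M N s" unfolding submodule_adjoin_def using D(3) by blast
qed

lemma submodule_adjoinE: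
  assumes "x \<in> submodule_adjoin R M N s"
  obtains u b where "x = u \<oplus>\<^bsub>M\<^esub> b \<odot>\<^bsub>M\<^esub> s" "u \<in> N" "b \<in> carrier R"
  using assms by (auto simp: submodule_adjoin_def)

lemma submodule_finsum:
  assumes "submodule N R M" "finite S" "f \<in> S \<rightarrow> N"
  shows "finsum M f S \<in> N"
  using assms(2,3)
proof (induction)
  case empty
  then show ?case using submoduleD(3)[OF assms(1)] by simp
next
  case (insert x F)
  moreover have "f \<in> F \<rightarrow> carrier M" "f x \<in> carrier M"
    using insert submoduleD(2)[OF assms(1)] by auto
  ultimately show ?case using submoduleD(4)[OF assms(1)] by (simp add: M.finsum_insert)
qed

lemma submodule_zero: "submodule {\<zero>\<^bsub>M\<^esub>} R M"
  by (rule submodule_intro) auto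

lemma finitely_generatedE:
  assumes "finitely_generated_module R M"
  obtains S where "finite S" "S \<subseteq> carrier M"
    "\<And>N. submodule N R M \<Longrightarrow> S \<subseteq> N \<Longrightarrow> N = carrier M"
proof -
  obtain S where S: "finite S" "S \<subseteq> carrier M"
    "carrier M = {\<Oplus>\<^bsub>M\<^esub>s\<in>S. c s \<odot>\<^bsub>M\<^esub> s | c. c \<in> S \<rightarrow> carrier R}"
    using assms unfolding finitely_generated_module_def by blast
  have "N = carrier M" if N: "submodule N R M" "S \<subseteq> N" for N
  proof
    show "N \<subseteq> carrier M" using submoduleD(1)[OF N(1)] .
    show "carrier M \<subseteq> N"
    proof
      fix x assume "x \<in> carrier M"
      then obtain c where c: "x = (\<Oplus>\<^bsub>M\<^esub>s\<in>S. c s \<odot>\<^bsub>M\<^esub> s)" "c \<in> S \<rightarrow> carrier R" using S(3) by blast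
      show "x \<in> N"
        unfolding c(1) by (rule submodule_finsum[OF N(1) S(1)]) (use c(2) N submoduleD(5)[OF N(1)] in blast)
    qed
  qed
  then show ?thesis using that S by blast
qed

text \<open>Adjoining the generators one at a time reaches the whole module in finitely many cyclic
  steps. This takes the place of Zorn's lemma when functionals are extended.\<close>

lemma finitely_generated_induct [consumes 2, case_names base adjoin]:
  assumes fg: "finitely_generated_module R M" and N: "submodule N R M"
    and base: "P N"
    and step: "\<And>L s. submodule L R M \<Longrightarrow> N \<subseteq> L \<Longrightarrow> s \<in> carrier M \<Longrightarrow> P L \<Longrightarrow> P (submodule_adjoin R M L s)"
  shows "P (carrier M)"
proof -
  obtain S where S: "finite S" "S \<subseteq> carrier M"
    and gen: "\<And>N. submodule N R M \<Longrightarrow> S \<subseteq> N \<Longrightarrow> N = carrier M"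
    using finitely_generatedE[OF fg] by blast
  have "\<exists>L. submodule L R M \<and> N \<subseteq> L \<and> S \<subseteq> L \<and> P L"
    using S
  proof (induction)
    case empty
    then show ?case using N base by blast
  next
    case (insert s F)
    then obtain L where L: "submodule L R M" "N \<subseteq> L" "F \<subseteq> L" "P L" by blast
    have s: "s \<in> carrier M" using insert by blast
    show ?case
      using submodule_adjoin[OF L(1) s] step[OF L(1,2) s L(4)] L(2,3)
      by (intro exI[of _ "submodule_adjoin R M L s"]) blast
  qed
  then show ?thesis using gen by metis
qed

text \<open>By induction the traces of the chain on \<open>L\<close> stabilise. For
  \<open>L + R s\<close> one more invariant is needed: the ideal of coefficients with which
  \<open>s\<close> occurs in members of the chain modulo \<open>L\<close>. It stabilises because the
  ring of scalars is artinian, and the two invariants determine the trace on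
  \<open>L + R s\<close>.\<close>

lemma finitely_generated_dcc:
  assumes art: "left_artinian R" and fg: "finitely_generated_module R M"
    and U: "\<And>n::nat. submodule (U n) R M" "\<And>n. U (Suc n) \<subseteq> U n"
  shows "\<exists>n. \<forall>m\<ge>n. U m = U n"
proof -
  have "\<exists>n. \<forall>m\<ge>n. U m \<inter> carrier M = U n \<inter> carrier M"
    using fg submodule_zero
  proof (induction rule: finitely_generated_induct)
    case base
    have "U m \<inter> {\<zero>\<^bsub>M\<^esub>} = {\<zero>\<^bsub>M\<^esub>}" for m using submoduleD(3)[OF U(1)] by blast
    then show ?case by blast
  next
    case (adjoin L s)
    note L = submoduleD[OF adjoin.hyps(1)] and s = adjoin.hyps(3)
    have anti: "U m \<subseteq> U n" if "n \<le> m" for n m using lift_Suc_antimono_le[of U n m] U(2) that by blast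
    define C where "C n = {k \<in> carrier R. \<exists>x\<in>L. x \<oplus>\<^bsub>M\<^esub> k \<odot>\<^bsub>M\<^esub> s \<in> U n}" for n
    have "left_ideal (C n) R" for n
    proof (rule left_idealI)
      note Un = submoduleD[OF U(1)[of n]]
      show "C n \<subseteq> carrier R" by (auto simp: C_def)
      show "\<zero> \<in> C n" unfolding C_def using s L(3) Un(3) by (auto intro!: bexI[of _ "\<zero>\<^bsub>M\<^esub>"])
      fix a b assume "a \<in> C n" "b \<in> C n"
      then obtain x y where *: "a \<in> carrier R" "b \<in> carrier R" "x \<in> L" "y \<in> L"
        "x \<oplus>\<^bsub>M\<^esub> a \<odot>\<^bsub>M\<^esub> s \<in> U n" "y \<oplus>\<^bsub>M\<^esub> b \<odot>\<^bsub>M\<^esub> s \<in> U n" by (auto simp: C_def)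
      have "(x \<oplus>\<^bsub>M\<^esub> a \<odot>\<^bsub>M\<^esub> s) \<oplus>\<^bsub>M\<^esub> (y \<oplus>\<^bsub>M\<^esub> b \<odot>\<^bsub>M\<^esub> s) = (x \<oplus>\<^bsub>M\<^esub> y) \<oplus>\<^bsub>M\<^esub> (a \<oplus> b) \<odot>\<^bsub>M\<^esub> s"
        using * s L(2) by (simp add: smult_l_distr M.a_ac)
      then have "(x \<oplus>\<^bsub>M\<^esub> y) \<oplus>\<^bsub>M\<^esub> (a \<oplus> b) \<odot>\<^bsub>M\<^esub> s \<in> U n" using Un(4)[OF *(5,6)] by simp
      then show "a \<oplus> b \<in> C n" using * L(4)[OF *(3,4)] by (auto simp: C_def)
    next
      note Un = submoduleD[OF U(1)[of n]]
      fix r a assume r: "r \<in> carrier R" and "a \<in> C n"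
      then obtain x where *: "a \<in> carrier R" "x \<in> L" "x \<oplus>\<^bsub>M\<^esub> a \<odot>\<^bsub>M\<^esub> s \<in> U n" by (auto simp: C_def)
      have "r \<odot>\<^bsub>M\<^esub> (x \<oplus>\<^bsub>M\<^esub> a \<odot>\<^bsub>M\<^esub> s) = r \<odot>\<^bsub>M\<^esub> x \<oplus>\<^bsub>M\<^esub> (r \<otimes> a) \<odot>\<^bsub>M\<^esub> s"
        using * s L(2) r by (simp add: smult_r_distr smult_assoc1)
      then have "r \<odot>\<^bsub>M\<^esub> x \<oplus>\<^bsub>M\<^esub> (r \<otimes> a) \<odot>\<^bsub>M\<^esub> s \<in> U n" using Un(5)[OF r *(3)] by simp
      then show "r \<otimes> a \<in> C n" using * r L(5)[OF r *(2)] by (auto simp: C_def)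
    qed
    moreover have "C (Suc n) \<subseteq> C n" for n using U(2) by (auto simp: C_def)
    ultimately obtain n1 where n1: "\<forall>m\<ge>n1. C m = C n1"
      using art unfolding left_artinian_def by blast
    obtain n2 where n2: "\<forall>m\<ge>n2. U m \<inter> L = U n2 \<inter> L" using adjoin.IH by blast
    define n where "n = max n1 n2"
    have nC: "C m = C n" if "n \<le> m" for m
      using n1[rule_format, of m] n1[rule_format, of n] that by (simp add: n_def)
    have nL: "U m \<inter> L = U n \<inter> L" if "n \<le> m" for m
      using n2[rule_format, of m] n2[rule_format, of n] that by (simp add: n_def)
    have "U n \<inter> submodule_adjoin R M L s \<subseteq> U m" if m: "n \<le> m" for m
    proof
      fix x assume x: "x \<in> U n \<inter> submodule_adjoin R M L s"
      then obtain u k where k: "x = u \<oplus>\<^bsub>M\<^esub> k \<odot>\<^bsub>M\<^esub> s" "u \<in> L" "k \<in> carrier R"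
        using submodule_adjoinE by blast
      then have "k \<in> C n" using x by (auto simp: C_def)
      then have "k \<in> C m" using nC[OF m] by simp
      \<comment> \<open>This element of \<open>U m\<close> has the same coefficient at
        \<open>s\<close> as \<open>x\<close>, so the difference is \<open>u - v\<close> in
        \<open>L\<close>, where the traces at \<open>m\<close> and \<open>n\<close> agree.\<close>
      then obtain v where v: "v \<in> L" "v \<oplus>\<^bsub>M\<^esub> k \<odot>\<^bsub>M\<^esub> s \<in> U m" by (auto simp: C_def)
      have c: "u \<in> carrier M" "v \<in> carrier M" "k \<odot>\<^bsub>M\<^esub> s \<in> carrier M" using k v L(2) s by auto
      have "x \<ominus>\<^bsub>M\<^esub> (v \<oplus>\<^bsub>M\<^esub> k \<odot>\<^bsub>M\<^esub> s) = u \<ominus>\<^bsub>M\<^esub> v"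
        using k(1) c by (simp add: M.minus_eq M.minus_add M.a_ac M.r_neg1 M.r_neg)
      moreover have "x \<ominus>\<^bsub>M\<^esub> (v \<oplus>\<^bsub>M\<^esub> k \<odot>\<^bsub>M\<^esub> s) \<in> U n"
        using submodule_minus[OF U(1)] x v(2) anti[OF m] by blast
      ultimately have "u \<ominus>\<^bsub>M\<^esub> v \<in> U m"
        using nL[OF m] submodule_minus[OF adjoin.hyps(1) k(2) v(1)] by auto
      then have "(u \<ominus>\<^bsub>M\<^esub> v) \<oplus>\<^bsub>M\<^esub> (v \<oplus>\<^bsub>M\<^esub> k \<odot>\<^bsub>M\<^esub> s) \<in> U m" using submoduleD(4)[OF U(1)] v by blast
      moreover have "(u \<ominus>\<^bsub>M\<^esub> v) \<oplus>\<^bsub>M\<^esub> (v \<oplus>\<^bsub>M\<^esub> k \<odot>\<^bsub>M\<^esub> s) = x"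
        using k(1) c by (simp add: M.minus_eq M.a_assoc M.r_neg1)
      ultimately show "x \<in> U m" by simp
    qed
    then have "U m \<inter> submodule_adjoin R M L s = U n \<inter> submodule_adjoin R M L s" if "n \<le> m" for m
      using anti that by blast
    then show ?case by blast
  qed
  moreover have "U n \<inter> carrier M = U n" for n using submoduleD(1)[OF U(1)] by blast
  ultimately show ?thesis by simp
qed

end

section \<open>Extension, separation and representation of functionals\<close>

locale self_dual_module = self_dual_ring K + module K M
  for K :: "('k, 'm) ring_scheme" (structure) and M :: "('k, 'b, 'n) module_scheme" (structure)
begin

lemma linear_on_zero:
  assumes "linear_on K M N f" "submodule N K M"
  shows "f \<zero>\<^bsub>M\<^esub> = \<zero>"
proof -
  have "f (\<zero> \<odot>\<^bsub>M\<^esub> \<zero>\<^bsub>M\<^esub>) = \<zero> \<otimes> f \<zero>\<^bsub>M\<^esub>" by (rule linear_onD(3)[OF assms(1)]) (use submoduleD(3)[OF assms(2)] in auto)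
  then show ?thesis using linear_onD(1)[OF assms(1) submoduleD(3)[OF assms(2)]] by simp
qed

lemma linear_on_minus:
  assumes "linear_on K M N f" "submodule N K M" "x \<in> N" "y \<in> N"
  shows "f (x \<ominus>\<^bsub>M\<^esub> y) = f x \<ominus> f y"
proof -
  note N = submoduleD[OF assms(2)] and f = linear_onD[OF assms(1)]
  have "f ((\<ominus> \<one>) \<odot>\<^bsub>M\<^esub> y) = \<ominus> f y" using f(3)[of "\<ominus> \<one>" y] f(1) assms by (simp add: l_minus)
  moreover have "(\<ominus> \<one>) \<odot>\<^bsub>M\<^esub> y = \<ominus>\<^bsub>M\<^esub> y" using N(2) assms by (simp add: smult_l_minus)
  moreover have "\<ominus>\<^bsub>M\<^esub> y \<in> N" using submoduleE(3)[OF assms(2)] assms by blast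
  ultimately show ?thesis using f(2)[OF assms(3), of "\<ominus>\<^bsub>M\<^esub> y"] by (simp add: a_minus_def)
qed

text \<open>The compatibility condition is exactly what makes
  \<open>n + k s \<mapsto> f n + k c\<close> well defined. The value \<open>c\<close> is a parameter
  because it has two sources: Baer's criterion, and a nonzero annihilator.\<close>

lemma extend_linear_by_value:
  assumes N: "submodule N K M" and f: "linear_on K M N f" and s: "s \<in> carrier M"
    and c: "c \<in> carrier K"
    and compat: "\<And>k. k \<in> carrier K \<Longrightarrow> k \<odot>\<^bsub>M\<^esub> s \<in> N \<Longrightarrow> f (k \<odot>\<^bsub>M\<^esub> s) = k \<otimes> c"
  obtains g where "linear_on K M (submodule_adjoin K M N s) g" "\<And>x. x \<in> N \<Longrightarrow> g x = f x" "g s = c"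
proof -
  note D = submoduleD[OF N] and F = linear_onD[OF f]
  define g where "g x = (SOME v. \<exists>n\<in>N. \<exists>k\<in>carrier K. x = n \<oplus>\<^bsub>M\<^esub> k \<odot>\<^bsub>M\<^esub> s \<and> v = f n \<oplus> k \<otimes> c)" for x
  have wd: "f n \<oplus> k \<otimes> c = f n' \<oplus> k' \<otimes> c"
    if *: "n \<in> N" "k \<in> carrier K" "n' \<in> N" "k' \<in> carrier K" "n \<oplus>\<^bsub>M\<^esub> k \<odot>\<^bsub>M\<^esub> s = n' \<oplus>\<^bsub>M\<^esub> k' \<odot>\<^bsub>M\<^esub> s" for n k n' k'
  proof -
    have car: "n \<in> carrier M" "n' \<in> carrier M" "k \<odot>\<^bsub>M\<^esub> s \<in> carrier M" "k' \<odot>\<^bsub>M\<^esub> s \<in> carrier M"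
      using * D(2) s by auto
    have "(k \<ominus> k') \<odot>\<^bsub>M\<^esub> s = k \<odot>\<^bsub>M\<^esub> s \<ominus>\<^bsub>M\<^esub> k' \<odot>\<^bsub>M\<^esub> s"
      using * s by (simp add: a_minus_def smult_l_distr smult_l_minus)
    also have "\<dots> = (\<ominus>\<^bsub>M\<^esub> n \<oplus>\<^bsub>M\<^esub> (n \<oplus>\<^bsub>M\<^esub> k \<odot>\<^bsub>M\<^esub> s)) \<ominus>\<^bsub>M\<^esub> k' \<odot>\<^bsub>M\<^esub> s" using car by (simp add: M.r_neg1)
    also have "\<dots> = n' \<ominus>\<^bsub>M\<^esub> n"
      unfolding *(5) using car by (simp add: M.minus_eq M.a_ac M.r_neg)
    finally have eq: "(k \<ominus> k') \<odot>\<^bsub>M\<^esub> s = n' \<ominus>\<^bsub>M\<^esub> n" .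
    then have "f (n' \<ominus>\<^bsub>M\<^esub> n) = (k \<ominus> k') \<otimes> c"
      using compat[of "k \<ominus> k'"] submodule_minus[OF N *(3,1)] * by simp
    then have "f n' \<ominus> f n = (k \<ominus> k') \<otimes> c" using linear_on_minus[OF f N *(3,1)] by simp
    then have e: "f n \<oplus> k' \<otimes> c \<oplus> (f n' \<ominus> f n) = f n \<oplus> k' \<otimes> c \<oplus> (k \<ominus> k') \<otimes> c" by simp
    have "f n \<oplus> k' \<otimes> c \<oplus> (f n' \<ominus> f n) = f n' \<oplus> k' \<otimes> c"
      using F(1)[OF *(1)] F(1)[OF *(3)] *(2,4) c by algebra
    moreover have "f n \<oplus> k' \<otimes> c \<oplus> (k \<ominus> k') \<otimes> c = f n \<oplus> k \<otimes> c"
      using F(1)[OF *(1)] F(1)[OF *(3)] *(2,4) c by algebra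
    ultimately show ?thesis using e by simp
  qed
  have g: "g (n \<oplus>\<^bsub>M\<^esub> k \<odot>\<^bsub>M\<^esub> s) = f n \<oplus> k \<otimes> c" if "n \<in> N" "k \<in> carrier K" for n k
    unfolding g_def
  proof (rule some_equality)
    show "\<exists>n'\<in>N. \<exists>k'\<in>carrier K. n \<oplus>\<^bsub>M\<^esub> k \<odot>\<^bsub>M\<^esub> s = n' \<oplus>\<^bsub>M\<^esub> k' \<odot>\<^bsub>M\<^esub> s \<and>
        f n \<oplus> k \<otimes> c = f n' \<oplus> k' \<otimes> c" using that by blast
    fix v
    assume "\<exists>n'\<in>N. \<exists>k'\<in>carrier K. n \<oplus>\<^bsub>M\<^esub> k \<odot>\<^bsub>M\<^esub> s = n' \<oplus>\<^bsub>M\<^esub> k' \<odot>\<^bsub>M\<^esub> s \<and> v = f n' \<oplus> k' \<otimes> c"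
    then obtain n' k' where v: "n' \<in> N" "k' \<in> carrier K"
      "n \<oplus>\<^bsub>M\<^esub> k \<odot>\<^bsub>M\<^esub> s = n' \<oplus>\<^bsub>M\<^esub> k' \<odot>\<^bsub>M\<^esub> s" "v = f n' \<oplus> k' \<otimes> c" by blast
    then show "v = f n \<oplus> k \<otimes> c" using wd[OF that v(1,2,3)] by simp
  qed
  have "linear_on K M (submodule_adjoin K M N s) g"
  proof (rule linear_onI)
    fix x assume "x \<in> submodule_adjoin K M N s"
    then obtain n k where *: "x = n \<oplus>\<^bsub>M\<^esub> k \<odot>\<^bsub>M\<^esub> s" "n \<in> N" "k \<in> carrier K" by (rule submodule_adjoinE)
    show "g x \<in> carrier K" using g * F(1) c by simp
    fix y assume "y \<in> submodule_adjoin K M N s"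
    then obtain n' k' where **: "y = n' \<oplus>\<^bsub>M\<^esub> k' \<odot>\<^bsub>M\<^esub> s" "n' \<in> N" "k' \<in> carrier K" by (rule submodule_adjoinE)
    have "x \<oplus>\<^bsub>M\<^esub> y = (n \<oplus>\<^bsub>M\<^esub> n') \<oplus>\<^bsub>M\<^esub> (k \<oplus> k') \<odot>\<^bsub>M\<^esub> s"
      using * ** s D(2) by (simp add: smult_l_distr M.a_ac)
    then have "g (x \<oplus>\<^bsub>M\<^esub> y) = f (n \<oplus>\<^bsub>M\<^esub> n') \<oplus> (k \<oplus> k') \<otimes> c" using g * ** D(4) by simp
    also have "\<dots> = (f n \<oplus> f n') \<oplus> (k \<oplus> k') \<otimes> c" using F(2) * ** by simp
    also have "\<dots> = g x \<oplus> g y"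
      using F(1)[OF *(2)] F(1)[OF **(2)] *(3) **(3) c unfolding *(1) **(1) g[OF *(2,3)] g[OF **(2,3)]
      by algebra
    finally show "g (x \<oplus>\<^bsub>M\<^esub> y) = g x \<oplus> g y" .
  next
    fix a x assume a: "a \<in> carrier K" and "x \<in> submodule_adjoin K M N s"
    then obtain n k where *: "x = n \<oplus>\<^bsub>M\<^esub> k \<odot>\<^bsub>M\<^esub> s" "n \<in> N" "k \<in> carrier K" by (auto elim: submodule_adjoinE)
    have "a \<odot>\<^bsub>M\<^esub> x = a \<odot>\<^bsub>M\<^esub> n \<oplus>\<^bsub>M\<^esub> (a \<otimes> k) \<odot>\<^bsub>M\<^esub> s"
      using * s D(2) a by (simp add: smult_r_distr smult_assoc1)
    then have "g (a \<odot>\<^bsub>M\<^esub> x) = f (a \<odot>\<^bsub>M\<^esub> n) \<oplus> (a \<otimes> k) \<otimes> c" using g * D(5) a by simp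
    also have "\<dots> = a \<otimes> g x"
      using F(1)[OF *(2)] F(3)[OF a *(2)] *(3) c a g[OF *(2,3)] *(1) by (simp add: r_distr m_assoc)
    finally show "g (a \<odot>\<^bsub>M\<^esub> x) = a \<otimes> g x" .
  qed
  moreover have "g x = f x" if "x \<in> N" for x
    using g[OF that, of \<zero>] D(2)[OF that] s F(1)[OF that] c by simp
  moreover have "g s = c" using g[OF D(3), of \<one>] s c linear_on_zero[OF f N] by simp
  ultimately show ?thesis using that by blast
qed

text \<open>Only one new generator \<open>s\<close> has to be treated at a time. Baer's criterion
  for \<open>k \<mapsto> h (k s)\<close> on the conductor of \<open>s\<close> yields the value to
  prescribe at \<open>s\<close>.\<close>

lemma extend_linear:
  assumes fg: "finitely_generated_module K M" and N: "submodule N K M" and f: "linear_on K M N f"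
  obtains g where "linear_on K M (carrier M) g" "\<And>x. x \<in> N \<Longrightarrow> g x = f x"
proof -
  have "\<exists>g. linear_on K M (carrier M) g \<and> (\<forall>x\<in>N. g x = f x)"
    using fg N
  proof (induction rule: finitely_generated_induct)
    case base
    then show ?case using f by blast
  next
    case (adjoin L s)
    note L = submoduleD[OF adjoin.hyps(1)] and s = adjoin.hyps(3)
    obtain h where h: "linear_on K M L h" "\<forall>x\<in>N. h x = f x" using adjoin.IH by blast
    note H = linear_onD[OF h(1)]
    let ?I = "{k \<in> carrier K. k \<odot>\<^bsub>M\<^esub> s \<in> L}"
    have "left_ideal ?I K"
      by (rule left_idealI) (use L s in \<open>auto simp: smult_l_distr smult_assoc1\<close>)
    moreover have "linear_on K (regular_module K) ?I (\<lambda>k. h (k \<odot>\<^bsub>M\<^esub> s))"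
      by (rule linear_onI) (use H s in \<open>auto simp: regular_module_def smult_l_distr smult_assoc1\<close>)
    ultimately obtain c where c: "c \<in> carrier K" "\<forall>k\<in>?I. h (k \<odot>\<^bsub>M\<^esub> s) = c \<otimes> k"
      using baer by blast
    obtain g where g: "linear_on K M (submodule_adjoin K M L s) g" "\<And>x. x \<in> L \<Longrightarrow> g x = h x"
      by (rule extend_linear_by_value[OF adjoin.hyps(1) h(1) s c(1)]) (use c in \<open>auto simp: m_comm\<close>)
    then show ?case using h(2) adjoin.hyps(2) by (intro exI[of _ g]) auto
  qed
  then show ?thesis using that by blast
qed

text \<open>The zero functional on \<open>N\<close> extends with any value at \<open>x\<close> that
  is annihilated by the conductor of \<open>x\<close>. The conductor is proper, so a nonzero such
  value exists.\<close>

lemma separating_functional: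
  assumes fg: "finitely_generated_module K M" and N: "submodule N K M"
    and x: "x \<in> carrier M" "x \<notin> N"
  obtains g where "linear_on K M (carrier M) g" "\<And>y. y \<in> N \<Longrightarrow> g y = \<zero>" "g x \<noteq> \<zero>"
proof -
  note D = submoduleD[OF N]
  let ?I = "{k \<in> carrier K. k \<odot>\<^bsub>M\<^esub> x \<in> N}"
  have I: "left_ideal ?I K"
    by (rule left_idealI) (use D x in \<open>auto simp: smult_l_distr smult_assoc1\<close>)
  moreover have "\<one> \<notin> ?I" using x by simp
  ultimately have "annihilator K ?I \<noteq> {\<zero>}" using cogenerator[OF I] by blast
  moreover have "\<zero> \<in> annihilator K ?I" by (simp add: annihilator_def)
  ultimately obtain w where w: "w \<in> annihilator K ?I" "w \<noteq> \<zero>" by blast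
  have wc: "w \<in> carrier K" using w by (simp add: annihilator_def)
  have z: "linear_on K M N (\<lambda>_. \<zero>)" by (rule linear_onI) auto
  obtain h where h: "linear_on K M (submodule_adjoin K M N x) h" "\<And>y. y \<in> N \<Longrightarrow> h y = \<zero>" "h x = w"
    by (rule extend_linear_by_value[OF N z x(1) wc])
      (use w wc in \<open>auto simp: annihilator_def m_comm\<close>)
  obtain g where g: "linear_on K M (carrier M) g" "\<And>y. y \<in> submodule_adjoin K M N x \<Longrightarrow> g y = h y"
    using extend_linear[OF fg submodule_adjoin(1)[OF N x(1)] h(1)] by metis
  show ?thesis
  proof (rule that[OF g(1)])
    show "g y = \<zero>" if "y \<in> N" for y using g(2) h(2) that submodule_adjoin(2)[OF N x(1)] by auto
    show "g x \<noteq> \<zero>" using g(2) h(3) w submodule_adjoin(3)[OF N x(1)] by simp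
  qed
qed

text \<open>Linear combinations of the functionals \<open>p (-) s\<close> are again of the form \<open>p (-) z\<close>, so this says that
  a functional which vanishes on the common kernel of finitely many functionals is a linear
  combination of them.\<close>

lemma functional_represented_on:
  assumes p: "bilinear_form K M p" and S: "finite S" "S \<subseteq> carrier M"
    and N: "submodule N K M" and f: "linear_on K M N f"
    and ker: "\<And>x. x \<in> N \<Longrightarrow> (\<And>s. s \<in> S \<Longrightarrow> p x s = \<zero>) \<Longrightarrow> f x = \<zero>"
  shows "\<exists>z\<in>carrier M. \<forall>x\<in>N. f x = p x z"
  using S N f ker
proof (induction arbitrary: N f)
  case empty
  have P: "p x (\<zero> \<odot>\<^bsub>M\<^esub> \<zero>\<^bsub>M\<^esub>) = \<zero> \<otimes> p x \<zero>\<^bsub>M\<^esub>" "p x \<zero>\<^bsub>M\<^esub> \<in> carrier K" if "x \<in> carrier M" for x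
    using p that unfolding bilinear_form_def by blast+
  have "f x = p x \<zero>\<^bsub>M\<^esub>" if "x \<in> N" for x
    using empty.prems(4)[OF that] P submoduleD(2)[OF empty.prems(2) that] by simp
  then show ?case by blast
next
  case (insert s S)
  note N = submoduleD[OF insert.prems(2)] and F = linear_onD[OF insert.prems(3)]
  have s: "s \<in> carrier M" using insert.prems by blast
  have P: "\<And>x y. x \<in> carrier M \<Longrightarrow> y \<in> carrier M \<Longrightarrow> p x y \<in> carrier K"
    "\<And>x y z. x \<in> carrier M \<Longrightarrow> y \<in> carrier M \<Longrightarrow> z \<in> carrier M \<Longrightarrow> p (x \<oplus>\<^bsub>M\<^esub> y) z = p x z \<oplus> p y z"
    "\<And>x y z. x \<in> carrier M \<Longrightarrow> y \<in> carrier M \<Longrightarrow> z \<in> carrier M \<Longrightarrow> p x (y \<oplus>\<^bsub>M\<^esub> z) = p x y \<oplus> p x z"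
    "\<And>a x y. a \<in> carrier K \<Longrightarrow> x \<in> carrier M \<Longrightarrow> y \<in> carrier M \<Longrightarrow> p (a \<odot>\<^bsub>M\<^esub> x) y = a \<otimes> p x y"
    "\<And>a x y. a \<in> carrier K \<Longrightarrow> x \<in> carrier M \<Longrightarrow> y \<in> carrier M \<Longrightarrow> p x (a \<odot>\<^bsub>M\<^esub> y) = a \<otimes> p x y"
    using p unfolding bilinear_form_def by blast+
  have p0: "p \<zero>\<^bsub>M\<^esub> s = \<zero>" using P(4)[of \<zero> "\<zero>\<^bsub>M\<^esub>" s] P(1)[of "\<zero>\<^bsub>M\<^esub>" s] s by simp
  let ?N = "{x \<in> N. p x s = \<zero>}"
  have N': "submodule ?N K M"
    by (rule submodule_intro) (use N P s p0 in \<open>auto simp: subset_iff\<close>)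
  \<comment> \<open>On the kernel of \<open>p (-) s\<close> the remaining functionals are enough,
    which is why the statement is proved for arbitrary submodules \<open>N\<close>.\<close>
  have "\<exists>z\<in>carrier M. \<forall>x\<in>?N. f x = p x z"
  proof (rule insert.IH[OF _ N'])
    show "linear_on K M ?N f" by (rule linear_on_subset[OF insert.prems(3)]) simp
    show "f x = \<zero>" if "x \<in> ?N" "\<And>t. t \<in> S \<Longrightarrow> p x t = \<zero>" for x using insert.prems(4) that by blast
  qed (use insert.prems in blast)
  then obtain z where z: "z \<in> carrier M" "\<And>x. x \<in> ?N \<Longrightarrow> f x = p x z" by blast
  have h: "linear_on K M N (\<lambda>x. f x \<ominus> p x z)"
  proof (rule linear_onI)
    fix x y assume xy: "x \<in> N" "y \<in> N"
    have c: "f x \<in> carrier K" "f y \<in> carrier K" "p x z \<in> carrier K" "p y z \<in> carrier K"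
      using F(1) P(1) N(2) xy z by auto
    have "f (x \<oplus>\<^bsub>M\<^esub> y) \<ominus> p (x \<oplus>\<^bsub>M\<^esub> y) z = (f x \<oplus> f y) \<ominus> (p x z \<oplus> p y z)"
      using F(2)[OF xy] P(2)[OF N(2)[OF xy(1)] N(2)[OF xy(2)] z(1)] by simp
    also have "\<dots> = (f x \<ominus> p x z) \<oplus> (f y \<ominus> p y z)" using c by algebra
    finally show "f (x \<oplus>\<^bsub>M\<^esub> y) \<ominus> p (x \<oplus>\<^bsub>M\<^esub> y) z = (f x \<ominus> p x z) \<oplus> (f y \<ominus> p y z)" .
  next
    fix a x assume ax: "a \<in> carrier K" "x \<in> N"
    have c: "f x \<in> carrier K" "p x z \<in> carrier K" using F(1) P(1) N(2) ax z by auto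
    have "f (a \<odot>\<^bsub>M\<^esub> x) \<ominus> p (a \<odot>\<^bsub>M\<^esub> x) z = a \<otimes> f x \<ominus> a \<otimes> p x z"
      using F(3)[OF ax] P(4)[OF ax(1) N(2)[OF ax(2)] z(1)] by simp
    also have "\<dots> = a \<otimes> (f x \<ominus> p x z)" using c ax by algebra
    finally show "f (a \<odot>\<^bsub>M\<^esub> x) \<ominus> p (a \<odot>\<^bsub>M\<^esub> x) z = a \<otimes> (f x \<ominus> p x z)" .
  qed (use F(1) P(1) N(2) z in auto)
  let ?h = "\<lambda>x. f x \<ominus> p x z"
  note H = linear_onD[OF h]
  \<comment> \<open>The error \<open>f - p (-) z\<close> vanishes wherever \<open>p (-) s\<close>
    does, so it factors through the values of \<open>p (-) s\<close>, an ideal of \<open>K\<close>.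
    By Baer's criterion the factor is multiplication by some \<open>c\<close>, and
    \<open>z + c s\<close> represents \<open>f\<close>.\<close>
  have hker: "?h x = ?h y" if xy: "x \<in> N" "y \<in> N" "p x s = p y s" for x y
  proof -
    have ps: "linear_on K M N (\<lambda>x. p x s)" by (rule linear_onI) (use P N(2) s in auto)
    have c: "x \<in> carrier M" "y \<in> carrier M" using N(2) xy by auto
    have "p (x \<ominus>\<^bsub>M\<^esub> y) s = \<zero>"
      using linear_on_minus[OF ps insert.prems(2) xy(1,2)] xy(3) P(1) s c by (simp add: minus_eq_zero_iff)
    then have m: "x \<ominus>\<^bsub>M\<^esub> y \<in> ?N" using submodule_minus[OF insert.prems(2) xy(1,2)] by simp
    have "?h (x \<ominus>\<^bsub>M\<^esub> y) = \<zero>" using z(2)[OF m] P(1)[OF _ z(1)] c by (simp add: minus_eq_zero_iff)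
    then have "?h x \<ominus> ?h y = \<zero>" using linear_on_minus[OF h insert.prems(2) xy(1,2)] by simp
    then show ?thesis using H(1)[OF xy(1)] H(1)[OF xy(2)] minus_eq_zero_iff by blast
  qed
  let ?I = "(\<lambda>x. p x s) ` N"
  define g where "g y = ?h (SOME x. x \<in> N \<and> p x s = y)" for y
  have g: "g (p x s) = ?h x" if x: "x \<in> N" for x
  proof -
    let ?x = "SOME x'. x' \<in> N \<and> p x' s = p x s"
    have "?x \<in> N \<and> p ?x s = p x s" by (rule someI[of _ x]) (use x in simp)
    then show ?thesis unfolding g_def using hker x by blast
  qed
  have "left_ideal ?I K"
  proof (rule left_idealI)
    show "?I \<subseteq> carrier K" using P(1) N(2) s by auto
    show "\<zero> \<in> ?I" using p0 N(3) by (metis image_eqI)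
    fix u v assume "u \<in> ?I" "v \<in> ?I"
    then obtain x y where "x \<in> N" "y \<in> N" "u = p x s" "v = p y s" by blast
    then show "u \<oplus> v \<in> ?I" using P(2) N(2,4) s by (intro image_eqI[of _ _ "x \<oplus>\<^bsub>M\<^esub> y"]) auto
  next
    fix a u assume a: "a \<in> carrier K" and "u \<in> ?I"
    then obtain x where "x \<in> N" "u = p x s" by blast
    then show "a \<otimes> u \<in> ?I" using P(4) N(2,5) s a by (intro image_eqI[of _ _ "a \<odot>\<^bsub>M\<^esub> x"]) auto
  qed
  moreover have "linear_on K (regular_module K) ?I g"
  proof (rule linear_onI)
    fix u assume "u \<in> ?I"
    then obtain x where x: "x \<in> N" "u = p x s" by blast
    show "g u \<in> carrier K" using g x H(1) by simp
    fix v assume "v \<in> ?I"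
    then obtain y where y: "y \<in> N" "v = p y s" by blast
    have "u \<oplus> v = p (x \<oplus>\<^bsub>M\<^esub> y) s" using P(2) N(2) s x y by simp
    then show "g (u \<oplus>\<^bsub>regular_module K\<^esub> v) = g u \<oplus> g v"
      using g[OF N(4)[OF x(1) y(1)]] g[OF x(1)] g[OF y(1)] H(2)[OF x(1) y(1)] x y
      by (simp add: regular_module_def)
  next
    fix a u assume a: "a \<in> carrier K" and "u \<in> ?I"
    then obtain x where x: "x \<in> N" "u = p x s" by blast
    have "a \<otimes> u = p (a \<odot>\<^bsub>M\<^esub> x) s" using P(4) N(2) s x a by simp
    then show "g (a \<odot>\<^bsub>regular_module K\<^esub> u) = a \<otimes> g u"
      using g[OF N(5)[OF a x(1)]] g[OF x(1)] H(3)[OF a x(1)] x by (simp add: regular_module_def)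
  qed
  ultimately obtain c where c: "c \<in> carrier K" "\<forall>y\<in>?I. g y = c \<otimes> y" using baer by blast
  have "f x = p x (z \<oplus>\<^bsub>M\<^esub> c \<odot>\<^bsub>M\<^esub> s)" if x: "x \<in> N" for x
  proof -
    have car: "f x \<in> carrier K" "p x z \<in> carrier K" "p x s \<in> carrier K"
      using F(1) P(1) N(2) x z s by auto
    have "f x \<ominus> p x z = c \<otimes> p x s" using c(2) g[OF x] x by simp
    then have "p x z \<oplus> (f x \<ominus> p x z) = p x z \<oplus> c \<otimes> p x s" by simp
    moreover have "p x z \<oplus> (f x \<ominus> p x z) = f x" using car by algebra
    moreover have "p x (z \<oplus>\<^bsub>M\<^esub> c \<odot>\<^bsub>M\<^esub> s) = p x z \<oplus> c \<otimes> p x s"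
      using P(3)[OF N(2)[OF x] z(1)] P(5)[OF c(1) N(2)[OF x] s] c(1) s by simp
    ultimately show ?thesis by simp
  qed
  moreover have "z \<oplus>\<^bsub>M\<^esub> c \<odot>\<^bsub>M\<^esub> s \<in> carrier M" using z c s by simp
  ultimately show ?case by blast
qed

text \<open>For fixed \<open>x\<close> the elements \<open>y\<close> with
  \<open>p x y = \<zero>\<close> form a submodule, so vanishing on finitely many generators is
  vanishing everywhere, and only finitely many functionals have to be combined.\<close>

lemma functional_represented:
  assumes fg: "finitely_generated_module K M" and p: "bilinear_form K M p"
    and f: "linear_on K M (carrier M) f"
    and ker: "\<And>x. x \<in> carrier M \<Longrightarrow> (\<And>y. y \<in> carrier M \<Longrightarrow> p x y = \<zero>) \<Longrightarrow> f x = \<zero>"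
  shows "\<exists>z\<in>carrier M. \<forall>x\<in>carrier M. f x = p x z"
proof -
  obtain S where S: "finite S" "S \<subseteq> carrier M"
    and gen: "\<And>N. submodule N K M \<Longrightarrow> S \<subseteq> N \<Longrightarrow> N = carrier M"
    using finitely_generatedE[OF fg] by blast
  show ?thesis
  proof (rule functional_represented_on[OF p S carrier_is_submodule f])
    fix x assume x: "x \<in> carrier M" and s: "\<And>s. s \<in> S \<Longrightarrow> p x s = \<zero>"
    have P: "\<And>y. y \<in> carrier M \<Longrightarrow> p x y \<in> carrier K"
      "\<And>y z. y \<in> carrier M \<Longrightarrow> z \<in> carrier M \<Longrightarrow> p x (y \<oplus>\<^bsub>M\<^esub> z) = p x y \<oplus> p x z"
      "\<And>a y. a \<in> carrier K \<Longrightarrow> y \<in> carrier M \<Longrightarrow> p x (a \<odot>\<^bsub>M\<^esub> y) = a \<otimes> p x y"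
      using p x unfolding bilinear_form_def by blast+
    have "p x \<zero>\<^bsub>M\<^esub> = \<zero>" using P(3)[of \<zero> "\<zero>\<^bsub>M\<^esub>"] P(1)[of "\<zero>\<^bsub>M\<^esub>"] by simp
    then have "submodule {y \<in> carrier M. p x y = \<zero>} K M"
      by (intro submodule_intro) (use P in auto)
    then have "{y \<in> carrier M. p x y = \<zero>} = carrier M" by (rule gen) (use s S in blast)
    then show "f x = \<zero>" using ker[OF x] by blast
  qed
qed

end

section \<open>The opposite ring\<close>

lemma opposite_ring_simps [simp]:
  "carrier (opposite_ring R) = carrier R" "\<zero>\<^bsub>opposite_ring R\<^esub> = \<zero>\<^bsub>R\<^esub>" "\<one>\<^bsub>opposite_ring R\<^esub> = \<one>\<^bsub>R\<^esub>"
  "x \<oplus>\<^bsub>opposite_ring R\<^esub> y = x \<oplus>\<^bsub>R\<^esub> y" "x \<otimes>\<^bsub>opposite_ring R\<^esub> y = y \<otimes>\<^bsub>R\<^esub> x"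
  "\<ominus>\<^bsub>opposite_ring R\<^esub> x = \<ominus>\<^bsub>R\<^esub> x" "x \<ominus>\<^bsub>opposite_ring R\<^esub> y = x \<ominus>\<^bsub>R\<^esub> y"
  "finsum (opposite_ring R) = finsum R"
  by (simp_all add: opposite_ring_def a_inv_def a_minus_def m_inv_def finsum_def fun_eq_iff)

lemma (in ring) ring_opposite: "ring (opposite_ring R)"
proof (rule ringI)
  show "abelian_group (opposite_ring R)"
    by (rule abelian_groupI) (auto simp: a_ac intro: bexI[of _ "\<ominus> _"] l_neg)
  show "monoid (opposite_ring R)" by (rule monoidI) (auto simp: m_assoc)
qed (auto simp: l_distr r_distr)

section \<open>The Jacobson radical\<close>

context ring
begin

lemma left_ideal_radical: "left_ideal (jacobson_radical R) R"
  unfolding jacobson_radical_def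
  by (rule left_ideal_Inter) (auto dest: maximal_left_idealD(1))

text \<open>Right multiplication by \<open>r\<close> embeds the quotient by the conductor into the
  simple module \<open>R / M\<close>, and the image is nonzero. This is why the radical, defined
  through left ideals, also absorbs multiplication from the right.\<close>

lemma maximal_left_ideal_conductor:
  assumes M: "maximal_left_ideal M R" and r: "r \<in> carrier R" "r \<notin> M"
  shows "maximal_left_ideal {x \<in> carrier R. x \<otimes> r \<in> M} R" (is "maximal_left_ideal ?C R")
  unfolding maximal_left_ideal_def
proof (intro conjI allI impI)
  note MD = maximal_left_idealD[OF M]
  note MI = left_idealD[OF MD(1)]
  show C: "left_ideal ?C R"
    by (rule left_idealI) (use MI r in \<open>auto simp: l_distr m_assoc\<close>)
  show "?C \<noteq> carrier R" using left_ideal_eq_carrier_iff[OF C] r by simp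
  fix L assume L: "left_ideal L R \<and> ?C \<subseteq> L"
  show "L = ?C \<or> L = carrier R"
  proof (cases "L \<subseteq> ?C")
    case False
    then obtain x where x: "x \<in> L" "x \<notin> ?C" by blast
    have xc: "x \<in> carrier R" using x L left_idealD(2) by blast
    obtain b where b: "b \<in> carrier R" "\<one> \<ominus> b \<otimes> (x \<otimes> r) \<in> M"
      using maximal_left_ideal_split[OF M, of "x \<otimes> r"] x xc r(1) by blast
    have "r \<otimes> (\<one> \<ominus> b \<otimes> (x \<otimes> r)) \<in> M" using MI(5) b r by blast
    moreover have "r \<otimes> (\<one> \<ominus> b \<otimes> (x \<otimes> r)) = (\<one> \<ominus> r \<otimes> b \<otimes> x) \<otimes> r"
      using r(1) b(1) xc by (simp add: a_minus_def l_distr r_distr l_minus r_minus m_assoc)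
    ultimately have "\<one> \<ominus> r \<otimes> b \<otimes> x \<in> ?C" using r(1) b(1) xc by simp
    then have "\<one> \<ominus> r \<otimes> b \<otimes> x \<in> L" using L by blast
    moreover have "r \<otimes> b \<otimes> x \<in> L" using left_idealD(5)[of L "r \<otimes> b" x] L x r b by simp
    ultimately have "\<one> \<in> L" using left_ideal_diff_cancel[of L] L by blast
    then show ?thesis using left_ideal_eq_carrier_iff L by blast
  qed (use L in blast)
qed

lemma radical_mult_right:
  assumes x: "x \<in> jacobson_radical R" and r: "r \<in> carrier R"
  shows "x \<otimes> r \<in> jacobson_radical R"
proof -
  have xc: "x \<in> carrier R" using x by (simp add: jacobson_radical_def)
  have "x \<otimes> r \<in> M" if M: "maximal_left_ideal M R" for M
  proof (cases "r \<in> M")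
    case True
    then show ?thesis using left_idealD(5)[OF maximal_left_idealD(1)[OF M] xc] by blast
  next
    case False
    then show ?thesis using maximal_left_ideal_conductor[OF M r] x by (auto simp: jacobson_radical_def)
  qed
  then show ?thesis using xc r by (auto simp: jacobson_radical_def)
qed

text \<open>Otherwise \<open>R (1 - j)\<close> would lie in a maximal left ideal, which contains
  \<open>j\<close> as well and hence \<open>\<one>\<close>.\<close>

lemma radical_left_inverse:
  assumes j: "j \<in> jacobson_radical R"
  obtains u where "u \<in> carrier R" "u \<otimes> (\<one> \<ominus> j) = \<one>"
proof (rule ccontr)
  assume no: "\<not> thesis"
  have jc: "j \<in> carrier R" using j by (simp add: jacobson_radical_def)
  let ?L = "{r \<otimes> (\<one> \<ominus> j) | r. r \<in> carrier R}"
  have L: "left_ideal ?L R" by (rule left_ideal_principal) (use jc in simp)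
  have notin: "\<one> \<notin> ?L" using no that by force
  show False
  proof (rule left_ideal_Zorn[OF L left_idealD(1)[OF L] notin])
    fix M assume M: "left_ideal M R" "?L \<subseteq> M" "M \<subseteq> carrier R" "\<one> \<notin> M"
      and max: "\<And>V. left_ideal V R \<Longrightarrow> M \<subset> V \<Longrightarrow> V \<subseteq> carrier R \<Longrightarrow> \<one> \<in> V"
    have "maximal_left_ideal M R"
      unfolding maximal_left_ideal_def
    proof (intro conjI allI impI)
      fix V assume V: "left_ideal V R \<and> M \<subseteq> V"
      show "V = M \<or> V = carrier R"
      proof (cases "V = M")
        case False
        then have "\<one> \<in> V" using max[of V] V left_idealD(1)[of V] by blast
        then show ?thesis using left_ideal_eq_carrier_iff V by blast
      qed simp
    qed (use M in auto)
    then have "j \<in> M" using j by (simp add: jacobson_radical_def)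
    moreover have "\<one> \<otimes> (\<one> \<ominus> j) \<in> ?L" by blast
    then have "\<one> \<ominus> j \<in> M" using M(2) jc by auto
    ultimately show False using left_ideal_diff_cancel[OF M(1)] M(4) by blast
  qed
qed

text \<open>The left inverse \<open>u\<close> satisfies \<open>1 - u = - u j\<close>, again in the
  radical, so \<open>u\<close> has a left inverse too, and that can only be
  \<open>1 - j\<close>.\<close>

lemma radical_inverse:
  assumes j: "j \<in> jacobson_radical R"
  obtains u where "u \<in> carrier R" "u \<otimes> (\<one> \<ominus> j) = \<one>" "(\<one> \<ominus> j) \<otimes> u = \<one>"
proof -
  note J = left_idealD[OF left_ideal_radical]
  have jc: "j \<in> carrier R" using J(2)[OF j] .
  obtain u where u: "u \<in> carrier R" "u \<otimes> (\<one> \<ominus> j) = \<one>" using radical_left_inverse[OF j] .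
  have "u \<ominus> u \<otimes> j = \<one>" using u jc by (simp add: a_minus_def r_distr r_minus)
  then have "\<one> \<ominus> u = (u \<ominus> u \<otimes> j) \<ominus> u" by simp
  also have "\<dots> = \<ominus> (u \<otimes> j)" using u(1) jc by algebra
  finally have "\<one> \<ominus> u \<in> jacobson_radical R"
    using left_ideal_a_inv[OF left_ideal_radical J(5)[OF u(1) j]] by simp
  then obtain v where v: "v \<in> carrier R" "v \<otimes> (\<one> \<ominus> (\<one> \<ominus> u)) = \<one>"
    using radical_left_inverse by blast
  have "\<one> \<ominus> (\<one> \<ominus> u) = u" using u(1) by algebra
  then have vu: "v \<otimes> u = \<one>" using v by simp
  have "v = v \<otimes> (u \<otimes> (\<one> \<ominus> j))" using u v by simp
  also have "\<dots> = (v \<otimes> u) \<otimes> (\<one> \<ominus> j)" using u v jc by (simp add: m_assoc)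
  finally have "v = \<one> \<ominus> j" using vu jc by simp
  then show ?thesis using that u vu by blast
qed

text \<open>For \<open>y\<close> outside a maximal \<open>M\<close>, choose \<open>b\<close> with
  \<open>1 - b y\<close> in \<open>M\<close>. Then
  \<open>(1 + b y) (1 - b y) + b (y b y) = 1\<close> would lie in \<open>M\<close>.\<close>

lemma radical_semiprime:
  assumes y: "y \<in> carrier R" and nil: "\<And>r. r \<in> carrier R \<Longrightarrow> y \<otimes> r \<otimes> y \<in> jacobson_radical R"
  shows "y \<in> jacobson_radical R"
proof -
  have "y \<in> M" if M: "maximal_left_ideal M R" for M
  proof (rule ccontr)
    assume "y \<notin> M"
    then obtain b where b: "b \<in> carrier R" "\<one> \<ominus> b \<otimes> y \<in> M"
      using maximal_left_ideal_split[OF M y] by blast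
    note MI = left_idealD[OF maximal_left_idealD(1)[OF M]]
    have "(\<one> \<oplus> b \<otimes> y) \<otimes> (\<one> \<ominus> b \<otimes> y) \<in> M" using MI(5) b y by simp
    moreover have "b \<otimes> (y \<otimes> b \<otimes> y) \<in> M"
      using MI(5)[OF b(1)] nil[OF b(1)] M by (simp add: jacobson_radical_def)
    ultimately have "(\<one> \<oplus> b \<otimes> y) \<otimes> (\<one> \<ominus> b \<otimes> y) \<oplus> b \<otimes> (y \<otimes> b \<otimes> y) \<in> M" using MI(4) by blast
    moreover have "(\<one> \<oplus> b \<otimes> y) \<otimes> (\<one> \<ominus> b \<otimes> y) \<oplus> b \<otimes> (y \<otimes> b \<otimes> y) = \<one>"
    proof -
      define t where "t = b \<otimes> y"
      have t: "t \<in> carrier R" "b \<otimes> (y \<otimes> b \<otimes> y) = t \<otimes> t" using b y by (simp_all add: t_def m_assoc)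
      have "t \<oplus> (\<one> \<oplus> \<ominus> t) = \<one>" using a_lcomm[of t \<one> "\<ominus> t"] t(1) by (simp add: r_neg)
      then have "(\<one> \<oplus> t) \<otimes> (\<one> \<ominus> t) \<oplus> t \<otimes> t = \<one>" using t(1) by (simp add: a_minus_def l_distr r_distr r_minus minus_add a_ac r_neg r_neg1 r_neg2)
      then show ?thesis using t by (simp add: t_def)
    qed
    ultimately show False using maximal_left_idealD(3)[OF M] by simp
  qed
  then show ?thesis using y by (auto simp: jacobson_radical_def)
qed

end

section \<open>Orthogonal primitive idempotents modulo the radical\<close>

text \<open>The conditions are symmetric under passage to the opposite ring. They say that \<open>R / J\<close> is the
  sum of the simple left ideals generated by the classes of the \<open>e i\<close>, and likewise on the right.\<close>

locale primitive_decomposition = ring R for R :: "('a, 'm) ring_scheme" (structure) +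
  fixes J :: "'a set" and I :: "'i set" and e :: "'i \<Rightarrow> 'a"
  assumes J_left_ideal: "left_ideal J R"
    and J_right: "\<lbrakk>x \<in> J; r \<in> carrier R\<rbrakk> \<Longrightarrow> x \<otimes> r \<in> J"
    and J_inverse: "j \<in> J \<Longrightarrow> \<exists>u\<in>carrier R. u \<otimes> (\<one> \<ominus> j) = \<one> \<and> (\<one> \<ominus> j) \<otimes> u = \<one>"
    and finite_I: "finite I"
    and e_closed: "i \<in> I \<Longrightarrow> e i \<in> carrier R"
    and e_sum: "\<one> \<ominus> finsum R e I \<in> J"
    and e_idem: "i \<in> I \<Longrightarrow> e i \<otimes> e i \<ominus> e i \<in> J"
    and e_orth: "\<lbrakk>i \<in> I; k \<in> I; i \<noteq> k\<rbrakk> \<Longrightarrow> e i \<otimes> e k \<in> J"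
    and e_left: "\<lbrakk>i \<in> I; r \<in> carrier R; r \<otimes> e i \<notin> J\<rbrakk> \<Longrightarrow> \<exists>s\<in>carrier R. s \<otimes> (r \<otimes> e i) \<ominus> e i \<in> J"
    and e_right: "\<lbrakk>i \<in> I; r \<in> carrier R; e i \<otimes> r \<notin> J\<rbrakk> \<Longrightarrow> \<exists>s\<in>carrier R. (e i \<otimes> r) \<otimes> s \<ominus> e i \<in> J"

lemma (in primitive_decomposition) opposite: "primitive_decomposition (opposite_ring R) J I e"
proof -
  interpret op: ring "opposite_ring R" by (rule ring_opposite)
  note D = left_idealD[OF J_left_ideal]
  have "left_ideal J (opposite_ring R)"
    by (rule op.left_idealI) (use D J_right in auto)
  then show ?thesis
  \<comment> \<open>The two absorption properties of \<open>J\<close> trade places, and so do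
    \<open>e_left\<close> and \<open>e_right\<close> in goals 9 and 10.\<close>
  proof (unfold_locales, goal_cases)
    case (2 x r)
    then show ?case using D(5) by simp
  next
    case (3 j)
    then show ?case using J_inverse[of j] by auto
  next
    case (9 i r)
    then show ?case using e_right[of i r] by simp
  next
    case (10 i r)
    then show ?case using e_left[of i r] by simp
  qed (use finite_I e_closed e_sum e_idem e_orth in auto)
qed

context ring
begin

text \<open>Among the finite intersections of maximal left ideals there is a minimal one, and
  intersecting it with a further maximal left ideal cannot shrink it.\<close>

lemma radical_finite_intersection:
  assumes art: "left_artinian R"
  obtains F where "finite F" "\<And>M. M \<in> F \<Longrightarrow> maximal_left_ideal M R"
    "jacobson_radical R = carrier R \<inter> \<Inter>F"
proof -
  let ?S = "{carrier R \<inter> \<Inter>F | F. finite F \<and> (\<forall>M\<in>F. maximal_left_ideal M R)}"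
  have "carrier R \<inter> \<Inter>{} \<in> ?S" by blast
  then have ne: "?S \<noteq> {}" by blast
  have S: "left_ideal X R" if "X \<in> ?S" for X
    using that left_ideal_Inter maximal_left_idealD(1) by force
  show ?thesis
  proof (rule left_artinian_minimal[OF art ne S])
    fix X assume X: "X \<in> ?S" "\<And>Y. Y \<in> ?S \<Longrightarrow> Y \<subseteq> X \<Longrightarrow> Y = X"
    obtain F where F: "X = carrier R \<inter> \<Inter>F" "finite F" "\<forall>M\<in>F. maximal_left_ideal M R"
      using X(1) by blast
    have "X \<subseteq> M" if M: "maximal_left_ideal M R" for M
    proof -
      have "carrier R \<inter> \<Inter>(insert M F) \<in> ?S" using F M by blast
      then have "carrier R \<inter> \<Inter>(insert M F) = X" by (rule X(2)) (use F in blast)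
      then show ?thesis by blast
    qed
    then have "jacobson_radical R = carrier R \<inter> \<Inter>F"
      using F by (auto simp: jacobson_radical_def)
    then show ?thesis using that F by blast
  qed
qed

text \<open>For \<open>F\<close> of least size, \<open>R / J\<close> is the direct sum of the simple
  modules \<open>R / M\<close>, by a Chinese remainder argument. The element \<open>e M\<close>
  represents \<open>\<one>\<close> in the component \<open>M\<close> and zero in the others, so
  right multiplication by it projects onto that component.\<close>

lemma artinian_left_decomposition:
  fixes J defines "J \<equiv> jacobson_radical R"
  assumes art: "left_artinian R"
  obtains F :: "'a set set" and e where
    "finite F" "\<And>M. M \<in> F \<Longrightarrow> e M \<in> carrier R" "\<one> \<ominus> finsum R e F \<in> J"
    "\<And>M. M \<in> F \<Longrightarrow> e M \<otimes> e M \<ominus> e M \<in> J"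
    "\<And>M N. M \<in> F \<Longrightarrow> N \<in> F \<Longrightarrow> M \<noteq> N \<Longrightarrow> e M \<otimes> e N \<in> J"
    "\<And>M r. M \<in> F \<Longrightarrow> r \<in> carrier R \<Longrightarrow> r \<otimes> e M \<notin> J \<Longrightarrow> \<exists>s\<in>carrier R. s \<otimes> (r \<otimes> e M) \<ominus> e M \<in> J"
proof -
  let ?P = "\<lambda>F. finite F \<and> (\<forall>M\<in>F. maximal_left_ideal M R) \<and> J = carrier R \<inter> \<Inter>F"
  have "\<exists>F. ?P F" using radical_finite_intersection[OF art] unfolding J_def by metis
  then obtain F where F: "?P F" and min: "\<And>G. ?P G \<Longrightarrow> card F \<le> card G"
    using ex_has_least_nat[of ?P _ card] by metis
  have J: "left_ideal J R" unfolding J_def by (rule left_ideal_radical)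
  have id: "left_ideal M R" if "M \<in> F" for M using F that maximal_left_idealD(1) by blast
  have JI: "x \<in> J" if "x \<in> carrier R" "\<And>M. M \<in> F \<Longrightarrow> x \<in> M" for x using F that by blast
  define L where "L M = carrier R \<inter> \<Inter>(F - {M})" for M
  have L: "left_ideal (L M) R" for M unfolding L_def by (rule left_ideal_Inter) (use id in blast)
  have LN: "x \<in> N" if "x \<in> L M" "N \<in> F" "N \<noteq> M" for x M N using that by (auto simp: L_def)
  have "\<exists>x. x \<in> L M \<and> \<one> \<ominus> x \<in> M" if M: "M \<in> F" for M
  proof -
    \<comment> \<open>Otherwise \<open>M\<close> could be dropped from \<open>F\<close>.\<close>
    have "\<not> L M \<subseteq> M"
    proof
      assume "L M \<subseteq> M"
      then have "?P (F - {M})" using F by (auto simp: L_def)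
      then have "card F \<le> card (F - {M})" by (rule min)
      then show False using F M by (metis card_Diff1_less leD)
    qed
    then obtain y where y: "y \<in> L M" "y \<notin> M" by blast
    have "maximal_left_ideal M R" using F M by blast
    then obtain b where "b \<in> carrier R" "\<one> \<ominus> b \<otimes> y \<in> M"
      using maximal_left_ideal_split y left_idealD(2)[OF L] by metis
    then show ?thesis using left_idealD(5)[OF L] y(1) by blast
  qed
  then obtain e where e: "\<And>M. M \<in> F \<Longrightarrow> e M \<in> L M" "\<And>M. M \<in> F \<Longrightarrow> \<one> \<ominus> e M \<in> M" by metis
  have ec: "e M \<in> carrier R" if "M \<in> F" for M using e(1)[OF that] left_idealD(2)[OF L] by blast
  have eM: "x \<ominus> x \<otimes> e M \<in> M" if "M \<in> F" "x \<in> carrier R" for x M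
  proof -
    have "x \<otimes> (\<one> \<ominus> e M) \<in> M" using left_idealD(5)[OF id[OF that(1)] that(2) e(2)[OF that(1)]] .
    then show ?thesis using that ec by (simp add: a_minus_def r_distr r_minus)
  qed
  have inJ: "x \<in> J" if "x \<in> L M" "x \<in> M" "M \<in> F" for x M
    by (rule JI) (use that LN left_idealD(2)[OF L] in metis)+
  have neg: "y \<ominus> x \<in> N" if "x \<ominus> y \<in> N" "left_ideal N R" "x \<in> carrier R" "y \<in> carrier R" for x y N
  proof -
    have "\<ominus> (x \<ominus> y) = y \<ominus> x" using that(3,4) by algebra
    then show ?thesis using left_ideal_a_inv[OF that(2,1)] by simp
  qed
  show ?thesis
  proof (rule that)
    show "finite F" using F by blast
    show "e M \<in> carrier R" if "M \<in> F" for M using ec that .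
    show "\<one> \<ominus> finsum R e F \<in> J"
    proof (rule JI)
      have eF: "e \<in> F \<rightarrow> carrier R" using ec by blast
      then show "\<one> \<ominus> finsum R e F \<in> carrier R" by simp
      fix M assume M: "M \<in> F"
      have eF': "e \<in> F - {M} \<rightarrow> carrier R" using ec by blast
      have "finsum R e F = e M \<oplus> finsum R e (F - {M})"
      proof -
        have "finsum R e (insert M (F - {M})) = e M \<oplus> finsum R e (F - {M})"
          by (rule finsum_insert) (use F eF' ec[OF M] in auto)
        then show ?thesis using M by (simp add: insert_absorb)
      qed
      then have "\<one> \<ominus> finsum R e F = (\<one> \<ominus> e M) \<ominus> finsum R e (F - {M})"
        using eF' ec[OF M] by (simp add: a_minus_def minus_add a_assoc)
      moreover have "finsum R e (F - {M}) \<in> M"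
        by (rule left_ideal_finsum[OF id[OF M]]) (use F e(1) LN M in auto)
      ultimately show "\<one> \<ominus> finsum R e F \<in> M" using left_ideal_minus[OF id[OF M] e(2)[OF M]] by simp
    qed
    show "e M \<otimes> e M \<ominus> e M \<in> J" if M: "M \<in> F" for M
      by (rule inJ[OF _ neg[OF eM[OF M ec[OF M]] id[OF M]] M])
        (use left_ideal_minus[OF L left_idealD(5)[OF L ec[OF M] e(1)[OF M]] e(1)[OF M]] ec[OF M] in auto)
    show "e M \<otimes> e N \<in> J" if MN: "M \<in> F" "N \<in> F" "M \<noteq> N" for M N
    proof (rule inJ[OF _ _ MN(2)])
      show "e M \<otimes> e N \<in> L N" using left_idealD(5)[OF L ec[OF MN(1)] e(1)[OF MN(2)]] .
      show "e M \<otimes> e N \<in> N"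
        by (rule left_ideal_diff_cancel'[OF id[OF MN(2)] eM[OF MN(2) ec[OF MN(1)]]])
          (use LN[OF e(1)[OF MN(1)] MN(2)] MN ec in auto)
    qed
    show "\<exists>s\<in>carrier R. s \<otimes> (r \<otimes> e M) \<ominus> e M \<in> J"
      if M: "M \<in> F" and r: "r \<in> carrier R" "r \<otimes> e M \<notin> J" for M r
    proof -
      have rL: "r \<otimes> e M \<in> L M" using left_idealD(5)[OF L r(1) e(1)[OF M]] .
      have "maximal_left_ideal M R" using F M by blast
      moreover have "r \<otimes> e M \<notin> M" using inJ[OF rL] r(2) M by blast
      ultimately obtain s where s: "s \<in> carrier R" "\<one> \<ominus> s \<otimes> (r \<otimes> e M) \<in> M"
        using maximal_left_ideal_split[of M "r \<otimes> e M"] r(1) ec[OF M] by blast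
      \<comment> \<open>Multiplying by \<open>e M\<close> keeps the congruence modulo
        \<open>M\<close> and brings the coefficient into the form needed; in the other components
        both terms vanish because they are left multiples of \<open>e M\<close>.\<close>
      have "e M \<otimes> (\<one> \<ominus> s \<otimes> (r \<otimes> e M)) \<in> M" using left_idealD(5)[OF id[OF M] ec[OF M] s(2)] .
      moreover have "e M \<otimes> (\<one> \<ominus> s \<otimes> (r \<otimes> e M)) = e M \<ominus> (e M \<otimes> s) \<otimes> (r \<otimes> e M)"
        using s(1) r(1) ec[OF M] by (simp add: a_minus_def r_distr r_minus m_assoc)
      ultimately have "(e M \<otimes> s) \<otimes> (r \<otimes> e M) \<ominus> e M \<in> M"
        using neg[OF _ id[OF M]] s(1) r(1) ec[OF M] by simp
      moreover have "(e M \<otimes> s) \<otimes> (r \<otimes> e M) \<ominus> e M \<in> L M"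
        by (rule left_ideal_minus[OF L left_idealD(5)[OF L _ rL] e(1)[OF M]]) (use s(1) ec[OF M] in simp)
      ultimately have "(e M \<otimes> s) \<otimes> (r \<otimes> e M) \<ominus> e M \<in> J" using inJ M by blast
      then show ?thesis using s(1) ec[OF M] by (meson m_closed)
    qed
  qed
qed

text \<open>In \<open>R / J\<close> the corner \<open>eRe\<close> at a primitive idempotent is a division ring, because nonzero
  elements of it have left inverses and hence also right inverses.\<close>

lemma radical_decomposition_right:
  fixes J defines "J \<equiv> jacobson_radical R"
  assumes c: "c \<in> carrier R" and idem: "c \<otimes> c \<ominus> c \<in> J"
    and left: "\<And>r. r \<in> carrier R \<Longrightarrow> r \<otimes> c \<notin> J \<Longrightarrow> \<exists>s\<in>carrier R. s \<otimes> (r \<otimes> c) \<ominus> c \<in> J"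
    and x: "x \<in> carrier R" "c \<otimes> x \<notin> J"
  shows "\<exists>s\<in>carrier R. (c \<otimes> x) \<otimes> s \<ominus> c \<in> J"
proof -
  have J: "left_ideal J R" unfolding J_def by (rule left_ideal_radical)
  note JD = left_idealD[OF J]
  have Jr: "j \<otimes> r \<in> J" if "j \<in> J" "r \<in> carrier R" for j r
    using radical_mult_right that unfolding J_def by blast
  define eq where "eq a b \<longleftrightarrow> a \<in> carrier R \<and> b \<in> carrier R \<and> a \<ominus> b \<in> J" for a b
  have eq_trans: "eq a d" if "eq a b" "eq b d" for a b d
  proof -
    have "(a \<ominus> b) \<oplus> (b \<ominus> d) = a \<ominus> d" using that unfolding eq_def by algebra
    then show ?thesis using that JD(4)[of "a \<ominus> b" "b \<ominus> d"] unfolding eq_def by auto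
  qed
  have eq_sym: "eq b a" if "eq a b" for a b
  proof -
    have "\<ominus> (a \<ominus> b) = b \<ominus> a" using that unfolding eq_def by algebra
    then show ?thesis using that left_ideal_a_inv[OF J, of "a \<ominus> b"] unfolding eq_def by auto
  qed
  have eq_l: "eq (r \<otimes> a) (r \<otimes> b)" if "eq a b" "r \<in> carrier R" for a b r
  proof -
    have "r \<otimes> (a \<ominus> b) = r \<otimes> a \<ominus> r \<otimes> b" using that unfolding eq_def by algebra
    then show ?thesis using that JD(5)[of r "a \<ominus> b"] unfolding eq_def by auto
  qed
  have eq_r: "eq (a \<otimes> r) (b \<otimes> r)" if "eq a b" "r \<in> carrier R" for a b r
  proof -
    have "(a \<ominus> b) \<otimes> r = a \<otimes> r \<ominus> b \<otimes> r" using that unfolding eq_def by algebra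
    then show ?thesis using that Jr[of "a \<ominus> b" r] unfolding eq_def by auto
  qed
  have eq_J: "a \<in> J" if "eq a b" "b \<in> J" for a b
    using that left_ideal_diff_cancel[OF J] unfolding eq_def by blast
  have cc: "eq (c \<otimes> c) c" using idem c by (simp add: eq_def)
  \<comment> \<open>Semiprimeness modulo \<open>J\<close> provides \<open>r\<close> such that
    \<open>u = c x r c\<close>, an element of the corner, stays nonzero modulo
    \<open>J\<close>.\<close>
  obtain r where r: "r \<in> carrier R" "(c \<otimes> x) \<otimes> r \<otimes> (c \<otimes> x) \<notin> J"
    using radical_semiprime[of "c \<otimes> x"] x c unfolding J_def by auto
  define u where "u = c \<otimes> x \<otimes> r \<otimes> c"
  have u: "u \<in> carrier R" using c x r by (simp add: u_def)
  have "(c \<otimes> x) \<otimes> r \<otimes> (c \<otimes> x) = u \<otimes> x" using c x r by (simp add: u_def m_assoc)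
  then have uJ: "u \<notin> J" using r(2) Jr x(1) by metis
  then obtain s where s: "s \<in> carrier R" "eq (s \<otimes> u) c"
    using left[of "c \<otimes> x \<otimes> r"] c x r u unfolding u_def eq_def by auto
  have cu: "eq (c \<otimes> u) u"
    using eq_r[OF cc, of "x \<otimes> r \<otimes> c"] c x r by (simp add: u_def m_assoc)
  have uc: "eq (u \<otimes> c) u"
    using eq_l[OF cc, of "c \<otimes> x \<otimes> r"] c x r by (simp add: u_def m_assoc)
  define v where "v = c \<otimes> s \<otimes> c"
  have v: "v \<in> carrier R" using c s by (simp add: v_def)
  have vu: "eq (v \<otimes> u) c"
  proof -
    have "eq (v \<otimes> u) (c \<otimes> (s \<otimes> u))"
      using eq_l[OF cu, of "c \<otimes> s"] c s(1) u by (simp add: v_def m_assoc)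
    moreover have "eq (c \<otimes> (s \<otimes> u)) (c \<otimes> c)" using eq_l[OF s(2)] c by blast
    ultimately show ?thesis using eq_trans cc by blast
  qed
  have "v \<notin> J"
  proof
    assume "v \<in> J"
    then have "v \<otimes> u \<in> J" using Jr u by blast
    then have "c \<in> J" using eq_J[OF eq_sym[OF vu]] by blast
    then show False using JD(5)[of "c \<otimes> x \<otimes> r" c] uJ c x r by (simp add: u_def)
  qed
  \<comment> \<open>Modulo \<open>J\<close>, \<open>v\<close> has the right inverse \<open>u\<close>
    and the left inverse \<open>t\<close> in the corner. The usual cancellation gives
    \<open>u\<close> congruent to \<open>t c\<close>, hence \<open>u v\<close> congruent to
    \<open>c\<close>.\<close>
  then obtain t where t: "t \<in> carrier R" "eq (t \<otimes> v) c"
    using left[of "c \<otimes> s"] c s v unfolding v_def eq_def by auto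
  have vc: "eq (v \<otimes> c) v" using eq_l[OF cc, of "c \<otimes> s"] c s by (simp add: v_def m_assoc)
  have "eq (u \<otimes> v) c"
  proof -
    have "eq (c \<otimes> u) (t \<otimes> (v \<otimes> u))"
      using eq_sym[OF eq_r[OF t(2) u]] t(1) v u by (simp add: m_assoc)
    then have "eq u (t \<otimes> c)"
      using eq_trans[OF eq_sym[OF cu]] eq_trans eq_l[OF vu t(1)] by blast
    then have "eq (u \<otimes> v) (t \<otimes> (c \<otimes> v))" using eq_r[of u "t \<otimes> c" v] t(1) c v by (simp add: m_assoc)
    moreover have "eq (t \<otimes> (c \<otimes> v)) (t \<otimes> v)"
    proof -
      have "eq (c \<otimes> v) v" using eq_r[OF cc, of "s \<otimes> c"] c s by (simp add: v_def m_assoc)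
      then show ?thesis using eq_l t(1) by blast
    qed
    ultimately show ?thesis using eq_trans t(2) by blast
  qed
  moreover have "u \<otimes> v = (c \<otimes> x) \<otimes> (r \<otimes> c \<otimes> v)" using c x r v by (simp add: u_def m_assoc)
  ultimately show ?thesis using c r v unfolding eq_def by (intro bexI[of _ "r \<otimes> c \<otimes> v"]) auto
qed

lemma artinian_primitive_decomposition:
  assumes art: "left_artinian R"
  shows "\<exists>(F :: 'a set set) e. primitive_decomposition R (jacobson_radical R) F e"
proof -
  let ?J = "jacobson_radical R"
  show ?thesis
  proof (rule artinian_left_decomposition[OF art])
    fix F :: "'a set set" and e
    assume e: "finite F" "\<And>M. M \<in> F \<Longrightarrow> e M \<in> carrier R" "\<one> \<ominus> finsum R e F \<in> ?J"
      "\<And>M. M \<in> F \<Longrightarrow> e M \<otimes> e M \<ominus> e M \<in> ?J"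
      "\<And>M N. M \<in> F \<Longrightarrow> N \<in> F \<Longrightarrow> M \<noteq> N \<Longrightarrow> e M \<otimes> e N \<in> ?J"
      "\<And>M r. M \<in> F \<Longrightarrow> r \<in> carrier R \<Longrightarrow> r \<otimes> e M \<notin> ?J \<Longrightarrow> \<exists>s\<in>carrier R. s \<otimes> (r \<otimes> e M) \<ominus> e M \<in> ?J"
    have "primitive_decomposition R ?J F e"
    proof
      show "\<exists>u\<in>carrier R. u \<otimes> (\<one> \<ominus> j) = \<one> \<and> (\<one> \<ominus> j) \<otimes> u = \<one>" if "j \<in> ?J" for j
        using radical_inverse[OF that] by metis
      show "\<exists>s\<in>carrier R. (e M \<otimes> r) \<otimes> s \<ominus> e M \<in> ?J"
        if "M \<in> F" "r \<in> carrier R" "e M \<otimes> r \<notin> ?J" for M r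
        using radical_decomposition_right[of "e M" r] e that by blast
    qed (use e left_ideal_radical radical_mult_right in auto)
    then show ?thesis by blast
  qed
qed

end

section \<open>The socle\<close>

lemma simple_submodule_regular:
  "simple_submodule S R (regular_module R) \<longleftrightarrow>
    left_ideal S R \<and> S \<noteq> {\<zero>\<^bsub>R\<^esub>} \<and> (\<forall>N. left_ideal N R \<and> N \<subseteq> S \<longrightarrow> N = {\<zero>\<^bsub>R\<^esub>} \<or> N = S)"
  by (simp add: simple_submodule_def left_ideal_def regular_module_def)

context ring
begin

lemma socle_simple: "simple_submodule S R (regular_module R) \<Longrightarrow> S \<subseteq> socle R (regular_module R)"
  unfolding socle_def by (auto intro: generate.incl)

lemma socle_zero: "\<zero> \<in> socle R (regular_module R)"
  using generate.one[of "add_monoid (regular_module R)"] by (simp add: socle_def regular_module_def)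

lemma socle_add:
  "x \<in> socle R (regular_module R) \<Longrightarrow> y \<in> socle R (regular_module R) \<Longrightarrow>
    x \<oplus> y \<in> socle R (regular_module R)"
  using generate.eng[of x "add_monoid (regular_module R)" _ y]
  by (simp add: socle_def regular_module_def)

lemma socle_least:
  assumes L: "left_ideal L R" and S: "\<And>S. simple_submodule S R (regular_module R) \<Longrightarrow> S \<subseteq> L"
  shows "socle R (regular_module R) \<subseteq> L"
proof
  fix x assume "x \<in> socle R (regular_module R)"
  then show "x \<in> L"
    unfolding socle_def
  proof (induction rule: generate.induct)
    case one
    then show ?case using left_idealD(3)[OF L] by (simp add: regular_module_def)
  next
    case (incl h)
    then show ?case using S by blast
  next
    case (inv h)
    have "inv\<^bsub>add_monoid (regular_module R)\<^esub> h = \<ominus> h"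
      by (simp add: a_inv_def m_inv_def regular_module_def)
    then show ?case using inv S left_ideal_a_inv[OF L] by auto
  next
    case (eng h1 h2)
    then show ?case using left_idealD(4)[OF L] by (simp add: regular_module_def)
  qed
qed

lemma socle_carrier: "socle R (regular_module R) \<subseteq> carrier R"
  by (rule socle_least[OF left_ideal_carrier]) (use left_idealD(1) simple_submodule_regular in blast)

lemma simple_principal:
  assumes S: "simple_submodule S R (regular_module R)" and x: "x \<in> S" "x \<noteq> \<zero>"
  shows "S = {r \<otimes> x | r. r \<in> carrier R}"
proof -
  have L: "left_ideal S R" and min: "\<And>N. left_ideal N R \<Longrightarrow> N \<subseteq> S \<Longrightarrow> N = {\<zero>} \<or> N = S"
    using S by (auto simp: simple_submodule_regular)
  have xc: "x \<in> carrier R" using left_idealD(2)[OF L x(1)] .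
  have "\<one> \<otimes> x \<in> {r \<otimes> x | r. r \<in> carrier R}" by blast
  then have "x \<in> {r \<otimes> x | r. r \<in> carrier R}" using xc by simp
  then have "{r \<otimes> x | r. r \<in> carrier R} \<noteq> {\<zero>}" using x(2) by blast
  moreover have "{r \<otimes> x | r. r \<in> carrier R} \<subseteq> S" using left_idealD(5)[OF L] x(1) by blast
  ultimately show ?thesis using min[OF left_ideal_principal[OF xc]] by metis
qed

lemma simple_principalI:
  assumes x: "x \<in> carrier R" "x \<noteq> \<zero>"
    and ret: "\<And>r. r \<in> carrier R \<Longrightarrow> r \<otimes> x \<noteq> \<zero> \<Longrightarrow> \<exists>s\<in>carrier R. s \<otimes> (r \<otimes> x) = x"
  shows "simple_submodule {r \<otimes> x | r. r \<in> carrier R} R (regular_module R)" (is "simple_submodule ?S _ _")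
  unfolding simple_submodule_regular
proof (intro conjI allI impI)
  show "left_ideal ?S R" using left_ideal_principal[OF x(1)] .
  have "\<one> \<otimes> x \<in> ?S" by blast
  then show "?S \<noteq> {\<zero>}" using x by (metis l_one singletonD)
  fix N assume N: "left_ideal N R \<and> N \<subseteq> ?S"
  show "N = {\<zero>} \<or> N = ?S"
  proof (cases "N = {\<zero>}")
    case False
    then obtain y where y: "y \<in> N" "y \<noteq> \<zero>" using N left_idealD(3) by blast
    then obtain r where r: "r \<in> carrier R" "y = r \<otimes> x" using N by blast
    then obtain s where "s \<in> carrier R" "s \<otimes> y = x" using ret y by blast
    then have "x \<in> N" using left_idealD(5)[of N s y] N y by simp
    then have "?S \<subseteq> N" using left_idealD(5)[of N _ x] N by blast
    then show ?thesis using N by blast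
  qed simp
qed

lemma simple_of_maximal_annihilator:
  assumes x: "x \<in> carrier R" and m: "maximal_left_ideal {a \<in> carrier R. a \<otimes> x = \<zero>} R"
  shows "simple_submodule {r \<otimes> x | r. r \<in> carrier R} R (regular_module R)"
proof (rule simple_principalI[OF x])
  show "x \<noteq> \<zero>" using maximal_left_idealD(3)[OF m] x by auto
  fix r assume r: "r \<in> carrier R" "r \<otimes> x \<noteq> \<zero>"
  then obtain b where b: "b \<in> carrier R" "\<one> \<ominus> b \<otimes> r \<in> {a \<in> carrier R. a \<otimes> x = \<zero>}"
    using maximal_left_ideal_split[OF m] by blast
  have "(\<one> \<ominus> b \<otimes> r) \<otimes> x = x \<ominus> b \<otimes> (r \<otimes> x)"
    using b(1) r(1) x by (simp add: a_minus_def l_distr l_minus m_assoc)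
  then have "x = b \<otimes> (r \<otimes> x)" using b r(1) x minus_eq_zero_iff[of x "b \<otimes> (r \<otimes> x)"] by simp
  then show "\<exists>s\<in>carrier R. s \<otimes> (r \<otimes> x) = x" using b(1) by metis
qed

lemma artinian_simple_sub:
  assumes art: "left_artinian R" and L: "left_ideal L R" "L \<noteq> {\<zero>}"
  obtains S where "simple_submodule S R (regular_module R)" "S \<subseteq> L"
proof -
  let ?F = "{N. left_ideal N R \<and> N \<noteq> {\<zero>} \<and> N \<subseteq> L}"
  obtain S where "S \<in> ?F" "\<And>N. N \<in> ?F \<Longrightarrow> N \<subseteq> S \<Longrightarrow> N = S"
    using left_artinian_minimal[OF art, of ?F] L by blast
  then show ?thesis using that[of S] unfolding simple_submodule_regular by blast
qed

end

text \<open>If \<open>j x\<close> were nonzero in a simple left ideal, it would generate it, so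
  \<open>x = r j x\<close>; as \<open>1 - r j\<close> is invertible, \<open>x\<close> would vanish.
  Conversely, an \<open>x\<close> killed by \<open>J\<close> is the sum of the \<open>e i x\<close>,
  and each of these is zero or generates a simple left ideal by \<open>e_left\<close>.\<close>

lemma (in primitive_decomposition) socle_eq:
  "socle R (regular_module R) = {x \<in> carrier R. \<forall>j\<in>J. j \<otimes> x = \<zero>}" (is "_ = ?A")
proof
  note JD = left_idealD[OF J_left_ideal]
  show "socle R (regular_module R) \<subseteq> ?A"
  proof (rule socle_least)
    show "left_ideal ?A R"
    proof (rule left_idealI)
      fix a x assume a: "a \<in> carrier R" and x: "x \<in> ?A"
      have "j \<otimes> (a \<otimes> x) = \<zero>" if j: "j \<in> J" for j
      proof -
        have "j \<otimes> (a \<otimes> x) = (j \<otimes> a) \<otimes> x" using JD(2)[OF j] a x by (simp add: m_assoc)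
        then show ?thesis using x J_right[OF j a] by simp
      qed
      then show "a \<otimes> x \<in> ?A" using a x by simp
    qed (use JD(2) in \<open>auto simp: r_distr\<close>)
    fix S assume S: "simple_submodule S R (regular_module R)"
    have L: "left_ideal S R" using S by (simp add: simple_submodule_regular)
    show "S \<subseteq> ?A"
    proof (intro subsetI CollectI conjI ballI)
      fix x assume x: "x \<in> S"
      then show xc: "x \<in> carrier R" using left_idealD(2)[OF L] by blast
      fix j assume j: "j \<in> J"
      show "j \<otimes> x = \<zero>"
      proof (rule ccontr)
        assume nz: "j \<otimes> x \<noteq> \<zero>"
        have "S = {r \<otimes> (j \<otimes> x) | r. r \<in> carrier R}"
          by (rule simple_principal[OF S _ nz]) (use left_idealD(5)[OF L JD(2)[OF j] x] in simp)
        then obtain r where r: "r \<in> carrier R" "x = r \<otimes> (j \<otimes> x)" using x by blast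
        have rj: "r \<otimes> j \<in> J" "r \<otimes> j \<in> carrier R" using JD(2,5) r(1) j by blast+
        obtain u where u: "u \<in> carrier R" "u \<otimes> (\<one> \<ominus> r \<otimes> j) = \<one>" using J_inverse[OF rj(1)] by blast
        have "(\<one> \<ominus> r \<otimes> j) \<otimes> x = x \<ominus> r \<otimes> (j \<otimes> x)"
          using r(1) JD(2)[OF j] xc by (simp add: a_minus_def l_distr l_minus m_assoc)
        also have "\<dots> = \<zero>" using r(2) xc minus_eq_zero_iff by simp
        finally have "u \<otimes> ((\<one> \<ominus> r \<otimes> j) \<otimes> x) = \<zero>" using u(1) by simp
        then have "(u \<otimes> (\<one> \<ominus> r \<otimes> j)) \<otimes> x = \<zero>" using u(1) rj xc by (simp add: m_assoc)
        then have "x = \<zero>" using u xc by simp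
        then show False using nz JD(2)[OF j] by simp
      qed
    qed
  qed
  show "?A \<subseteq> socle R (regular_module R)"
  proof
    fix x assume x: "x \<in> ?A"
    have xc: "x \<in> carrier R" using x by simp
    have eF: "e \<in> I \<rightarrow> carrier R" using e_closed by blast
    have kill: "a \<otimes> x = b \<otimes> x" if "a \<in> carrier R" "b \<in> carrier R" "a \<ominus> b \<in> J" for a b
    proof -
      have "(a \<ominus> b) \<otimes> x = a \<otimes> x \<ominus> b \<otimes> x"
        using that xc by (simp add: a_minus_def l_distr l_minus)
      then show ?thesis using that x minus_eq_zero_iff[of "a \<otimes> x" "b \<otimes> x"] by simp
    qed
    have piece: "e i \<otimes> x \<in> socle R (regular_module R)" if i: "i \<in> I" for i
    proof (cases "e i \<otimes> x = \<zero>")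
      case True
      then show ?thesis using socle_zero by simp
    next
      case False
      have ex: "e i \<otimes> x \<in> carrier R" using e_closed[OF i] xc by simp
      have "simple_submodule {r \<otimes> (e i \<otimes> x) | r. r \<in> carrier R} R (regular_module R)"
      proof (rule simple_principalI[OF ex False])
        fix r assume r: "r \<in> carrier R" "r \<otimes> (e i \<otimes> x) \<noteq> \<zero>"
        have "r \<otimes> (e i \<otimes> x) = (r \<otimes> e i) \<otimes> x" using r e_closed[OF i] xc by (simp add: m_assoc)
        then have "r \<otimes> e i \<notin> J" using r(2) x by auto
        then obtain s where s: "s \<in> carrier R" "s \<otimes> (r \<otimes> e i) \<ominus> e i \<in> J"
          using e_left[OF i r(1)] by blast
        have "(s \<otimes> (r \<otimes> e i)) \<otimes> x = e i \<otimes> x"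
          by (rule kill) (use s r(1) e_closed[OF i] in auto)
        then have "s \<otimes> (r \<otimes> (e i \<otimes> x)) = e i \<otimes> x"
          using s(1) r(1) e_closed[OF i] xc by (simp add: m_assoc)
        then show "\<exists>s\<in>carrier R. s \<otimes> (r \<otimes> (e i \<otimes> x)) = e i \<otimes> x" using s(1) by blast
      qed
      moreover have "\<one> \<otimes> (e i \<otimes> x) \<in> {r \<otimes> (e i \<otimes> x) | r. r \<in> carrier R}" by blast
      then have "e i \<otimes> x \<in> {r \<otimes> (e i \<otimes> x) | r. r \<in> carrier R}" using ex by simp
      ultimately show ?thesis using socle_simple by blast
    qed
    have "(\<Oplus>i\<in>I'. e i \<otimes> x) \<in> socle R (regular_module R)" if "I' \<subseteq> I" for I'
      using finite_subset[OF that finite_I] that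
    proof (induction)
      case empty
      then show ?case using socle_zero by simp
    next
      case (insert i I')
      then have "(\<Oplus>i\<in>insert i I'. e i \<otimes> x) = e i \<otimes> x \<oplus> (\<Oplus>i\<in>I'. e i \<otimes> x)"
        using e_closed xc by (intro finsum_insert) auto
      then show ?case using insert socle_add piece by simp
    qed
    then have "(\<Oplus>i\<in>I. e i \<otimes> x) \<in> socle R (regular_module R)" by blast
    moreover have "(\<Oplus>i\<in>I. e i \<otimes> x) = finsum R e I \<otimes> x"
      using finsum_ldistr[OF finite_I xc eF] by simp
    moreover have "\<one> \<otimes> x = finsum R e I \<otimes> x" by (rule kill) (use e_sum eF in auto)
    ultimately show "x \<in> socle R (regular_module R)" using xc by simp
  qed
qed

section \<open>Frobenius rings by annihilators\<close>

text \<open>\<open>z\<close> is the image of the class of \<open>\<one>\<close> under an isomorphism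
  from \<open>A / J\<close> to the socle: one equation expresses injectivity, the other
  surjectivity.\<close>

definition socle_generator :: "('a, 'm) ring_scheme \<Rightarrow> 'a set \<Rightarrow> 'a \<Rightarrow> bool" where
  "socle_generator A J z \<longleftrightarrow> z \<in> carrier A \<and> J = {a \<in> carrier A. a \<otimes>\<^bsub>A\<^esub> z = \<zero>\<^bsub>A\<^esub>} \<and>
    socle A (regular_module A) = {a \<otimes>\<^bsub>A\<^esub> z | a. a \<in> carrier A}"

context ring
begin

text \<open>By definition the socle is merely an additive subgroup. The elements all of whose left
  multiples lie in it form a left ideal that contains every simple left ideal, hence the whole
  socle.\<close>

lemma left_ideal_socle: "left_ideal (socle R (regular_module R)) R"
proof (rule left_idealI)
  let ?S = "socle R (regular_module R)"
  let ?L = "{x \<in> carrier R. \<forall>a\<in>carrier R. a \<otimes> x \<in> ?S}"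
  have "?S \<subseteq> ?L"
  proof (rule socle_least)
    show "left_ideal ?L R"
      by (rule left_idealI) (auto simp: socle_zero socle_add r_distr m_assoc[symmetric])
    show "S \<subseteq> ?L" if S: "simple_submodule S R (regular_module R)" for S
    proof -
      have L: "left_ideal S R" using S by (simp add: simple_submodule_regular)
      show ?thesis using left_idealD(2,5)[OF L] socle_simple[OF S] by blast
    qed
  qed
  then show "a \<otimes> x \<in> ?S" if "a \<in> carrier R" "x \<in> ?S" for a x using that by blast
qed (use socle_carrier socle_zero socle_add in auto)

lemma regular_coset:
  assumes J: "left_ideal J R" and x: "x \<in> carrier R"
  shows "J +>\<^bsub>regular_module R\<^esub> x = {y \<in> carrier R. y \<ominus> x \<in> J}"
proof -
  have "J +>\<^bsub>regular_module R\<^esub> x = {h \<oplus> x | h. h \<in> J}"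
    by (auto simp: a_r_coset_def' regular_module_def)
  also have "\<dots> = {y \<in> carrier R. y \<ominus> x \<in> J}"
  proof (intro equalityI subsetI)
    fix y assume "y \<in> {h \<oplus> x | h. h \<in> J}"
    then obtain h where h: "h \<in> J" "y = h \<oplus> x" by blast
    have "h \<in> carrier R" using left_idealD(2)[OF J h(1)] .
    then show "y \<in> {y \<in> carrier R. y \<ominus> x \<in> J}" using h x by (simp add: a_minus_def a_assoc r_neg)
  next
    fix y assume y: "y \<in> {y \<in> carrier R. y \<ominus> x \<in> J}"
    then have "y = (y \<ominus> x) \<oplus> x" using x by (simp add: a_minus_def a_assoc l_neg)
    then show "y \<in> {h \<oplus> x | h. h \<in> J}" using y by blast
  qed
  finally show ?thesis .
qed

lemma regular_coset_eq_iff: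
  assumes J: "left_ideal J R" and "x \<in> carrier R" "y \<in> carrier R"
  shows "J +>\<^bsub>regular_module R\<^esub> x = J +>\<^bsub>regular_module R\<^esub> y \<longleftrightarrow> x \<ominus> y \<in> J"
proof
  assume "J +>\<^bsub>regular_module R\<^esub> x = J +>\<^bsub>regular_module R\<^esub> y"
  moreover have "x \<in> J +>\<^bsub>regular_module R\<^esub> x"
    using assms left_idealD(3)[OF J] by (simp add: regular_coset a_minus_def r_neg)
  ultimately show "x \<ominus> y \<in> J" using assms by (simp add: regular_coset)
next
  assume xy: "x \<ominus> y \<in> J"
  have "u \<ominus> x \<in> J \<longleftrightarrow> u \<ominus> y \<in> J" if u: "u \<in> carrier R" for u
  proof -
    have "u \<ominus> y = (u \<ominus> x) \<oplus> (x \<ominus> y)" "u \<ominus> x = (u \<ominus> y) \<ominus> (x \<ominus> y)"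
      using assms u by algebra+
    then show ?thesis using left_idealD(4)[OF J _ xy] left_ideal_minus[OF J _ xy] by metis
  qed
  then show "J +>\<^bsub>regular_module R\<^esub> x = J +>\<^bsub>regular_module R\<^esub> y"
    using assms by (auto simp: regular_coset)
qed

text \<open>The scalar action is a union over all representatives of a coset; since \<open>J\<close>
  is a left ideal, all of them contribute the same coset.\<close>

lemma factor_module_simps:
  assumes J: "left_ideal J R"
  defines "cs \<equiv> \<lambda>x. J +>\<^bsub>regular_module R\<^esub> x"
  shows "carrier (factor_module (regular_module R) J) = cs ` carrier R"
    "\<lbrakk>x \<in> carrier R; y \<in> carrier R\<rbrakk> \<Longrightarrow> cs x \<oplus>\<^bsub>factor_module (regular_module R) J\<^esub> cs y = cs (x \<oplus> y)"
    "\<lbrakk>a \<in> carrier R; x \<in> carrier R\<rbrakk> \<Longrightarrow> a \<odot>\<^bsub>factor_module (regular_module R) J\<^esub> cs x = cs (a \<otimes> x)"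
proof -
  note JD = left_idealD[OF J]
  show "carrier (factor_module (regular_module R) J) = cs ` carrier R"
    by (auto simp: factor_module_def A_RCOSETS_def' a_r_coset_def' regular_module_def cs_def)
  have cs: "cs x = {y \<in> carrier R. y \<ominus> x \<in> J}" if "x \<in> carrier R" for x
    using regular_coset[OF J that] by (simp add: cs_def)
  have self: "x \<in> cs x" if "x \<in> carrier R" for x
    using that JD(3) by (simp add: cs a_minus_def r_neg)
  show "cs x \<oplus>\<^bsub>factor_module (regular_module R) J\<^esub> cs y = cs (x \<oplus> y)"
    if xy: "x \<in> carrier R" "y \<in> carrier R"
  proof -
    have "cs x \<oplus>\<^bsub>factor_module (regular_module R) J\<^esub> cs y = {u \<oplus> v | u v. u \<in> cs x \<and> v \<in> cs y}"
      by (auto simp: factor_module_def set_add_def' regular_module_def)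
    also have "\<dots> = cs (x \<oplus> y)"
    proof (intro equalityI subsetI)
      fix w assume "w \<in> {u \<oplus> v | u v. u \<in> cs x \<and> v \<in> cs y}"
      then obtain u v where uv: "w = u \<oplus> v" "u \<in> cs x" "v \<in> cs y" by blast
      have c: "u \<in> carrier R" "v \<in> carrier R" "u \<ominus> x \<in> J" "v \<ominus> y \<in> J" using uv xy by (auto simp: cs)
      have "(u \<oplus> v) \<ominus> (x \<oplus> y) = (u \<ominus> x) \<oplus> (v \<ominus> y)" using c xy by algebra
      then show "w \<in> cs (x \<oplus> y)" using uv(1) c xy JD(4) by (simp add: cs)
    next
      fix w assume w: "w \<in> cs (x \<oplus> y)"
      then have c: "w \<in> carrier R" "w \<ominus> (x \<oplus> y) \<in> J" using xy by (auto simp: cs)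
      have "(w \<ominus> y) \<ominus> x = w \<ominus> (x \<oplus> y)" using c xy by algebra
      then have "w \<ominus> y \<in> cs x" using c xy by (simp add: cs)
      moreover have "w = (w \<ominus> y) \<oplus> y" using c xy by algebra
      ultimately show "w \<in> {u \<oplus> v | u v. u \<in> cs x \<and> v \<in> cs y}" using self[OF xy(2)] by blast
    qed
    finally show ?thesis .
  qed
  show "a \<odot>\<^bsub>factor_module (regular_module R) J\<^esub> cs x = cs (a \<otimes> x)"
    if ax: "a \<in> carrier R" "x \<in> carrier R"
  proof -
    have "a \<odot>\<^bsub>factor_module (regular_module R) J\<^esub> cs x = (\<Union>u\<in>cs x. cs (a \<otimes> u))"
      by (simp add: factor_module_def cs_def regular_module_def)
    moreover have "cs (a \<otimes> u) = cs (a \<otimes> x)" if u: "u \<in> cs x" for u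
    proof -
      have c: "u \<in> carrier R" "u \<ominus> x \<in> J" using u ax by (auto simp: cs)
      have "a \<otimes> u \<ominus> a \<otimes> x = a \<otimes> (u \<ominus> x)" using c ax by algebra
      then show ?thesis using regular_coset_eq_iff[OF J] c ax JD(5) unfolding cs_def by simp
    qed
    ultimately show ?thesis using self[OF ax(2)] by blast
  qed
qed

text \<open>\<open>R / J\<close> is generated by the class of \<open>\<one>\<close>, so an
  isomorphism is determined by the socle element \<open>z\<close> that corresponds to this class;
  conversely \<open>a z \<mapsto> a + J\<close> is well defined and bijective.\<close>

lemma socle_isomorphic_iff:
  assumes J: "left_ideal J R"
  shows "module_isomorphic R (socle_module R (regular_module R)) (factor_module (regular_module R) J) \<longleftrightarrow>
    (\<exists>z. socle_generator R J z)"
proof -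
  define cs where "cs x = J +>\<^bsub>regular_module R\<^esub> x" for x
  let ?S = "socle R (regular_module R)" and ?F = "factor_module (regular_module R) J"
  note F = factor_module_simps[OF J, folded cs_def]
  note S = left_idealD[OF left_ideal_socle]
  have cs_eq: "cs x = cs y \<longleftrightarrow> x \<ominus> y \<in> J" if "x \<in> carrier R" "y \<in> carrier R" for x y
    using regular_coset_eq_iff[OF J that] by (simp add: cs_def)
  have SM: "carrier (socle_module R (regular_module R)) = ?S"
    "x \<oplus>\<^bsub>socle_module R (regular_module R)\<^esub> y = x \<oplus> y"
    "x \<odot>\<^bsub>socle_module R (regular_module R)\<^esub> y = x \<otimes> y" for x y
    by (simp_all add: socle_module_def regular_module_def)
  show ?thesis
  proof
    assume "module_isomorphic R (socle_module R (regular_module R)) ?F"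
    then obtain h where h: "bij_betw h ?S (cs ` carrier R)"
      "\<And>a x. a \<in> carrier R \<Longrightarrow> x \<in> ?S \<Longrightarrow> h (a \<otimes> x) = a \<odot>\<^bsub>?F\<^esub> h x"
      unfolding module_isomorphic_def SM F(1) by blast
    have "cs \<one> \<in> h ` ?S" using h(1) by (auto simp: bij_betw_def)
    then obtain z where z: "z \<in> ?S" "h z = cs \<one>" by auto
    have zc: "z \<in> carrier R" using S(2) z by blast
    have hz: "h (a \<otimes> z) = cs a" if "a \<in> carrier R" for a
      using h(2)[OF that z(1)] z(2) F(3)[OF that one_closed] that by simp
    have inj: "x = y" if "h x = h y" "x \<in> ?S" "y \<in> ?S" for x y
      using h(1) that by (auto simp: bij_betw_def inj_on_def)
    have h0: "h \<zero> = cs \<zero>" using hz[of \<zero>] zc by simp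
    have "a \<in> J \<longleftrightarrow> a \<otimes> z = \<zero>" if a: "a \<in> carrier R" for a
    proof -
      have "a \<otimes> z = \<zero> \<longleftrightarrow> h (a \<otimes> z) = h \<zero>" using inj[of "a \<otimes> z" \<zero>] S(3) S(5)[OF a z(1)] by auto
      also have "\<dots> \<longleftrightarrow> a \<ominus> \<zero> \<in> J" using hz[OF a] h0 cs_eq[OF a zero_closed] by simp
      finally show ?thesis using a by (simp add: a_minus_def)
    qed
    then have "J = {a \<in> carrier R. a \<otimes> z = \<zero>}" using left_idealD(2)[OF J] by blast
    moreover have "?S = {a \<otimes> z | a. a \<in> carrier R}"
    proof (intro equalityI subsetI)
      fix x assume x: "x \<in> ?S"
      then have "h x \<in> cs ` carrier R" using h(1) by (auto simp: bij_betw_def)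
      then obtain a where a: "a \<in> carrier R" "h x = cs a" by blast
      then have "x = a \<otimes> z" using inj[of x "a \<otimes> z"] hz x S(5)[OF a(1) z(1)] by simp
      then show "x \<in> {a \<otimes> z | a. a \<in> carrier R}" using a by blast
    qed (use S(5) z in blast)
    ultimately show "\<exists>z. socle_generator R J z" using zc unfolding socle_generator_def by blast
  next
    assume "\<exists>z. socle_generator R J z"
    then obtain z where z: "z \<in> carrier R" "J = {a \<in> carrier R. a \<otimes> z = \<zero>}"
      "?S = {a \<otimes> z | a. a \<in> carrier R}" unfolding socle_generator_def by blast
    have eq: "cs a = cs b \<longleftrightarrow> a \<otimes> z = b \<otimes> z" if ab: "a \<in> carrier R" "b \<in> carrier R" for a b
    proof -
      have "(a \<ominus> b) \<otimes> z = a \<otimes> z \<ominus> b \<otimes> z" using ab z by algebra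
      then have "a \<ominus> b \<in> J \<longleftrightarrow> a \<otimes> z = b \<otimes> z"
        using ab z(1) minus_eq_zero_iff[of "a \<otimes> z" "b \<otimes> z"] unfolding z(2) by simp
      then show ?thesis using cs_eq[OF ab] by simp
    qed
    define h where "h x = cs (SOME a. a \<in> carrier R \<and> x = a \<otimes> z)" for x
    have h: "h (a \<otimes> z) = cs a" if a: "a \<in> carrier R" for a
    proof -
      let ?b = "SOME b. b \<in> carrier R \<and> a \<otimes> z = b \<otimes> z"
      have "?b \<in> carrier R \<and> a \<otimes> z = ?b \<otimes> z" by (rule someI[of _ a]) (use a in simp)
      then show ?thesis using eq[OF a, of ?b] unfolding h_def by simp
    qed
    have "bij_betw h ?S (cs ` carrier R)"
      unfolding bij_betw_def inj_on_def
    proof (intro conjI ballI impI)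
      fix x y assume xy: "x \<in> ?S" "y \<in> ?S" "h x = h y"
      obtain a where a: "a \<in> carrier R" "x = a \<otimes> z" using z(3) xy(1) by blast
      obtain b where b: "b \<in> carrier R" "y = b \<otimes> z" using z(3) xy(2) by blast
      show "x = y" using xy(3) h[OF a(1)] h[OF b(1)] eq[OF a(1) b(1)] a(2) b(2) by simp
    next
      show "h ` ?S = cs ` carrier R"
      proof (intro equalityI subsetI)
        fix y assume "y \<in> h ` ?S"
        then show "y \<in> cs ` carrier R" using z(3) h by auto
      next
        fix y assume "y \<in> cs ` carrier R"
        then obtain a where "a \<in> carrier R" "y = h (a \<otimes> z)" using h by auto
        then show "y \<in> h ` ?S" using z(3) by blast
      qed
    qed
    moreover have "h (x \<oplus> y) = h x \<oplus>\<^bsub>?F\<^esub> h y" if xy: "x \<in> ?S" "y \<in> ?S" for x y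
    proof -
      obtain a where a: "a \<in> carrier R" "x = a \<otimes> z" using z(3) xy(1) by blast
      obtain b where b: "b \<in> carrier R" "y = b \<otimes> z" using z(3) xy(2) by blast
      have "x \<oplus> y = (a \<oplus> b) \<otimes> z" using a b z(1) by (simp add: l_distr)
      then show ?thesis using a b h F(2) by simp
    qed
    moreover have "h (r \<otimes> x) = r \<odot>\<^bsub>?F\<^esub> h x" if r: "r \<in> carrier R" and x: "x \<in> ?S" for r x
    proof -
      obtain a where a: "a \<in> carrier R" "x = a \<otimes> z" using z(3) x by blast
      then have "r \<otimes> x = (r \<otimes> a) \<otimes> z" using z(1) r by (simp add: m_assoc)
      then show ?thesis using a h F(3) r by simp
    qed
    ultimately show "module_isomorphic R (socle_module R (regular_module R)) ?F"
      unfolding module_isomorphic_def SM F(1) by blast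
  qed
qed

text \<open>\<open>frobenius_ring\<close> forms the right-hand quotient with the radical built from
  left ideals; this fact lets the preceding equivalence be used for the opposite ring.\<close>

lemma left_ideal_radical_opposite: "left_ideal (jacobson_radical R) (opposite_ring R)"
proof -
  interpret op: ring "opposite_ring R" by (rule ring_opposite)
  show ?thesis
    by (rule op.left_idealI)
      (use left_idealD[OF left_ideal_radical] radical_mult_right in auto)
qed

lemma frobenius_ring_iff:
  "frobenius_ring R \<longleftrightarrow> left_artinian R \<and> right_artinian R \<and>
    (\<exists>z. socle_generator R (jacobson_radical R) z) \<and>
    (\<exists>z. socle_generator (opposite_ring R) (jacobson_radical R) z)"
  using ring_axioms socle_isomorphic_iff[OF left_ideal_radical]
    ring.socle_isomorphic_iff[OF ring_opposite left_ideal_radical_opposite]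
  by (simp add: frobenius_ring_def)

end

text \<open>An element with maximal annihilator spans a simple ideal, so it lies in the socle and is
  a multiple of the socle generator.\<close>

lemma (in cring) frobenius_self_dual:
  assumes "frobenius_ring R"
  shows "self_dual_ring R"
proof -
  obtain z where art: "left_artinian R" and z: "socle_generator R (jacobson_radical R) z"
    using assms by (auto simp: frobenius_ring_iff)
  interpret cyclic_socle R z
  proof
    fix s assume s: "s \<in> carrier R" and m: "maximal_left_ideal {a \<in> carrier R. a \<otimes> s = \<zero>} R"
    have "\<one> \<otimes> s \<in> {r \<otimes> s | r. r \<in> carrier R}" by blast
    then have "s \<in> socle R (regular_module R)"
      using socle_simple[OF simple_of_maximal_annihilator[OF s m]] s by auto
    then show "\<exists>c\<in>carrier R. s = c \<otimes> z" using z by (auto simp: socle_generator_def)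
  qed (use art z in \<open>auto simp: socle_generator_def\<close>)
  show ?thesis by (rule self_dual)
qed

section \<open>Algebras over a self-dual ring\<close>

text \<open>Choose \<open>i\<close> with \<open>x e i\<close> outside \<open>J\<close> and
  \<open>s\<close> with \<open>s x e i\<close> congruent to \<open>e i\<close>. Modulo
  \<open>J\<close>, the element \<open>e i s x\<close> is \<open>e i\<close> in the corner
  \<open>i\<close> and zero in the other diagonal corners. The set \<open>Z\<close> stands for the
  zero set of a functional and stays abstract, so that the statement applies to a ring and to its
  opposite.\<close>

lemma (in primitive_decomposition) avoid_kernel:
  assumes Z: "\<And>i y. \<lbrakk>i \<in> I; e i \<notin> J; y \<in> carrier R; \<And>k. k \<in> I \<Longrightarrow> k \<noteq> i \<Longrightarrow> e k \<otimes> y \<otimes> e k \<in> J;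
      e i \<otimes> y \<otimes> e i \<ominus> e i \<in> J\<rbrakk> \<Longrightarrow> y \<notin> Z"
    and x: "x \<in> carrier R" "x \<notin> J"
  shows "\<exists>r\<in>carrier R. r \<otimes> x \<notin> Z"
proof -
  note JD = left_idealD[OF J_left_ideal]
  have eI: "e \<in> I \<rightarrow> carrier R" using e_closed by blast
  have "\<exists>i\<in>I. x \<otimes> e i \<notin> J"
  proof (rule ccontr)
    assume "\<not> (\<exists>i\<in>I. x \<otimes> e i \<notin> J)"
    then have "(\<Oplus>i\<in>I. x \<otimes> e i) \<in> J" by (intro left_ideal_finsum[OF J_left_ideal finite_I]) auto
    then have "x \<otimes> finsum R e I \<in> J" using finsum_rdistr[OF finite_I x(1) eI] by simp
    moreover have "x \<otimes> (\<one> \<ominus> finsum R e I) \<in> J" using JD(5)[OF x(1) e_sum] .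
    ultimately have "x \<otimes> (\<one> \<ominus> finsum R e I) \<oplus> x \<otimes> finsum R e I \<in> J" using JD(4) by blast
    moreover have "x \<otimes> (\<one> \<ominus> finsum R e I) \<oplus> x \<otimes> finsum R e I = x"
      using x(1) finsum_closed[OF eI] by (simp add: a_minus_def r_distr r_minus a_assoc l_neg)
    ultimately show False using x(2) by simp
  qed
  then obtain i where i: "i \<in> I" "x \<otimes> e i \<notin> J" by blast
  have ei: "e i \<in> carrier R" using e_closed i by blast
  have eJ: "e i \<notin> J" using i(2) JD(5)[OF x(1)] by blast
  obtain s where s: "s \<in> carrier R" "s \<otimes> (x \<otimes> e i) \<ominus> e i \<in> J" using e_left[OF i(1) x(1) i(2)] by blast
  have "(e i \<otimes> s) \<otimes> x \<notin> Z"
  proof (rule Z[OF i(1) eJ])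
    show "(e i \<otimes> s) \<otimes> x \<in> carrier R" using ei s x by simp
    fix k assume k: "k \<in> I" "k \<noteq> i"
    have "(e k \<otimes> e i) \<otimes> (s \<otimes> x \<otimes> e k) \<in> J"
      by (rule J_right[OF e_orth[OF k(1) i(1) k(2)]]) (use s x e_closed[OF k(1)] in simp)
    then show "e k \<otimes> ((e i \<otimes> s) \<otimes> x) \<otimes> e k \<in> J"
      using s x e_closed[OF k(1)] ei by (simp add: m_assoc)
  next
    \<comment> \<open>\<open>e i\<close> is idempotent only modulo \<open>J\<close>. The multiples
      of \<open>d\<close> telescope the third power of \<open>e i\<close> down to \<open>e i\<close>
      itself.\<close>
    let ?d = "e i \<otimes> e i \<ominus> e i"
    have "(e i \<otimes> e i) \<otimes> (s \<otimes> (x \<otimes> e i) \<ominus> e i) \<oplus> (?d \<otimes> e i \<oplus> ?d) \<in> J"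
      using JD(4)[OF JD(5)[OF _ s(2)] JD(4)[OF J_right[OF e_idem[OF i(1)] ei] e_idem[OF i(1)]]] ei by simp
    moreover have "(e i \<otimes> e i) \<otimes> (s \<otimes> (x \<otimes> e i) \<ominus> e i) \<oplus> (?d \<otimes> e i \<oplus> ?d)
        = e i \<otimes> ((e i \<otimes> s) \<otimes> x) \<otimes> e i \<ominus> e i"
    proof -
      define c where "c = e i"
      have c: "c \<in> carrier R" using ei by (simp add: c_def)
      have "(c \<otimes> c) \<otimes> (s \<otimes> (x \<otimes> c) \<ominus> c) = c \<otimes> ((c \<otimes> s) \<otimes> x) \<otimes> c \<ominus> c \<otimes> (c \<otimes> c)"
        using c s(1) x(1) by (simp add: a_minus_def r_distr r_minus m_assoc)
      moreover have "(c \<otimes> c \<ominus> c) \<otimes> c = c \<otimes> (c \<otimes> c) \<ominus> c \<otimes> c"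
        using c by (simp add: a_minus_def l_distr l_minus m_assoc)
      moreover have "(p \<ominus> q) \<oplus> ((q \<ominus> t) \<oplus> (t \<ominus> c)) = p \<ominus> c"
        if "p \<in> carrier R" "q \<in> carrier R" "t \<in> carrier R" for p q t
        using that c by algebra
      ultimately show ?thesis unfolding c_def[symmetric] using c s(1) x(1) by simp
    qed
    ultimately show "e i \<otimes> ((e i \<otimes> s) \<otimes> x) \<otimes> e i \<ominus> e i \<in> J" by simp
  qed
  then show ?thesis using ei s by blast
qed

lemma smult_opposite [simp]: "smult (opposite_ring R) = smult R"
  by (simp add: opposite_ring_def)

lemma linear_on_opposite [simp]: "linear_on K (opposite_ring R) N f \<longleftrightarrow> linear_on K R N f"
  by (simp add: linear_on_def)

lemma linear_on_finsum:
  assumes M: "module K M" and I: "finite I"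
    and f: "\<And>i. i \<in> I \<Longrightarrow> linear_on K M (carrier M) (f i)"
  shows "linear_on K M (carrier M) (\<lambda>x. \<Oplus>\<^bsub>K\<^esub>i\<in>I. f i x)"
proof -
  have closed: "x \<oplus>\<^bsub>M\<^esub> y \<in> carrier M" "a \<odot>\<^bsub>M\<^esub> x \<in> carrier M"
    if "x \<in> carrier M" "y \<in> carrier M" "a \<in> carrier K" for x y a
    using that M by (auto simp: module_def abelian_group_def abelian_monoid.a_closed module.smult_closed[OF M])
  interpret cring K using M by (simp add: module_def)
  show ?thesis
    using I f
  proof (induction)
    case empty
    show ?case by (rule linear_onI) auto
  next
    case (insert j I)
    have F: "linear_on K M (carrier M) (f j)" "linear_on K M (carrier M) (\<lambda>x. \<Oplus>\<^bsub>K\<^esub>i\<in>I. f i x)"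
      using insert by auto
    have c: "(\<lambda>i. f i x) \<in> I \<rightarrow> carrier K" if x: "x \<in> carrier M" for x
      using insert.prems linear_onD(1)[OF _ x] by blast
    have eq: "(\<Oplus>\<^bsub>K\<^esub>i\<in>insert j I. f i x) = f j x \<oplus>\<^bsub>K\<^esub> (\<Oplus>\<^bsub>K\<^esub>i\<in>I. f i x)" if "x \<in> carrier M" for x
      by (rule finsum_insert) (use insert.hyps c[OF that] linear_onD(1)[OF F(1) that] in auto)
    show ?case
    proof (rule linear_onI)
      fix x y assume xy: "x \<in> carrier M" "y \<in> carrier M"
      show "(\<Oplus>\<^bsub>K\<^esub>i\<in>insert j I. f i (x \<oplus>\<^bsub>M\<^esub> y)) =
          (\<Oplus>\<^bsub>K\<^esub>i\<in>insert j I. f i x) \<oplus>\<^bsub>K\<^esub> (\<Oplus>\<^bsub>K\<^esub>i\<in>insert j I. f i y)"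
        using eq[OF closed(1)[OF xy zero_closed]] eq xy linear_onD(1,2)[OF F(1)] linear_onD(1,2)[OF F(2)]
        by (simp add: a_ac)
    next
      fix a x assume "a \<in> carrier K" "x \<in> carrier M"
      then show "(\<Oplus>\<^bsub>K\<^esub>i\<in>insert j I. f i (a \<odot>\<^bsub>M\<^esub> x)) = a \<otimes>\<^bsub>K\<^esub> (\<Oplus>\<^bsub>K\<^esub>i\<in>insert j I. f i x)"
        using eq closed(2) linear_onD(1,3)[OF F(1)] linear_onD(1,3)[OF F(2)] by (simp add: r_distr)
    next
      fix x assume "x \<in> carrier M"
      then show "(\<Oplus>\<^bsub>K\<^esub>i\<in>insert j I. f i x) \<in> carrier K"
        using eq linear_onD(1)[OF F(1)] linear_onD(1)[OF F(2)] by simp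
    qed
  qed
qed

locale self_dual_algebra = D: self_dual_module K R + A: unital_algebra K R
  for K :: "('k, 'm) ring_scheme" and R :: "('k, 'r, 'n) module_scheme" (structure) +
  assumes fg: "finitely_generated_module K R"
begin

abbreviation functional :: "('r \<Rightarrow> 'k) \<Rightarrow> bool" where
  "functional f \<equiv> linear_on K R (carrier R) f"

text \<open>For \<open>J = {\<zero>}\<close> the kernel of \<open>f\<close> contains no nonzero left
  ideal. The parameter lets the same notion speak about functionals on \<open>R / J\<close>.\<close>

definition left_nondegenerate :: "'r set \<Rightarrow> ('r \<Rightarrow> 'k) \<Rightarrow> bool" where
  "left_nondegenerate J f \<longleftrightarrow>
    (\<forall>x\<in>carrier R. (\<forall>r\<in>carrier R. f (r \<otimes> x) = \<zero>\<^bsub>K\<^esub>) \<longrightarrow> x \<in> J)"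

definition right_nondegenerate :: "'r set \<Rightarrow> ('r \<Rightarrow> 'k) \<Rightarrow> bool" where
  "right_nondegenerate J f \<longleftrightarrow>
    (\<forall>x\<in>carrier R. (\<forall>r\<in>carrier R. f (x \<otimes> r) = \<zero>\<^bsub>K\<^esub>) \<longrightarrow> x \<in> J)"

text \<open>Passing to the opposite ring exchanges left and right nondegeneracy, so one-sided
  statements below come with their mirror images.\<close>

lemma opposite: "self_dual_algebra K (opposite_ring R)"
proof -
  interpret op: ring "opposite_ring R" by (rule A.ring_opposite)
  have m: "module K (opposite_ring R)"
    by (rule moduleI)
      (auto simp: D.is_cring op.abelian_group_axioms D.smult_l_distr D.smult_r_distr D.smult_assoc1)
  interpret opm: module K "opposite_ring R" by (rule m)
  show ?thesis
    using fg
    by unfold_locales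
      (auto simp: A.smult_mult_left A.smult_mult_right finitely_generated_module_def)
qed

lemma left_ideal_submodule:
  assumes "left_ideal I R"
  shows "submodule I K R"
proof (rule D.submodule_intro)
  note ID = A.left_idealD[OF assms]
  fix a x assume a: "a \<in> carrier K" and x: "x \<in> I"
  have "(a \<odot> \<one>) \<otimes> x \<in> I" by (rule ID(5)) (use a x in auto)
  then show "a \<odot> x \<in> I" using a ID(2)[OF x] by (simp add: A.smult_mult_left)
qed (use A.left_idealD[OF assms] in auto)

lemma left_artinian_algebra:
  assumes "left_artinian K"
  shows "left_artinian R"
  unfolding left_artinian_def
  using D.finitely_generated_dcc[OF assms fg] left_ideal_submodule by blast

lemma functional_mult_right:
  assumes f: "functional f" and x: "x \<in> carrier R"
  shows "functional (\<lambda>y. f (y \<otimes> x))"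
  by (rule linear_onI) (use linear_onD[OF f] x in \<open>auto simp: A.l_distr A.smult_mult_left\<close>)

lemma functional_zero: "functional f \<Longrightarrow> f \<zero> = \<zero>\<^bsub>K\<^esub>"
  using D.linear_on_zero D.carrier_is_submodule by blast

lemma functional_minus:
  "\<lbrakk>functional f; x \<in> carrier R; y \<in> carrier R\<rbrakk> \<Longrightarrow> f (x \<ominus> y) = f x \<ominus>\<^bsub>K\<^esub> f y"
  using D.linear_on_minus D.carrier_is_submodule by blast

lemma bilinear_mult:
  assumes f: "functional f"
  shows "bilinear_form K R (\<lambda>x y. f (x \<otimes> y))"
  unfolding bilinear_form_def
  using linear_onD[OF f]
  by (auto simp: A.l_distr A.r_distr A.smult_mult_left A.smult_mult_right)

text \<open>The representation of functionals is applied to the form \<open>l (x y)\<close>. If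
  \<open>l\<close> is right nondegenerate modulo \<open>J\<close>, it suffices that \<open>f\<close>
  vanishes on \<open>J\<close>.\<close>

lemma functional_as_multiple:
  assumes l: "functional l" and f: "functional f"
    and ker: "\<And>x. x \<in> carrier R \<Longrightarrow> (\<And>y. y \<in> carrier R \<Longrightarrow> l (x \<otimes> y) = \<zero>\<^bsub>K\<^esub>) \<Longrightarrow> f x = \<zero>\<^bsub>K\<^esub>"
  shows "\<exists>z\<in>carrier R. \<forall>x\<in>carrier R. f x = l (x \<otimes> z)"
  by (rule D.functional_represented[OF fg bilinear_mult[OF l] f]) (use ker in blast)


lemma functional_eq_multipleD:
  assumes f: "functional f" and nd: "left_nondegenerate {\<zero>} f"
    and x: "x \<in> carrier R" and y: "y \<in> carrier R"
    and eq: "\<And>r. r \<in> carrier R \<Longrightarrow> f (r \<otimes> x) = f (r \<otimes> y)"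
  shows "x = y"
proof -
  have "f (r \<otimes> (x \<ominus> y)) = \<zero>\<^bsub>K\<^esub>" if r: "r \<in> carrier R" for r
  proof -
    have "r \<otimes> (x \<ominus> y) = r \<otimes> x \<ominus> r \<otimes> y"
      using r x y by (simp add: a_minus_def A.r_distr A.r_minus)
    then show ?thesis
      using functional_minus[OF f, of "r \<otimes> x" "r \<otimes> y"] eq[OF r] linear_onD(1)[OF f] r x y
      by (simp add: D.minus_eq_zero_iff)
  qed
  then have "x \<ominus> y = \<zero>" using nd x y by (auto simp: left_nondegenerate_def)
  then show ?thesis using A.minus_eq_zero_iff x y by blast
qed

text \<open>The functional is \<open>x \<mapsto> \<Sum>i. \<nu>\<^sub>i (e\<^sub>i x e\<^sub>i)\<close>, where \<open>\<nu>\<^sub>i\<close> vanishes on \<open>J\<close> but not at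
  \<open>e\<^sub>i\<close>. Every one-sided ideal that is not contained in \<open>J\<close> contains an element which is \<open>e\<^sub>i\<close> in one
  diagonal corner and lies in \<open>J\<close> in all the others.\<close>

lemma functional_nondegenerate_mod_radical:
  assumes pd: "primitive_decomposition R J I e"
  obtains m where "functional m" "\<And>j. j \<in> J \<Longrightarrow> m j = \<zero>\<^bsub>K\<^esub>"
    "left_nondegenerate J m" "right_nondegenerate J m"
proof -
  interpret P: primitive_decomposition R J I e by (rule pd)
  interpret Q: primitive_decomposition "opposite_ring R" J I e by (rule P.opposite)
  note JD = A.left_idealD[OF P.J_left_ideal]
  \<comment> \<open>An index with \<open>e i\<close> in \<open>J\<close> is not excluded by the
    locale; it receives the zero functional.\<close>
  have "\<exists>f. functional f \<and> (\<forall>j\<in>J. f j = \<zero>\<^bsub>K\<^esub>) \<and> (e i \<notin> J \<longrightarrow> f (e i) \<noteq> \<zero>\<^bsub>K\<^esub>)" if i: "i \<in> I" for i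
  proof (cases "e i \<in> J")
    case True
    have "functional (\<lambda>_. \<zero>\<^bsub>K\<^esub>)" by (rule linear_onI) auto
    then show ?thesis using True by blast
  next
    case False
    obtain g where "functional g" "\<And>y. y \<in> J \<Longrightarrow> g y = \<zero>\<^bsub>K\<^esub>" "g (e i) \<noteq> \<zero>\<^bsub>K\<^esub>"
      using D.separating_functional[OF fg left_ideal_submodule[OF P.J_left_ideal] P.e_closed[OF i] False] by metis
    then show ?thesis by blast
  qed
  then obtain n where n: "\<And>i. i \<in> I \<Longrightarrow> functional (n i)" "\<And>i j. i \<in> I \<Longrightarrow> j \<in> J \<Longrightarrow> n i j = \<zero>\<^bsub>K\<^esub>"
    "\<And>i. i \<in> I \<Longrightarrow> e i \<notin> J \<Longrightarrow> n i (e i) \<noteq> \<zero>\<^bsub>K\<^esub>" by metis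
  define t where "t i x = n i (e i \<otimes> x \<otimes> e i)" for i x
  define m where "m x = (\<Oplus>\<^bsub>K\<^esub>i\<in>I. t i x)" for x
  have t: "functional (t i)" if i: "i \<in> I" for i
    unfolding t_def
    by (rule linear_onI)
      (use linear_onD[OF n(1)[OF i]] P.e_closed[OF i] in
        \<open>auto simp: A.l_distr A.r_distr A.smult_mult_left A.smult_mult_right\<close>)
  have m: "functional m"
    unfolding m_def by (rule linear_on_finsum[OF D.module_axioms P.finite_I t])
  have kam: "abelian_monoid K" using D.is_cring by (simp add: cring_def ring_def abelian_group_def)
  have mJ: "m j = \<zero>\<^bsub>K\<^esub>" if j: "j \<in> J" for j
  proof -
    have "t i j = \<zero>\<^bsub>K\<^esub>" if i: "i \<in> I" for i
      unfolding t_def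
      by (rule n(2)[OF i P.J_right[OF JD(5)[OF P.e_closed[OF i] j] P.e_closed[OF i]]])
    then have "m j = (\<Oplus>\<^bsub>K\<^esub>i\<in>I. \<zero>\<^bsub>K\<^esub>)"
      unfolding m_def by (intro abelian_monoid.finsum_cong'[OF kam]) (auto simp: D.zero_closed)
    then show ?thesis by (simp add: abelian_monoid.finsum_zero[OF kam])
  qed
  have key: "m y \<noteq> \<zero>\<^bsub>K\<^esub>"
    if i: "i \<in> I" "e i \<notin> J" and y: "y \<in> carrier R"
      and off: "\<And>k. k \<in> I \<Longrightarrow> k \<noteq> i \<Longrightarrow> e k \<otimes> y \<otimes> e k \<in> J"
      and diag: "e i \<otimes> y \<otimes> e i \<ominus> e i \<in> J" for i y
  proof -
    note ei = P.e_closed[OF i(1)]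
    have eye: "e i \<otimes> y \<otimes> e i \<in> carrier R" using ei y by simp
    have "n i (e i \<otimes> y \<otimes> e i) \<ominus>\<^bsub>K\<^esub> n i (e i) = \<zero>\<^bsub>K\<^esub>"
      using functional_minus[OF n(1)[OF i(1)] eye ei] n(2)[OF i(1) diag] by simp
    then have ti: "t i y = n i (e i)"
      unfolding t_def
      using linear_onD(1)[OF n(1)[OF i(1)]] eye ei D.minus_eq_zero_iff by blast
    have tc: "t k y \<in> carrier K" if "k \<in> I" for k using linear_onD(1)[OF t[OF that] y] .
    have "m y = (\<Oplus>\<^bsub>K\<^esub>k\<in>I. if i = k then t k y else \<zero>\<^bsub>K\<^esub>)"
      unfolding m_def
    proof (rule abelian_monoid.finsum_cong'[OF kam])
      fix k assume k: "k \<in> I"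
      show "t k y = (if i = k then t k y else \<zero>\<^bsub>K\<^esub>)"
        using n(2)[OF k off[OF k]] by (auto simp: t_def)
    qed (use tc in \<open>auto simp: D.zero_closed\<close>)
    also have "\<dots> = t i y"
      by (rule abelian_monoid.finsum_singleton[OF kam i(1) P.finite_I]) (use tc in auto)
    finally show ?thesis using ti n(3)[OF i] by simp
  qed
  have "left_nondegenerate J m"
    unfolding left_nondegenerate_def
  proof (intro ballI impI, rule ccontr)
    fix x assume x: "x \<in> carrier R" "\<forall>r\<in>carrier R. m (r \<otimes> x) = \<zero>\<^bsub>K\<^esub>" "x \<notin> J"
    have "\<exists>r\<in>carrier R. r \<otimes> x \<notin> {y. m y = \<zero>\<^bsub>K\<^esub>}"
      by (rule P.avoid_kernel[OF _ x(1,3)]) (use key in blast)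
    then show False using x(2) by blast
  qed
  moreover have "right_nondegenerate J m"
    unfolding right_nondegenerate_def
  proof (intro ballI impI, rule ccontr)
    fix x assume x: "x \<in> carrier R" "\<forall>r\<in>carrier R. m (x \<otimes> r) = \<zero>\<^bsub>K\<^esub>" "x \<notin> J"
    have "\<exists>r\<in>carrier (opposite_ring R). r \<otimes>\<^bsub>opposite_ring R\<^esub> x \<notin> {y. m y = \<zero>\<^bsub>K\<^esub>}"
    proof (rule Q.avoid_kernel)
      fix i y
      assume i: "i \<in> I" "e i \<notin> J" and y: "y \<in> carrier (opposite_ring R)"
        and off: "\<And>k. k \<in> I \<Longrightarrow> k \<noteq> i \<Longrightarrow> e k \<otimes>\<^bsub>opposite_ring R\<^esub> y \<otimes>\<^bsub>opposite_ring R\<^esub> e k \<in> J"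
        and diag: "e i \<otimes>\<^bsub>opposite_ring R\<^esub> y \<otimes>\<^bsub>opposite_ring R\<^esub> e i \<ominus>\<^bsub>opposite_ring R\<^esub> e i \<in> J"
      have "m y \<noteq> \<zero>\<^bsub>K\<^esub>"
      proof (rule key[OF i])
        show "e k \<otimes> y \<otimes> e k \<in> J" if "k \<in> I" "k \<noteq> i" for k
          using off[OF that] P.e_closed[OF that(1)] y by (simp add: A.m_assoc)
        show "e i \<otimes> y \<otimes> e i \<ominus> e i \<in> J"
          using diag P.e_closed[OF i(1)] y by (simp add: A.m_assoc)
      qed (use y in simp)
      then show "y \<notin> {y. m y = \<zero>\<^bsub>K\<^esub>}" by simp
    qed (use x in simp_all)
    then show False using x(2) by auto
  qed
  ultimately show ?thesis using that m mJ by blast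
qed

text \<open>With \<open>m = l (- z)\<close>, the equation \<open>a z = \<zero>\<close> means that
  \<open>m\<close> vanishes on \<open>R a\<close>, that is, \<open>a\<close> lies in
  \<open>J\<close>. If \<open>J\<close> kills \<open>x\<close>, then \<open>l (- x)\<close> vanishes
  on \<open>J\<close>, so right nondegeneracy of \<open>m\<close> makes it
  \<open>m (- r) = l (- r z)\<close>, whence \<open>x = r z\<close>.\<close>

lemma socle_generator_of_nondegenerate:
  assumes l: "functional l" "left_nondegenerate {\<zero>} l" "right_nondegenerate {\<zero>} l"
    and J: "left_ideal J R" "\<And>j r. j \<in> J \<Longrightarrow> r \<in> carrier R \<Longrightarrow> j \<otimes> r \<in> J"
    and m: "functional m" "\<And>j. j \<in> J \<Longrightarrow> m j = \<zero>\<^bsub>K\<^esub>" "left_nondegenerate J m" "right_nondegenerate J m"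
    and soc: "socle R (regular_module R) = {x \<in> carrier R. \<forall>j\<in>J. j \<otimes> x = \<zero>}"
  shows "\<exists>z. socle_generator R J z"
proof -
  note JD = A.left_idealD[OF J(1)]
  have "\<exists>z\<in>carrier R. \<forall>x\<in>carrier R. m x = l (x \<otimes> z)"
  proof (rule functional_as_multiple[OF l(1) m(1)])
    fix x assume "x \<in> carrier R" "\<And>y. y \<in> carrier R \<Longrightarrow> l (x \<otimes> y) = \<zero>\<^bsub>K\<^esub>"
    then have "x = \<zero>" using l(3) by (simp add: right_nondegenerate_def)
    then show "m x = \<zero>\<^bsub>K\<^esub>" using functional_zero[OF m(1)] by simp
  qed
  then obtain z where z: "z \<in> carrier R" "\<And>x. x \<in> carrier R \<Longrightarrow> m x = l (x \<otimes> z)" by blast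
  have J_iff: "a \<in> J \<longleftrightarrow> a \<otimes> z = \<zero>" if a: "a \<in> carrier R" for a
  proof
    assume aJ: "a \<in> J"
    have "l (r \<otimes> (a \<otimes> z)) = \<zero>\<^bsub>K\<^esub>" if r: "r \<in> carrier R" for r
      using m(2)[OF JD(5)[OF r aJ]] z(2)[of "r \<otimes> a"] r a z(1) by (simp add: A.m_assoc)
    then show "a \<otimes> z = \<zero>" using l(2) a z(1) by (simp add: left_nondegenerate_def)
  next
    assume az: "a \<otimes> z = \<zero>"
    have "m (r \<otimes> a) = \<zero>\<^bsub>K\<^esub>" if r: "r \<in> carrier R" for r
      using z(2)[of "r \<otimes> a"] r a z(1) az functional_zero[OF l(1)] by (simp add: A.m_assoc)
    then show "a \<in> J" using m(3) a by (simp add: left_nondegenerate_def)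
  qed
  have "socle R (regular_module R) = {a \<otimes> z | a. a \<in> carrier R}"
  proof (intro equalityI subsetI)
    fix x assume "x \<in> socle R (regular_module R)"
    then have x: "x \<in> carrier R" "\<And>j. j \<in> J \<Longrightarrow> j \<otimes> x = \<zero>" by (auto simp: soc)
    have "\<exists>r\<in>carrier R. \<forall>y\<in>carrier R. l (y \<otimes> x) = m (y \<otimes> r)"
    proof (rule functional_as_multiple[OF m(1) functional_mult_right[OF l(1) x(1)]])
      fix y assume "y \<in> carrier R" "\<And>r. r \<in> carrier R \<Longrightarrow> m (y \<otimes> r) = \<zero>\<^bsub>K\<^esub>"
      then have "y \<in> J" using m(4) by (simp add: right_nondegenerate_def)
      then show "l (y \<otimes> x) = \<zero>\<^bsub>K\<^esub>" using x(2) functional_zero[OF l(1)] by simp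
    qed
    then obtain r where r: "r \<in> carrier R" "\<And>y. y \<in> carrier R \<Longrightarrow> l (y \<otimes> x) = m (y \<otimes> r)" by blast
    have "x = r \<otimes> z"
    proof (rule functional_eq_multipleD[OF l(1,2) x(1)])
      fix y assume y: "y \<in> carrier R"
      show "l (y \<otimes> x) = l (y \<otimes> (r \<otimes> z))"
        using r(2)[OF y] z(2)[of "y \<otimes> r"] y r(1) z(1) by (simp add: A.m_assoc)
    qed (use r z in simp)
    then show "x \<in> {a \<otimes> z | a. a \<in> carrier R}" using r(1) by blast
  next
    fix x assume "x \<in> {a \<otimes> z | a. a \<in> carrier R}"
    then obtain a where a: "a \<in> carrier R" "x = a \<otimes> z" by blast
    have "j \<otimes> x = \<zero>" if j: "j \<in> J" for j
    proof -
      have "j \<otimes> x = (j \<otimes> a) \<otimes> z" using JD(2)[OF j] a z(1) by (simp add: A.m_assoc)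
      then show ?thesis using J_iff[of "j \<otimes> a"] J(2)[OF j a(1)] JD(2) by simp
    qed
    then show "x \<in> socle R (regular_module R)" using a z(1) by (simp add: soc)
  qed
  moreover have "J = {a \<in> carrier R. a \<otimes> z = \<zero>}" using J_iff JD(2) by blast
  ultimately show ?thesis using z(1) unfolding socle_generator_def by blast
qed

text \<open>The functional \<open>a z \<mapsto> m a\<close> on the socle \<open>R z\<close> is extended to \<open>R\<close>. Its kernel contains no
  simple left ideal, hence no nonzero left ideal.\<close>

lemma left_nondegenerate_of_socle_generator:
  assumes art: "left_artinian R" and z: "socle_generator R J z"
    and m: "functional m" "\<And>j. j \<in> J \<Longrightarrow> m j = \<zero>\<^bsub>K\<^esub>" "left_nondegenerate J m"
  obtains l where "functional l" "left_nondegenerate {\<zero>} l"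
proof -
  let ?S = "socle R (regular_module R)"
  have zc: "z \<in> carrier R" and J: "J = {a \<in> carrier R. a \<otimes> z = \<zero>}"
    and S: "?S = {a \<otimes> z | a. a \<in> carrier R}" using z by (auto simp: socle_generator_def)
  note sub = left_ideal_submodule[OF A.left_ideal_socle]
  \<comment> \<open>The choice of \<open>a\<close> is immaterial: two choices differ by an element
    of \<open>J\<close>, on which \<open>m\<close> vanishes.\<close>
  define f where "f x = m (SOME a. a \<in> carrier R \<and> x = a \<otimes> z)" for x
  have f: "f (a \<otimes> z) = m a" if a: "a \<in> carrier R" for a
  proof -
    let ?b = "SOME b. b \<in> carrier R \<and> a \<otimes> z = b \<otimes> z"
    have b: "?b \<in> carrier R \<and> a \<otimes> z = ?b \<otimes> z" by (rule someI[of _ a]) (use a in simp)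
    have "(a \<ominus> ?b) \<otimes> z = a \<otimes> z \<ominus> ?b \<otimes> z"
      using a b zc by (simp add: a_minus_def A.l_distr A.l_minus)
    also have "\<dots> = \<zero>" using a b zc A.minus_eq_zero_iff by simp
    finally have "a \<ominus> ?b \<in> J" using a b by (simp add: J)
    then have "m (a \<ominus> ?b) = \<zero>\<^bsub>K\<^esub>" by (rule m(2))
    then have "m a \<ominus>\<^bsub>K\<^esub> m ?b = \<zero>\<^bsub>K\<^esub>" using functional_minus[OF m(1) a conjunct1[OF b]] by simp
    moreover have "m a \<in> carrier K" "m ?b \<in> carrier K"
      using linear_onD(1)[OF m(1)] a conjunct1[OF b] by blast+
    ultimately have "m a = m ?b" using D.minus_eq_zero_iff by blast
    then show ?thesis by (simp add: f_def)
  qed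
  have "linear_on K R ?S f"
  proof (rule linear_onI)
    fix x assume "x \<in> ?S"
    then obtain a where a: "a \<in> carrier R" "x = a \<otimes> z" using S by blast
    show "f x \<in> carrier K" using f a linear_onD(1)[OF m(1)] by simp
    fix y assume "y \<in> ?S"
    then obtain b where b: "b \<in> carrier R" "y = b \<otimes> z" using S by blast
    have "x \<oplus> y = (a \<oplus> b) \<otimes> z" using a b zc by (simp add: A.l_distr)
    then show "f (x \<oplus> y) = f x \<oplus>\<^bsub>K\<^esub> f y"
      using f[of "a \<oplus> b"] f[OF a(1)] f[OF b(1)] a b linear_onD(2)[OF m(1)] by simp
  next
    fix k x assume k: "k \<in> carrier K" and "x \<in> ?S"
    then obtain a where a: "a \<in> carrier R" "x = a \<otimes> z" using S by blast
    have "k \<odot> x = (k \<odot> a) \<otimes> z" using a k zc by (simp add: A.smult_mult_left)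
    then show "f (k \<odot> x) = k \<otimes>\<^bsub>K\<^esub> f x"
      using f[of "k \<odot> a"] f[OF a(1)] a k linear_onD(3)[OF m(1)] by simp
  qed
  then obtain l where l: "functional l" "\<And>x. x \<in> ?S \<Longrightarrow> l x = f x"
    using D.extend_linear[OF fg sub] by metis
  have "left_nondegenerate {\<zero>} l"
    unfolding left_nondegenerate_def
  proof (intro ballI impI, rule ccontr)
    fix x assume x: "x \<in> carrier R" "\<forall>r\<in>carrier R. l (r \<otimes> x) = \<zero>\<^bsub>K\<^esub>" "x \<notin> {\<zero>}"
    let ?L = "{r \<otimes> x | r. r \<in> carrier R}"
    have "\<one> \<otimes> x \<in> ?L" by blast
    then have L: "?L \<noteq> {\<zero>}" using x by auto
    \<comment> \<open>A simple left ideal inside \<open>R x\<close> lies in the socle, so its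
      nonzero element \<open>y\<close> is some \<open>a z\<close>. As \<open>l\<close> vanishes on
      \<open>R y\<close>, \<open>m\<close> vanishes on \<open>R a\<close>; hence \<open>a\<close> is
      in \<open>J\<close> and \<open>y\<close> is zero.\<close>
    obtain T where T: "simple_submodule T R (regular_module R)" "T \<subseteq> ?L"
      using A.artinian_simple_sub[OF art A.left_ideal_principal[OF x(1)] L] .
    have "left_ideal T R" "T \<noteq> {\<zero>}" using T(1) by (auto simp: simple_submodule_regular)
    then obtain y where y: "y \<in> T" "y \<noteq> \<zero>" using A.left_idealD(3) by blast
    then obtain r where r: "r \<in> carrier R" "y = r \<otimes> x" using T(2) by blast
    have "y \<in> ?S" using A.socle_simple[OF T(1)] y by blast
    then obtain a where a: "a \<in> carrier R" "y = a \<otimes> z" using S by blast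
    have "m (s \<otimes> a) = \<zero>\<^bsub>K\<^esub>" if s: "s \<in> carrier R" for s
    proof -
      have sy: "s \<otimes> y = (s \<otimes> a) \<otimes> z" "s \<otimes> y = (s \<otimes> r) \<otimes> x"
        using s a r zc x(1) by (simp_all add: A.m_assoc)
      have "s \<otimes> y \<in> ?S" unfolding S sy(1) using s a by blast
      then have "m (s \<otimes> a) = l (s \<otimes> y)" using l(2) f[of "s \<otimes> a"] sy(1) s a by simp
      then show ?thesis using x(2) sy(2) s r by simp
    qed
    then have "a \<in> J" using m(3) a(1) by (simp add: left_nondegenerate_def)
    then show False using J a y by simp
  qed
  then show ?thesis using that l by blast
qed

text \<open>The map \<open>t \<mapsto> l (t \<cdot>)\<close> is onto \<open>R\<^sup>*\<close> and \<open>u \<mapsto> q (u \<cdot>)\<close> is injective, so that \<open>R\<^sup>*\<close> is both a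
  quotient of \<open>R\<close> and contains a copy of \<open>R\<close>. The descending chain condition on iterated
  preimages of this copy forces the injection to be onto as well.\<close>

lemma left_nondegenerate_of_right:
  assumes art: "left_artinian K"
    and l: "functional l" "left_nondegenerate {\<zero>} l"
    and q: "functional q" "right_nondegenerate {\<zero>} q"
  shows "left_nondegenerate {\<zero>} q"
proof -
  interpret op: self_dual_algebra K "opposite_ring R" by (rule opposite)
  \<comment> \<open>Over the opposite ring \<open>l\<close> is right nondegenerate, so every
    functional is a multiple of it.\<close>
  have surj: "\<exists>t\<in>carrier R. \<forall>x\<in>carrier R. g x = l (t \<otimes> x)" if g: "functional g" for g
  proof -
    have "\<exists>t\<in>carrier (opposite_ring R). \<forall>x\<in>carrier (opposite_ring R). g x = l (x \<otimes>\<^bsub>opposite_ring R\<^esub> t)"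
    proof (rule op.functional_as_multiple)
      fix x assume "x \<in> carrier (opposite_ring R)"
        "\<And>y. y \<in> carrier (opposite_ring R) \<Longrightarrow> l (x \<otimes>\<^bsub>opposite_ring R\<^esub> y) = \<zero>\<^bsub>K\<^esub>"
      then have "x = \<zero>" using l(2) by (simp add: left_nondegenerate_def)
      then show "g x = \<zero>\<^bsub>K\<^esub>" using functional_zero[OF g] by simp
    qed (use l g in simp_all)
    then show ?thesis by simp
  qed
  have left_mult: "functional (\<lambda>x. q (t \<otimes> x))" if "t \<in> carrier R" for t
    using op.functional_mult_right[of q t] q(1) that by simp
  have inj: "u = v" if "u \<in> carrier R" "v \<in> carrier R"
    "\<And>x. x \<in> carrier R \<Longrightarrow> q (u \<otimes> x) = q (v \<otimes> x)" for u v
    using op.functional_eq_multipleD[of q u v] q that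
    by (simp add: op.left_nondegenerate_def right_nondegenerate_def)
  \<comment> \<open>With \<open>u\<close> identified with \<open>q (u -)\<close>, this is the
    preimage of \<open>X\<close> under \<open>t \<mapsto> l (t -)\<close>.\<close>
  define \<Phi> where "\<Phi> X = {t \<in> carrier R. \<exists>u\<in>X. \<forall>x\<in>carrier R. l (t \<otimes> x) = q (u \<otimes> x)}" for X
  define T where "T n = (\<Phi> ^^ n) (carrier R)" for n
  have T0: "T 0 = carrier R" and TS: "T (Suc n) = \<Phi> (T n)" for n by (simp_all add: T_def)
  have "submodule (T n) K R" for n
  proof (induction n)
    case 0
    then show ?case using T0 D.carrier_is_submodule by simp
  next
    case (Suc n)
    note Tn = D.submoduleD[OF Suc.IH] and L = linear_onD[OF l(1)] and Q = linear_onD[OF q(1)]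
    show ?case
      unfolding TS
    proof (rule D.submodule_intro)
      show "\<Phi> (T n) \<subseteq> carrier R" by (auto simp: \<Phi>_def)
      show "\<zero> \<in> \<Phi> (T n)"
        unfolding \<Phi>_def using Tn(3) functional_zero[OF l(1)] functional_zero[OF q(1)]
        by (auto intro!: bexI[of _ "\<zero>"])
      fix t s assume "t \<in> \<Phi> (T n)" "s \<in> \<Phi> (T n)"
      then obtain u v where *: "t \<in> carrier R" "s \<in> carrier R" "u \<in> T n" "v \<in> T n"
        "\<And>x. x \<in> carrier R \<Longrightarrow> l (t \<otimes> x) = q (u \<otimes> x)"
        "\<And>x. x \<in> carrier R \<Longrightarrow> l (s \<otimes> x) = q (v \<otimes> x)" by (auto simp: \<Phi>_def)
      have "l ((t \<oplus> s) \<otimes> x) = q ((u \<oplus> v) \<otimes> x)" if "x \<in> carrier R" for x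
        using * that L Q Tn(2) by (simp add: A.l_distr)
      then show "t \<oplus> s \<in> \<Phi> (T n)" unfolding \<Phi>_def using * Tn(4) by blast
    next
      fix k t assume k: "k \<in> carrier K" and "t \<in> \<Phi> (T n)"
      then obtain u where *: "t \<in> carrier R" "u \<in> T n"
        "\<And>x. x \<in> carrier R \<Longrightarrow> l (t \<otimes> x) = q (u \<otimes> x)" by (auto simp: \<Phi>_def)
      have "l ((k \<odot> t) \<otimes> x) = q ((k \<odot> u) \<otimes> x)" if "x \<in> carrier R" for x
        using * that k L Q Tn(2) by (simp add: A.smult_mult_left)
      then show "k \<odot> t \<in> \<Phi> (T n)" unfolding \<Phi>_def using * Tn(5) k D.smult_closed by blast
    qed
  qed
  note sub = this
  have \<Phi>_mono: "\<Phi> X \<subseteq> \<Phi> Y" if "X \<subseteq> Y" for X Y using that by (auto simp: \<Phi>_def)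
  have "T (Suc n) \<subseteq> T n" for n
  proof (induction n)
    case 0
    then show ?case by (auto simp: T0 TS \<Phi>_def)
  next
    case (Suc n)
    then show ?case using \<Phi>_mono by (simp add: TS)
  qed
  then obtain n where "T (Suc n) = T n"
    using D.finitely_generated_dcc[OF art fg sub] by (metis le_SucI le_refl)
  \<comment> \<open>Stability moves down by one index: for \<open>u\<close> in \<open>T n\<close>,
    write \<open>q (u -) = l (t -)\<close>. Then \<open>t\<close> is in
    \<open>\<Phi> (T n) = \<Phi> (T (Suc n))\<close>, and injectivity of
    \<open>u \<mapsto> q (u -)\<close> puts \<open>u\<close> into \<open>T (Suc n)\<close>.\<close>
  moreover have "T (Suc n) = T n \<Longrightarrow> T (Suc 0) = T 0" for n
  proof (induction n)
    case (Suc n)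
    have "T n \<subseteq> T (Suc n)"
    proof
      fix u assume u: "u \<in> T n"
      have uc: "u \<in> carrier R" using D.submoduleD(2)[OF sub u] .
      obtain t where t: "t \<in> carrier R" "\<And>x. x \<in> carrier R \<Longrightarrow> q (u \<otimes> x) = l (t \<otimes> x)"
        using surj[OF left_mult[OF uc]] by blast
      have "t \<in> \<Phi> (T n)" unfolding \<Phi>_def using t u by (auto intro!: bexI[of _ u])
      then have "t \<in> \<Phi> (T (Suc n))" using Suc.prems by (simp add: TS)
      then obtain v where v: "v \<in> T (Suc n)" "\<And>x. x \<in> carrier R \<Longrightarrow> l (t \<otimes> x) = q (v \<otimes> x)"
        by (auto simp: \<Phi>_def)
      have "u = v"
        by (rule inj[OF uc D.submoduleD(2)[OF sub v(1)]]) (use t v in simp)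
      then show "u \<in> T (Suc n)" using v by simp
    qed
    moreover have "T (Suc n) \<subseteq> T n" by fact
    ultimately show ?case using Suc.IH by blast
  qed simp
  ultimately have \<Phi>R: "\<Phi> (carrier R) = carrier R" using T0 TS by metis
  show ?thesis
    unfolding left_nondegenerate_def
  proof (intro ballI impI, rule ccontr)
    fix x assume x: "x \<in> carrier R" "\<forall>r\<in>carrier R. q (r \<otimes> x) = \<zero>\<^bsub>K\<^esub>" "x \<notin> {\<zero>}"
    \<comment> \<open>Every functional is now some \<open>q (u -)\<close> and vanishes at
      \<open>x\<close>, although functionals separate points.\<close>
    obtain g where g: "functional g" "g x \<noteq> \<zero>\<^bsub>K\<^esub>"
      using D.separating_functional[OF fg D.submodule_zero x(1,3)] by metis
    obtain t where t: "t \<in> carrier R" "\<And>y. y \<in> carrier R \<Longrightarrow> g y = l (t \<otimes> y)"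
      using surj[OF g(1)] by blast
    have "t \<in> \<Phi> (carrier R)" using t(1) by (simp add: \<Phi>R)
    then obtain u where "u \<in> carrier R" "\<And>y. y \<in> carrier R \<Longrightarrow> l (t \<otimes> y) = q (u \<otimes> y)"
      by (auto simp: \<Phi>_def)
    then show False using g(2) t(2) x by simp
  qed
qed

text \<open>For the form \<open>f (x y)\<close>, injectivity of \<open>form_alpha\<close> is right
  nondegeneracy of \<open>f\<close>, and injectivity of \<open>form_beta\<close> is left
  nondegeneracy.\<close>

lemma nondegenerate_form_of_functional:
  assumes f: "functional f" "left_nondegenerate {\<zero>} f" "right_nondegenerate {\<zero>} f"
  shows "nonprojective_frobenius_algebra K R"
proof -
  interpret op: self_dual_algebra K "opposite_ring R" by (rule opposite)
  let ?p = "\<lambda>x y. f (x \<otimes> y)"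
  have "associative_form R ?p" by (simp add: associative_form_def A.m_assoc)
  moreover have "nondegenerate_form R ?p"
    unfolding nondegenerate_form_def
  proof
    show "inj_on (form_alpha R ?p) (carrier R)"
    proof (rule inj_onI)
      fix x y assume xy: "x \<in> carrier R" "y \<in> carrier R" "form_alpha R ?p x = form_alpha R ?p y"
      have "f (x \<otimes> r) = f (y \<otimes> r)" if "r \<in> carrier R" for r
        using fun_cong[OF xy(3), of r] that by (simp add: form_alpha_def)
      then show "x = y"
        using op.functional_eq_multipleD[of f x y] f xy
        by (simp add: op.left_nondegenerate_def right_nondegenerate_def)
    qed
    show "inj_on (form_beta R ?p) (carrier R)"
    proof (rule inj_onI)
      fix x y assume xy: "x \<in> carrier R" "y \<in> carrier R" "form_beta R ?p x = form_beta R ?p y"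
      have "f (r \<otimes> x) = f (r \<otimes> y)" if "r \<in> carrier R" for r
        using fun_cong[OF xy(3), of r] that by (simp add: form_beta_def)
      then show "x = y" using functional_eq_multipleD[OF f(1,2) xy(1,2)] by blast
    qed
  qed
  ultimately show ?thesis
    unfolding nonprojective_frobenius_algebra_def
    using bilinear_mult[OF f(1)] fg A.unital_algebra_axioms by blast
qed

text \<open>Associativity gives \<open>p x y = p \<one> (x y)\<close>, so the form is recovered from
  the functional \<open>p \<one>\<close>.\<close>

lemma functional_of_nondegenerate_form:
  assumes "nonprojective_frobenius_algebra K R"
  obtains f where "functional f" "left_nondegenerate {\<zero>} f" "right_nondegenerate {\<zero>} f"
proof -
  obtain p where p: "bilinear_form K R p" "associative_form R p" "nondegenerate_form R p"
    using assms unfolding nonprojective_frobenius_algebra_def by blast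
  have P: "\<And>x y. x \<in> carrier R \<Longrightarrow> y \<in> carrier R \<Longrightarrow> p x y \<in> carrier K"
    "\<And>x y z. x \<in> carrier R \<Longrightarrow> y \<in> carrier R \<Longrightarrow> z \<in> carrier R \<Longrightarrow> p x (y \<oplus> z) = p x y \<oplus>\<^bsub>K\<^esub> p x z"
    "\<And>a x y. a \<in> carrier K \<Longrightarrow> x \<in> carrier R \<Longrightarrow> y \<in> carrier R \<Longrightarrow> p x (a \<odot> y) = a \<otimes>\<^bsub>K\<^esub> p x y"
    "\<And>a x y. a \<in> carrier K \<Longrightarrow> x \<in> carrier R \<Longrightarrow> y \<in> carrier R \<Longrightarrow> p (a \<odot> x) y = a \<otimes>\<^bsub>K\<^esub> p x y"
    using p(1) unfolding bilinear_form_def by blast+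
  define f where "f = p \<one>"
  have pf: "p x y = f (x \<otimes> y)" if "x \<in> carrier R" "y \<in> carrier R" for x y
    using p(2) that unfolding associative_form_def f_def by (metis A.l_one A.one_closed)
  have f: "functional f" unfolding f_def by (rule linear_onI) (use P in auto)
  have "left_nondegenerate {\<zero>} f"
    unfolding left_nondegenerate_def
  proof (intro ballI impI)
    fix x assume x: "x \<in> carrier R" "\<forall>r\<in>carrier R. f (r \<otimes> x) = \<zero>\<^bsub>K\<^esub>"
    have "form_beta R p x = form_beta R p \<zero>"
      using x pf functional_zero[OF f] by (auto simp: form_beta_def fun_eq_iff)
    then show "x \<in> {\<zero>}" using p(3) x(1) by (auto simp: nondegenerate_form_def dest: inj_onD)
  qed
  moreover have "right_nondegenerate {\<zero>} f"
    unfolding right_nondegenerate_def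
  proof (intro ballI impI)
    fix x assume x: "x \<in> carrier R" "\<forall>r\<in>carrier R. f (x \<otimes> r) = \<zero>\<^bsub>K\<^esub>"
    have "form_alpha R p x = form_alpha R p \<zero>"
      using x pf functional_zero[OF f] by (auto simp: form_alpha_def fun_eq_iff)
    then show "x \<in> {\<zero>}" using p(3) x(1) by (auto simp: nondegenerate_form_def dest: inj_onD)
  qed
  ultimately show ?thesis using that f by blast
qed

lemma nonprojective_frobenius_iff:
  assumes art: "left_artinian K"
  shows "nonprojective_frobenius_algebra K R \<longleftrightarrow> frobenius_ring R"
proof -
  let ?J = "jacobson_radical R"
  interpret op: self_dual_algebra K "opposite_ring R" by (rule opposite)
  have artR: "left_artinian R" "left_artinian (opposite_ring R)"
    using left_artinian_algebra[OF art] op.left_artinian_algebra[OF art] by blast+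
  obtain I :: "'r set set" and e where pd: "primitive_decomposition R ?J I e"
    using A.artinian_primitive_decomposition[OF artR(1)] by blast
  interpret P: primitive_decomposition R ?J I e by (rule pd)
  interpret Q: primitive_decomposition "opposite_ring R" ?J I e by (rule P.opposite)
  obtain m where m: "functional m" "\<And>j. j \<in> ?J \<Longrightarrow> m j = \<zero>\<^bsub>K\<^esub>"
    "left_nondegenerate ?J m" "right_nondegenerate ?J m"
    using functional_nondegenerate_mod_radical[OF pd] by metis
  have nd_op: "op.left_nondegenerate = right_nondegenerate" "op.right_nondegenerate = left_nondegenerate"
    by (simp_all add: fun_eq_iff op.left_nondegenerate_def op.right_nondegenerate_def
        left_nondegenerate_def right_nondegenerate_def)
  have m_op: "linear_on K (opposite_ring R) (carrier (opposite_ring R)) m"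
    "op.left_nondegenerate ?J m" "op.right_nondegenerate ?J m"
    using m by (simp_all add: nd_op)
  show ?thesis
  proof
    assume "nonprojective_frobenius_algebra K R"
    then obtain f where f: "functional f" "left_nondegenerate {\<zero>} f" "right_nondegenerate {\<zero>} f"
      using functional_of_nondegenerate_form by metis
    have "\<exists>z. socle_generator R ?J z"
      by (rule socle_generator_of_nondegenerate[OF f P.J_left_ideal P.J_right m P.socle_eq])
    moreover have "\<exists>z. socle_generator (opposite_ring R) ?J z"
      by (rule op.socle_generator_of_nondegenerate[OF _ _ _ Q.J_left_ideal Q.J_right m_op(1) m(2) m_op(2,3) Q.socle_eq])
        (use f in \<open>simp_all add: nd_op\<close>)
    ultimately show "frobenius_ring R"
      using artR by (simp add: A.frobenius_ring_iff right_artinian_def)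
  next
    assume "frobenius_ring R"
    then obtain z w where zw: "socle_generator R ?J z" "socle_generator (opposite_ring R) ?J w"
      by (auto simp: A.frobenius_ring_iff)
    obtain l where l: "functional l" "left_nondegenerate {\<zero>} l"
      using left_nondegenerate_of_socle_generator[OF artR(1) zw(1) m(1,2,3)] by metis
    obtain q where "linear_on K (opposite_ring R) (carrier (opposite_ring R)) q"
      "op.left_nondegenerate {\<zero>\<^bsub>opposite_ring R\<^esub>} q"
      using op.left_nondegenerate_of_socle_generator[OF artR(2) zw(2) m_op(1) m(2) m_op(2)] by metis
    then have q: "functional q" "right_nondegenerate {\<zero>} q" by (simp_all add: nd_op)
    \<comment> \<open>The form comes from \<open>q\<close>; \<open>l\<close> serves to show that
      \<open>q\<close> is nondegenerate on the left as well.\<close>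
    show "nonprojective_frobenius_algebra K R"
      by (rule nondegenerate_form_of_functional[OF q(1) left_nondegenerate_of_right[OF art l q] q(2)])
  qed
qed

end

theorem theorem18:
  fixes K :: "('k, 'm) ring_scheme" and R :: "('k, 'r, 'n) module_scheme"
  assumes "cring K" and "frobenius_ring K"
    and "unital_algebra K R" and "finitely_generated_module K R"
  shows "nonprojective_frobenius_algebra K R \<longleftrightarrow> frobenius_ring R"
proof -
  interpret unital_algebra K R by (rule assms(3))
  interpret self_dual_ring K by (rule cring.frobenius_self_dual[OF assms(1,2)])
  interpret self_dual_algebra K R by unfold_locales (rule assms(4))
  have "left_artinian K" using assms(2) by (simp add: frobenius_ring_def)
  then show ?thesis by (rule nonprojective_frobenius_iff)
qed

end
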